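(* Let $G$ be a Lie group equipped with a left-invariant Riemannian metric $g$, let $K$ be a semisimple Lie subgroup of $G$ of codimension two, and let $\mathcal{F}$ be the left-invariant foliation on $G$ generated by $K$. Then $\mathcal{F}$ is Riemannian.
   Context: Let $\mathfrak{k}\subset\mathfrak{g}$ be the Lie algebras of $K$ and $G$, and let $\mathfrak{m}$ be the orthogonal complement of $\mathfrak{k}$ in $\mathfrak{g}$ with respect to $g$. $\mathcal{V}$ is the left-invariant integrable distribution on $G$ generated by $\mathfrak{k}$, $\mathcal{H}$ is its orthogonal distribution (generated by $\mathfrak{m}$), and $\mathcal{F}$ is the foliation tangent to $\mathcal{V}$; the symbol $\mathcal{V}$ also denotes the orthogonal projection onto the corresponding subbundle of $TG$. With $\nabla$ the Levi-Civita connection of $g$, the second fundamental form of $\mathcal{H}$ is $B^{\mathcal{H}}(X,Y)=\tfrac12\mathcal{V}(\nabla_XY+\nabla_YX)$ for $X,Y\in\mathcal{H}$. The foliation $\mathcal{F}$ is conformal if there is a vector field $V\in\mathcal{V}$ such that $B^{\mathcal{H}}(X,Y)=g(X,Y)\,V$ for all $X,Y\in\mathcal{H}$, and Riemannian if this holds with $V=0$, i.e. $B^{\mathcal{H}}=0$.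
   Formalization: The formal theorem assumes in addition that the foliation F is conformal; without this the claim fails, e.g. for K = SL_2(R) in the semidirect product of SL_2(R) with R^2, with sl_2 orthogonal to R^2. *)

theory Defs
  imports "HOL-Analysis.Analysis" "HOL-Library.Function_Algebras" "HOL-Algebra.Group"
begin

text \<open>
  Tangent vectors are real-valued operators on functions and vector fields are functions from
  points to such operators, so both live in function spaces with the pointwise operations.
\<close>

instantiation "fun" :: (type, real_vector) real_vector
begin

definition scaleR_fun :: "real \<Rightarrow> ('a \<Rightarrow> 'b) \<Rightarrow> 'a \<Rightarrow> 'b"
  where "scaleR_fun c f = (\<lambda>x. c *\<^sub>R f x)"

instance
  by standard (auto simp: scaleR_fun_def plus_fun_def scaleR_add_right scaleR_add_left)

end


subsection \<open>Smooth manifolds\<close>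

text \<open>\<open>Ck_on k U f\<close>: on the open set \<open>U\<close>, \<open>f\<close> is \<open>k\<close> times continuously differentiable.\<close>

primrec Ck_on :: "nat \<Rightarrow> 'a::euclidean_space set \<Rightarrow> ('a \<Rightarrow> 'b::euclidean_space) \<Rightarrow> bool" where
  "Ck_on 0 U f \<longleftrightarrow> continuous_on U f"
| "Ck_on (Suc k) U f \<longleftrightarrow>
     (\<forall>x\<in>U. f differentiable (at x)) \<and> (\<forall>v. Ck_on k U (\<lambda>x. frechet_derivative f (at x) v))"

text \<open>
  Smoothness on an arbitrary set means that there are local smooth extensions; for open sets
  this is ordinary smoothness. It is needed for relatively open subsets of a linear subspace.
\<close>

definition smooth_on :: "'a::euclidean_space set \<Rightarrow> ('a \<Rightarrow> 'b::euclidean_space) \<Rightarrow> bool" where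
  "smooth_on S f \<longleftrightarrow>
     (\<forall>x\<in>S. \<exists>U h. open U \<and> x \<in> U \<and> (\<forall>k. Ck_on k U h) \<and> (\<forall>y\<in>S \<inter> U. f y = h y))"

text \<open>
  The charts of a manifold take values in the linear subspace \<open>model\<close> of a Euclidean space.
  The subspace is there because Euclidean space types have positive dimension, while
  0-dimensional manifolds (such as discrete subgroups) have to be covered.
\<close>

record ('a, 'e) manifold =
  mtop :: "'a topology"
  atlas :: "('a set \<times> ('a \<Rightarrow> 'e)) set"
  model :: "'e set"

definition points :: "('a, 'e) manifold \<Rightarrow> 'a set" where
  "points M = topspace (mtop M)"

definition mdim :: "('a, 'e::euclidean_space) manifold \<Rightarrow> nat" where
  "mdim M = dim (model M)"

definition smooth_manifold :: "('a, 'e::euclidean_space) manifold \<Rightarrow> bool" where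
  "smooth_manifold M \<longleftrightarrow>
     Hausdorff_space (mtop M) \<and> second_countable (mtop M) \<and> subspace (model M) \<and>
     (\<forall>(U, \<phi>)\<in>atlas M. openin (mtop M) U \<and>
        openin (top_of_set (model M)) (\<phi> ` U) \<and>
        homeomorphic_map (subtopology (mtop M) U) (top_of_set (\<phi> ` U)) \<phi>) \<and>
     \<Union> (fst ` atlas M) = points M \<and>
     (\<forall>(U, \<phi>)\<in>atlas M. \<forall>(V, \<psi>)\<in>atlas M. smooth_on (\<phi> ` (U \<inter> V)) (\<lambda>x. \<psi> (inv_into U \<phi> x)))"

definition smooth_map ::
  "('a, 'e::euclidean_space) manifold \<Rightarrow> ('b, 'f::euclidean_space) manifold \<Rightarrow> ('a \<Rightarrow> 'b) \<Rightarrow> bool"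
where
  "smooth_map M N F \<longleftrightarrow>
     continuous_map (mtop M) (mtop N) F \<and>
     (\<forall>(U, \<phi>)\<in>atlas M. \<forall>(V, \<psi>)\<in>atlas N.
        smooth_on (\<phi> ` {p\<in>U. F p \<in> V}) (\<lambda>x. \<psi> (F (inv_into U \<phi> x))))"

definition smooth_fun_on :: "('a, 'e::euclidean_space) manifold \<Rightarrow> 'a set \<Rightarrow> ('a \<Rightarrow> real) \<Rightarrow> bool" where
  "smooth_fun_on M W f \<longleftrightarrow>
     openin (mtop M) W \<and>
     (\<forall>(U, \<phi>)\<in>atlas M. smooth_on (\<phi> ` (U \<inter> W)) (\<lambda>x. f (inv_into U \<phi> x)))"

abbreviation smooth_fun :: "('a, 'e::euclidean_space) manifold \<Rightarrow> ('a \<Rightarrow> real) \<Rightarrow> bool" where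
  "smooth_fun M \<equiv> smooth_fun_on M (points M)"

definition smooth_fun_at :: "('a, 'e::euclidean_space) manifold \<Rightarrow> 'a \<Rightarrow> ('a \<Rightarrow> real) \<Rightarrow> bool" where
  "smooth_fun_at M p f \<longleftrightarrow> (\<exists>W. p \<in> W \<and> smooth_fun_on M W f)"

definition prod_manifold ::
  "('a, 'e::euclidean_space) manifold \<Rightarrow> ('b, 'f::euclidean_space) manifold \<Rightarrow> ('a \<times> 'b, 'e \<times> 'f) manifold"
where
  "prod_manifold M N =
     \<lparr>mtop = prod_topology (mtop M) (mtop N),
      atlas = {(U \<times> V, map_prod \<phi> \<psi>) | U \<phi> V \<psi>. (U, \<phi>) \<in> atlas M \<and> (V, \<psi>) \<in> atlas N},
      model = model M \<times> model N\<rparr>"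

definition interval_manifold :: "real \<Rightarrow> (real, real) manifold" where
  "interval_manifold \<epsilon> =
     \<lparr>mtop = top_of_set {- \<epsilon><..<\<epsilon>}, atlas = {({- \<epsilon><..<\<epsilon>}, \<lambda>t. t)}, model = UNIV\<rparr>"


subsection \<open>Tangent vectors and vector fields\<close>

text \<open>
  A tangent vector at \<open>p\<close> is the velocity at time 0 of a smooth curve through \<open>p\<close>, regarded as an
  operator on the functions that are smooth near \<open>p\<close>. Its value is set to 0 on all
  other functions, so that equal tangent vectors are equal as HOL functions.
\<close>

type_synonym 'a tvec = "('a \<Rightarrow> real) \<Rightarrow> real"
type_synonym 'a vfield = "'a \<Rightarrow> 'a tvec"
type_synonym 'a distribution = "'a \<Rightarrow> 'a tvec set"

definition velocity :: "('a, 'e::euclidean_space) manifold \<Rightarrow> (real \<Rightarrow> 'a) \<Rightarrow> 'a tvec" where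
  "velocity M \<gamma> = (\<lambda>f. if smooth_fun_at M (\<gamma> 0) f then deriv (\<lambda>t. f (\<gamma> t)) 0 else 0)"

definition tangent_space :: "('a, 'e::euclidean_space) manifold \<Rightarrow> 'a distribution" where
  "tangent_space M p =
     {velocity M \<gamma> | \<gamma> \<epsilon>. \<epsilon> > 0 \<and> smooth_map (interval_manifold \<epsilon>) M \<gamma> \<and> \<gamma> 0 = p}"

definition differential :: "('b, 'f::euclidean_space) manifold \<Rightarrow> ('a \<Rightarrow> 'b) \<Rightarrow> 'a \<Rightarrow> 'a tvec \<Rightarrow> 'b tvec"
where
  "differential N F p v = (\<lambda>f. if smooth_fun_at N (F p) f then v (\<lambda>x. f (F x)) else 0)"

definition vector_field :: "('a, 'e::euclidean_space) manifold \<Rightarrow> 'a vfield \<Rightarrow> bool" where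
  "vector_field M X \<longleftrightarrow>
     (\<forall>p\<in>points M. X p \<in> tangent_space M p) \<and> (\<forall>p. p \<notin> points M \<longrightarrow> X p = 0) \<and>
     (\<forall>W f. smooth_fun_on M W f \<longrightarrow> smooth_fun_on M W (\<lambda>p. X p f))"

definition lie_bracket ::
  "('a, 'e::euclidean_space) manifold \<Rightarrow> 'a vfield \<Rightarrow> 'a vfield \<Rightarrow> 'a vfield" where
  "lie_bracket M X Y =
     (\<lambda>p f. if smooth_fun_at M p f then X p (\<lambda>q. Y q f) - Y p (\<lambda>q. X q f) else 0)"

definition section_of :: "('a, 'e::euclidean_space) manifold \<Rightarrow> 'a distribution \<Rightarrow> 'a vfield \<Rightarrow> bool" where
  "section_of M \<D> X \<longleftrightarrow> vector_field M X \<and> (\<forall>p\<in>points M. X p \<in> \<D> p)"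


subsection \<open>Riemannian metrics and the Levi-Civita connection\<close>

type_synonym 'a metric_tensor = "'a \<Rightarrow> 'a tvec \<Rightarrow> 'a tvec \<Rightarrow> real"

definition riemannian_metric :: "('a, 'e::euclidean_space) manifold \<Rightarrow> 'a metric_tensor \<Rightarrow> bool" where
  "riemannian_metric M g \<longleftrightarrow>
     (\<forall>p\<in>points M.
        (\<forall>u\<in>tangent_space M p. \<forall>v\<in>tangent_space M p. g p u v = g p v u) \<and>
        (\<forall>u\<in>tangent_space M p. \<forall>v\<in>tangent_space M p. \<forall>w\<in>tangent_space M p. \<forall>a b.
           g p (a *\<^sub>R u + b *\<^sub>R v) w = a * g p u w + b * g p v w) \<and>
        (\<forall>u\<in>tangent_space M p. u \<noteq> 0 \<longrightarrow> g p u u > 0)) \<and>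
     (\<forall>X Y. vector_field M X \<longrightarrow> vector_field M Y \<longrightarrow> smooth_fun M (\<lambda>p. g p (X p) (Y p)))"

definition affine_connection ::
  "('a, 'e::euclidean_space) manifold \<Rightarrow> ('a vfield \<Rightarrow> 'a vfield \<Rightarrow> 'a vfield) \<Rightarrow> bool" where
  "affine_connection M D \<longleftrightarrow>
     (\<forall>X Y. vector_field M X \<longrightarrow> vector_field M Y \<longrightarrow> vector_field M (D X Y)) \<and>
     (\<forall>X Y Z f h. vector_field M X \<longrightarrow> vector_field M Y \<longrightarrow> vector_field M Z \<longrightarrow>
        smooth_fun M f \<longrightarrow> smooth_fun M h \<longrightarrow>
        D (\<lambda>p. f p *\<^sub>R X p + h p *\<^sub>R Y p) Z = (\<lambda>p. f p *\<^sub>R D X Z p + h p *\<^sub>R D Y Z p)) \<and>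
     (\<forall>X Y Z. vector_field M X \<longrightarrow> vector_field M Y \<longrightarrow> vector_field M Z \<longrightarrow>
        D X (Y + Z) = D X Y + D X Z) \<and>
     (\<forall>X Y f. vector_field M X \<longrightarrow> vector_field M Y \<longrightarrow> smooth_fun M f \<longrightarrow>
        D X (\<lambda>p. f p *\<^sub>R Y p) = (\<lambda>p. X p f *\<^sub>R Y p + f p *\<^sub>R D X Y p))"

definition levi_civita_connection ::
  "('a, 'e::euclidean_space) manifold \<Rightarrow> 'a metric_tensor \<Rightarrow>
   ('a vfield \<Rightarrow> 'a vfield \<Rightarrow> 'a vfield) \<Rightarrow> bool" where
  "levi_civita_connection M g D \<longleftrightarrow>
     affine_connection M D \<and>
     (\<forall>X Y. vector_field M X \<longrightarrow> vector_field M Y \<longrightarrow> D X Y - D Y X = lie_bracket M X Y) \<and>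
     (\<forall>X Y Z. vector_field M X \<longrightarrow> vector_field M Y \<longrightarrow> vector_field M Z \<longrightarrow>
        (\<forall>p\<in>points M. X p (\<lambda>q. g q (Y q) (Z q)) = g p (D X Y p) (Z p) + g p (Y p) (D X Z p)))"


subsection \<open>Conformal and Riemannian foliations\<close>

text \<open>A foliation is represented by its tangent distribution \<open>\<V>\<close>.\<close>

definition orthogonal_distribution ::
  "('a, 'e::euclidean_space) manifold \<Rightarrow> 'a metric_tensor \<Rightarrow> 'a distribution \<Rightarrow> 'a distribution" where
  "orthogonal_distribution M g \<V> p = {u\<in>tangent_space M p. \<forall>v\<in>\<V> p. g p u v = 0}"

definition orthogonal_projection ::
  "'a metric_tensor \<Rightarrow> 'a distribution \<Rightarrow> 'a \<Rightarrow> 'a tvec \<Rightarrow> 'a tvec" where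
  "orthogonal_projection g \<V> p w = (THE v. v \<in> \<V> p \<and> (\<forall>u\<in>\<V> p. g p (w - v) u = 0))"

text \<open>The second fundamental form of the orthogonal distribution of \<open>\<V>\<close>.\<close>

definition second_fundamental_form ::
  "'a metric_tensor \<Rightarrow> ('a vfield \<Rightarrow> 'a vfield \<Rightarrow> 'a vfield) \<Rightarrow> 'a distribution \<Rightarrow>
   'a vfield \<Rightarrow> 'a vfield \<Rightarrow> 'a vfield" where
  "second_fundamental_form g D \<V> X Y =
     (\<lambda>p. (1 / 2) *\<^sub>R orthogonal_projection g \<V> p (D X Y p + D Y X p))"

definition conformal_with ::
  "('a, 'e::euclidean_space) manifold \<Rightarrow> 'a metric_tensor \<Rightarrow>
   ('a vfield \<Rightarrow> 'a vfield \<Rightarrow> 'a vfield) \<Rightarrow> 'a distribution \<Rightarrow> 'a vfield \<Rightarrow> bool" where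
  "conformal_with M g D \<V> Z \<longleftrightarrow>
     (\<forall>X Y. section_of M (orthogonal_distribution M g \<V>) X \<longrightarrow>
        section_of M (orthogonal_distribution M g \<V>) Y \<longrightarrow>
        (\<forall>p\<in>points M. second_fundamental_form g D \<V> X Y p = g p (X p) (Y p) *\<^sub>R Z p))"

definition conformal_foliation ::
  "('a, 'e::euclidean_space) manifold \<Rightarrow> 'a metric_tensor \<Rightarrow>
   ('a vfield \<Rightarrow> 'a vfield \<Rightarrow> 'a vfield) \<Rightarrow> 'a distribution \<Rightarrow> bool" where
  "conformal_foliation M g D \<V> \<longleftrightarrow> (\<exists>Z. section_of M \<V> Z \<and> conformal_with M g D \<V> Z)"

definition riemannian_foliation ::
  "('a, 'e::euclidean_space) manifold \<Rightarrow> 'a metric_tensor \<Rightarrow>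
   ('a vfield \<Rightarrow> 'a vfield \<Rightarrow> 'a vfield) \<Rightarrow> 'a distribution \<Rightarrow> bool" where
  "riemannian_foliation M g D \<V> \<longleftrightarrow> conformal_with M g D \<V> 0"


subsection \<open>Lie groups and Lie subgroups\<close>

definition lie_group :: "('a, 'm) monoid_scheme \<Rightarrow> ('a, 'e::euclidean_space) manifold \<Rightarrow> bool" where
  "lie_group G M \<longleftrightarrow>
     group G \<and> smooth_manifold M \<and> points M = carrier G \<and>
     smooth_map (prod_manifold M M) M (\<lambda>(x, y). x \<otimes>\<^bsub>G\<^esub> y) \<and>
     smooth_map M M (\<lambda>x. inv\<^bsub>G\<^esub> x)"

definition left_invariant_metric ::
  "('a, 'm) monoid_scheme \<Rightarrow> ('a, 'e::euclidean_space) manifold \<Rightarrow> 'a metric_tensor \<Rightarrow> bool" where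
  "left_invariant_metric G M g \<longleftrightarrow>
     riemannian_metric M g \<and>
     (\<forall>a\<in>carrier G. \<forall>p\<in>carrier G. \<forall>u\<in>tangent_space M p. \<forall>v\<in>tangent_space M p.
        g (a \<otimes>\<^bsub>G\<^esub> p) (differential M (\<lambda>x. a \<otimes>\<^bsub>G\<^esub> x) p u) (differential M (\<lambda>x. a \<otimes>\<^bsub>G\<^esub> x) p v) = g p u v)"

definition lie_algebra ::
  "('a, 'm) monoid_scheme \<Rightarrow> ('a, 'e::euclidean_space) manifold \<Rightarrow> 'a vfield set" where
  "lie_algebra G M =
     {X. vector_field M X \<and>
         (\<forall>a\<in>carrier G. \<forall>p\<in>carrier G. X (a \<otimes>\<^bsub>G\<^esub> p) = differential M (\<lambda>x. a \<otimes>\<^bsub>G\<^esub> x) p (X p))}"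

text \<open>
  Lie subgroups are immersed and need not be closed: the manifold structure \<open>N\<close> of the subgroup
  is extra data, and its topology may be finer than the subspace topology.
\<close>

definition lie_subgroup ::
  "('a, 'm) monoid_scheme \<Rightarrow> ('a, 'e::euclidean_space) manifold \<Rightarrow>
   'a set \<Rightarrow> ('a, 'f::euclidean_space) manifold \<Rightarrow> bool" where
  "lie_subgroup G M K N \<longleftrightarrow>
     subgroup K G \<and> lie_group (G\<lparr>carrier := K\<rparr>) N \<and> smooth_map N M (\<lambda>x. x) \<and>
     (\<forall>p\<in>K. inj_on (differential M (\<lambda>x. x) p) (tangent_space N p))"

text \<open>
  The Lie algebra of a Lie subgroup, as a subalgebra of the Lie algebra of \<open>G\<close>: the
  left-invariant fields whose value at the identity is tangent to the subgroup.
\<close>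

definition lie_subalgebra ::
  "('a, 'm) monoid_scheme \<Rightarrow> ('a, 'e::euclidean_space) manifold \<Rightarrow>
   ('a, 'f::euclidean_space) manifold \<Rightarrow> 'a vfield set" where
  "lie_subalgebra G M N =
     {X\<in>lie_algebra G M. X \<one>\<^bsub>G\<^esub> \<in> differential M (\<lambda>x. x) \<one>\<^bsub>G\<^esub> ` tangent_space N \<one>\<^bsub>G\<^esub>}"

definition generated_distribution :: "'a vfield set \<Rightarrow> 'a distribution" where
  "generated_distribution \<k> p = span ((\<lambda>X. X p) ` \<k>)"


subsection \<open>Semisimplicity\<close>

text \<open>The trace of an endomorphism of a finite-dimensional subspace \<open>L\<close>, in an arbitrary basis.\<close>

definition trace_on :: "'v::real_vector set \<Rightarrow> ('v \<Rightarrow> 'v) \<Rightarrow> real" where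
  "trace_on L T =
     (let B = (SOME B. independent B \<and> span B = L) in \<Sum>b\<in>B. representation B (T b) b)"

definition killing_form :: "'v::real_vector set \<Rightarrow> ('v \<Rightarrow> 'v \<Rightarrow> 'v) \<Rightarrow> 'v \<Rightarrow> 'v \<Rightarrow> real" where
  "killing_form L br x y = trace_on L (\<lambda>z. br x (br y z))"

text \<open>
  Helgason's definition: a real Lie algebra is semisimple if its Killing form is nondegenerate,
  and a Lie group is semisimple if its Lie algebra is. (The zero algebra is semisimple.)
\<close>

definition semisimple_lie_algebra :: "'v::real_vector set \<Rightarrow> ('v \<Rightarrow> 'v \<Rightarrow> 'v) \<Rightarrow> bool" where
  "semisimple_lie_algebra L br \<longleftrightarrow> (\<forall>x\<in>L. (\<forall>y\<in>L. killing_form L br x y = 0) \<longrightarrow> x = 0)"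

end

theory Submission
  imports Defs
begin

text \<open>
  For left-invariant fields \<open>X\<close>, \<open>Y\<close> and \<open>W \<in> \<k>\<close>, metric compatibility and vanishing torsion give
  \<open>g (\<nabla>\<^sub>X Y + \<nabla>\<^sub>Y X) W = g [W, X] Y + g X [W, Y]\<close>. Hence conformality with vector field \<open>Z\<close> says that
  for horizontal \<open>X\<close>, \<open>Y\<close> the right-hand side is \<open>2 (l W) (g X Y)\<close> with \<open>l W = g Z W\<close>: the action of
  \<open>W\<close> on \<open>\<g>/\<k>\<close>, identified with the horizontal left-invariant fields, is \<open>l W\<close> times the identity plus
  a skew map. Commutators of such maps are skew, so \<open>l\<close> vanishes on \<open>[\<k>, \<k>]\<close>. If the
  Killing form is nondegenerate, it represents \<open>l\<close> by some \<open>x\<close>, and its invariance forces \<open>x\<close> to be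
  central, hence zero. So \<open>l = 0\<close>, and since \<open>Z\<close> is vertical, \<open>Z\<close> vanishes wherever horizontal vectors exist.

  That \<open>\<k>\<close> is a Lie algebra, and that there are enough left-invariant fields, is verified in charts.
\<close>

section \<open>Iterated derivatives\<close>

text \<open>Conformality is a hypothesis with content: in the semidirect product of SL(2,R) with the
  plane, \<open>\<k>\<close> = sl(2,R) is semisimple of codimension two, but it acts on
  \<open>\<g>/\<k>\<close> by the standard representation, which is skew for no inner product, so
  that foliation is not Riemannian. \<open>Z\<close> is not assumed left-invariant, so the algebra
  is done at one fixed point \<open>p\<close>, with \<open>l\<close> built from \<open>Z p\<close>.
  Left-invariant fields remain usable there because their mutual inner products are constant: such a
  field that is horizontal at \<open>p\<close> is horizontal everywhere, and conformality applies to
  it. Two features of the definitions shape the analysis. Charts take values in a subspace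
  \<open>model M\<close> that may have empty interior, so functions are differentiated through
  smooth extensions to ambient open sets, and each coordinate vector must be shown to lie in the
  model. Tangent vectors are velocities of curves, so even their sums need an argument; coordinates
  in the model replace curves once and for all. \<open>\<k>\<close> is defined by tangency at the
  identity only; its closure under brackets is obtained by extending tangent vectors of
  \<open>K\<close> to left-invariant fields on \<open>K\<close>.\<close>

abbreviation Cinf_on :: "'a::euclidean_space set \<Rightarrow> ('a \<Rightarrow> 'b::euclidean_space) \<Rightarrow> bool" where
  "Cinf_on U f \<equiv> \<forall>k. Ck_on k U f"

lemma frechet_derivative_eqI:
  "(f has_derivative f') (at x) \<Longrightarrow> frechet_derivative f (at x) = f'"
  by (metis frechet_derivative_at)

lemma Ck_on_SucI:
  assumes "\<And>x. x \<in> U \<Longrightarrow> (f has_derivative f' x) (at x)"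
    and "\<And>v. Ck_on k U (\<lambda>x. frechet_derivative f (at x) v)"
  shows "Ck_on (Suc k) U f"
  using assms unfolding Ck_on.simps differentiable_def by blast

text \<open>On an open set the derivative at a point sees only nearby values, so equality of
  functions passes to all iterated derivatives.\<close>

lemma Ck_on_cong:
  assumes "open U" "\<And>x. x \<in> U \<Longrightarrow> f x = h x" "Ck_on k U f"
  shows "Ck_on k U h"
  using assms
proof (induction k arbitrary: f h)
  case 0
  then show ?case using continuous_on_cong by force
next
  case (Suc k)
  have d: "(h has_derivative frechet_derivative f (at x)) (at x)" if "x \<in> U" for x
    using Suc.prems that
    by (intro has_derivative_transform_within_open[of f _ x UNIV U h])
       (auto simp: frechet_derivative_works)
  have e: "frechet_derivative f (at x) = frechet_derivative h (at x)" if "x \<in> U" for x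
    using d[OF that] frechet_derivative_at by blast
  show ?case
  proof (rule Ck_on_SucI[OF d])
    fix v
    show "Ck_on k U (\<lambda>x. frechet_derivative h (at x) v)"
      by (rule Suc.IH[OF Suc.prems(1), of "\<lambda>x. frechet_derivative f (at x) v"])
         (use Suc.prems e in auto)
  qed
qed

text \<open>\<open>frechet_derivative\<close> is given by a choice operator; here an explicit
  derivative formula takes its place, which is what the inductions on \<open>k\<close> below
  produce.\<close>

lemma Ck_on_SucI_open:
  assumes "open U" and d: "\<And>x. x \<in> U \<Longrightarrow> (f has_derivative f' x) (at x)"
    and "\<And>v. Ck_on k U (\<lambda>x. f' x v)"
  shows "Ck_on (Suc k) U f"
proof (rule Ck_on_SucI[OF d])
  fix v
  show "Ck_on k U (\<lambda>x. frechet_derivative f (at x) v)"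
    by (rule Ck_on_cong[OF assms(1) _ assms(3)]) (simp add: frechet_derivative_eqI[OF d])
qed

lemma Ck_on_subset: "Ck_on k U f \<Longrightarrow> V \<subseteq> U \<Longrightarrow> Ck_on k V f"
  by (induction k arbitrary: f) (auto intro: continuous_on_subset)

lemma Ck_on_continuous: "Ck_on k U f \<Longrightarrow> continuous_on U f"
  by (cases k)
     (auto intro!: continuous_at_imp_continuous_on differentiable_imp_continuous_within)

lemma Cinf_on_continuous: "Cinf_on U f \<Longrightarrow> continuous_on U f"
  using Ck_on_continuous by blast

lemma Ck_on_SucD: "Ck_on (Suc k) U f \<Longrightarrow> Ck_on k U f"
proof (induction k arbitrary: f)
  case 0
  then have "continuous_on U f" by (rule Ck_on_continuous)
  then show ?case by simp
next
  case (Suc k)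
  show ?case unfolding Ck_on.simps(2)[of k]
    using Suc.IH Suc.prems unfolding Ck_on.simps(2)[of "Suc k"] by blast
qed

lemma Cinf_on_has_derivative:
  "Cinf_on U f \<Longrightarrow> x \<in> U \<Longrightarrow> (f has_derivative frechet_derivative f (at x)) (at x)"
  by (metis Ck_on.simps(2) frechet_derivative_works)

lemma Cinf_on_derivative:
  "Cinf_on U f \<Longrightarrow> Cinf_on U (\<lambda>x. frechet_derivative f (at x) v)"
  by (metis Ck_on.simps(2))

lemma Ck_on_const: "Ck_on k U (\<lambda>x. c)"
  by (induction k arbitrary: c) (auto simp: frechet_derivative_const)

lemma Ck_on_bounded_linear:
  assumes "bounded_linear L" shows "Ck_on k U L"
proof (cases k)
  case 0
  then show ?thesis using assms linear_continuous_on by auto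
next
  case (Suc m)
  have "(L has_derivative L) (at x)" for x
    using assms bounded_linear_imp_has_derivative by blast
  moreover from this have "frechet_derivative L (at x) v = L v" for x v
    by (metis frechet_derivative_eqI)
  ultimately show ?thesis unfolding Suc
    by (intro Ck_on_SucI) (auto simp: Ck_on_const)
qed

lemma Ck_on_linear_compose:
  assumes "open U" and L: "bounded_linear L" and "Ck_on k U f"
  shows "Ck_on k U (\<lambda>x. L (f x))"
  using assms(3)
proof (induction k arbitrary: f)
  case 0
  then show ?case
    using L by (auto intro: bounded_linear.continuous_on)
next
  case (Suc k)
  show ?case
  proof (rule Ck_on_SucI_open[OF assms(1)])
    show "((\<lambda>x. L (f x)) has_derivative (\<lambda>v. L (frechet_derivative f (at x) v))) (at x)"
      if "x \<in> U" for x
      using Suc.prems that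
      by (intro bounded_linear.has_derivative[OF L]) (auto simp: frechet_derivative_works)
    show "Ck_on k U (\<lambda>x. L (frechet_derivative f (at x) v))" for v
      using Suc by auto
  qed
qed

lemma Ck_on_add:
  assumes "open U" "Ck_on k U f" "Ck_on k U h"
  shows "Ck_on k U (\<lambda>x. f x + h x)"
  using assms(2,3)
proof (induction k arbitrary: f h)
  case 0
  then show ?case by (auto intro: continuous_on_add)
next
  case (Suc k)
  show ?case
  proof (rule Ck_on_SucI_open[OF assms(1)])
    show "((\<lambda>x. f x + h x) has_derivative
        (\<lambda>v. frechet_derivative f (at x) v + frechet_derivative h (at x) v)) (at x)"
      if "x \<in> U" for x
      using Suc.prems that
      by (intro has_derivative_add) (auto simp: frechet_derivative_works)
    show "Ck_on k U (\<lambda>x. frechet_derivative f (at x) v + frechet_derivative h (at x) v)" for v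
      using Suc by auto
  qed
qed

lemma Ck_on_sum:
  assumes "open U" "\<And>i. i \<in> I \<Longrightarrow> Ck_on k U (f i)"
  shows "Ck_on k U (\<lambda>x. \<Sum>i\<in>I. f i x)"
  using assms(2)
  by (induction I rule: infinite_finite_induct)
     (auto simp: Ck_on_const intro!: Ck_on_add[OF assms(1)])

lemma Ck_on_scaleR:
  fixes f :: "'a::euclidean_space \<Rightarrow> real" and h :: "'a \<Rightarrow> 'b::euclidean_space"
  assumes "open U" "Ck_on k U f" "Ck_on k U h"
  shows "Ck_on k U (\<lambda>x. f x *\<^sub>R h x)"
  using assms(2,3)
proof (induction k arbitrary: f h)
  case 0
  then show ?case by (auto intro: continuous_on_scaleR)
next
  case (Suc k)
  \<comment> \<open>The product rule leaves one factor undifferentiated, so both factors are needed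
    at the lower order too.\<close>
  have k: "Ck_on k U f" "Ck_on k U h" using Suc.prems by (auto intro: Ck_on_SucD simp del: Ck_on.simps)
  show ?case
  proof (rule Ck_on_SucI_open[OF assms(1)])
    show "((\<lambda>x. f x *\<^sub>R h x) has_derivative
        (\<lambda>v. f x *\<^sub>R frechet_derivative h (at x) v + frechet_derivative f (at x) v *\<^sub>R h x)) (at x)"
      if "x \<in> U" for x
      using Suc.prems that
      by (intro has_derivative_scaleR) (auto simp: frechet_derivative_works)
    show "Ck_on k U (\<lambda>x. f x *\<^sub>R frechet_derivative h (at x) v
        + frechet_derivative f (at x) v *\<^sub>R h x)" for v
      using Suc.prems k by (intro Ck_on_add assms(1) Suc.IH) auto
  qed
qed

lemma linear_Basis_expansion:
  fixes L :: "'a::euclidean_space \<Rightarrow> 'b::real_vector"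
  assumes "linear L"
  shows "L w = (\<Sum>b\<in>Basis. (w \<bullet> b) *\<^sub>R L b)"
  by (subst euclidean_representation[of w, symmetric])
     (simp only: linear_sum[OF assms] linear_scale[OF assms])

text \<open>In the chain rule the outer derivative is taken in the direction \<open>h'(x) v\<close>,
  which moves with \<open>x\<close>, so the induction hypothesis does not apply to it. Expanding
  this direction in \<open>Basis\<close> leaves outer derivatives in fixed directions, with scalar
  coefficients.\<close>

lemma Ck_on_compose:
  assumes "open U" "open V" "Ck_on k U f" "Ck_on k V h" "h ` V \<subseteq> U"
  shows "Ck_on k V (\<lambda>x. f (h x))"
  using assms(3-)
proof (induction k arbitrary: f h)
  case 0
  then show ?case by (auto intro: continuous_on_compose2)
next
  case (Suc k)
  have k: "Ck_on k V h" using Suc.prems by (auto intro: Ck_on_SucD simp del: Ck_on.simps)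
  show ?case
  proof (rule Ck_on_SucI_open[OF assms(2)])
    fix x assume x: "x \<in> V"
    have 1: "(h has_derivative frechet_derivative h (at x)) (at x)"
      "(f has_derivative frechet_derivative f (at (h x))) (at (h x))"
      using Suc.prems x by (auto simp flip: frechet_derivative_works)
    have 2: "frechet_derivative f (at (h x)) w =
        (\<Sum>b\<in>Basis. (w \<bullet> b) *\<^sub>R frechet_derivative f (at (h x)) b)" for w
      by (rule linear_Basis_expansion) (use 1(2) has_derivative_linear in blast)
    have "(\<lambda>v. frechet_derivative f (at (h x)) (frechet_derivative h (at x) v)) =
        (\<lambda>v. \<Sum>b\<in>Basis. (frechet_derivative h (at x) v \<bullet> b) *\<^sub>R frechet_derivative f (at (h x)) b)"
      by (rule ext) (rule 2)
    with has_derivative_compose[OF 1]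
    show "((\<lambda>x. f (h x)) has_derivative
        (\<lambda>v. \<Sum>b\<in>Basis. (frechet_derivative h (at x) v \<bullet> b) *\<^sub>R frechet_derivative f (at (h x)) b)) (at x)"
      by (simp only:)
  next
    fix v
    show "Ck_on k V (\<lambda>x. \<Sum>b\<in>Basis. (frechet_derivative h (at x) v \<bullet> b) *\<^sub>R frechet_derivative f (at (h x)) b)"
      using Suc.prems k
      by (intro Ck_on_sum Ck_on_scaleR Ck_on_linear_compose[OF _ bounded_linear_inner_left] assms(1,2) Suc.IH)
         auto
  qed
qed

lemma Ck_on_Pair:
  assumes "open U" "Ck_on k U f" "Ck_on k U h"
  shows "Ck_on k U (\<lambda>x. (f x, h x))"
proof -
  have "bounded_linear (\<lambda>x::'b. (x, 0::'c))" "bounded_linear (\<lambda>x::'c. (0::'b, x))"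
    by (auto intro: bounded_linear_Pair bounded_linear_ident bounded_linear_zero)
  then have "Ck_on k U (\<lambda>x. (f x, 0) + (0, h x))"
    using assms by (intro Ck_on_add Ck_on_linear_compose[of U "\<lambda>x. (x, 0)"]
          Ck_on_linear_compose[of U "\<lambda>x. (0, x)"]) auto
  then show ?thesis by simp
qed

lemma open_Collect_continuous:
  assumes "open V" "continuous_on V h" "open U"
  shows "open {x\<in>V. h x \<in> U}"
  using continuous_open_preimage[OF assms(2,1,3)] by (simp add: vimage_def Int_def)

text \<open>Two mean value steps: first in \<open>s\<close> for the increment of \<open>F\<close> in
  direction \<open>v\<close>, then in \<open>r\<close> for the derivative of \<open>F\<close> along
  \<open>u\<close>. The left side is unchanged when \<open>u\<close> and \<open>v\<close> are
  exchanged, which drives the symmetry of second derivatives.\<close>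

lemma second_difference_mvt:
  fixes F :: "'a::euclidean_space \<Rightarrow> real"
  assumes C: "Cinf_on O' F" and t: "0 < t"
    and in_O: "\<And>s r. 0 \<le> s \<Longrightarrow> s \<le> t \<Longrightarrow> 0 \<le> r \<Longrightarrow> r \<le> t \<Longrightarrow> x + s *\<^sub>R u + r *\<^sub>R v \<in> O'"
  obtains s r where "0 < s" "s < t" "0 < r" "r < t"
    "F (x + t *\<^sub>R u + t *\<^sub>R v) - F (x + t *\<^sub>R u) - F (x + t *\<^sub>R v) + F x =
     t * t * frechet_derivative (\<lambda>y. frechet_derivative F (at y) u) (at (x + s *\<^sub>R u + r *\<^sub>R v)) v"
proof -
  let ?D = "\<lambda>y. frechet_derivative F (at y)"
  let ?h = "\<lambda>y. ?D y u"
  let ?E = "\<lambda>y. frechet_derivative ?h (at y)"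
  note Fd = Cinf_on_has_derivative[OF C]
  note hd = Cinf_on_has_derivative[OF Cinf_on_derivative[OF C, of u]]
  have p1: "((\<lambda>s. F (x + s *\<^sub>R u + r *\<^sub>R v)) has_derivative (\<lambda>d. d * ?D (x + s *\<^sub>R u + r *\<^sub>R v) u)) (at s)"
    if "0 \<le> s" "s \<le> t" "0 \<le> r" "r \<le> t" for s r
  proof -
    have "((\<lambda>s. x + s *\<^sub>R u + r *\<^sub>R v) has_derivative (\<lambda>d. d *\<^sub>R u)) (at s)"
      by (auto intro!: derivative_eq_intros)
    from has_derivative_compose[OF this Fd[OF in_O[OF that]]]
    show ?thesis
      using linear_scale[OF has_derivative_linear[OF Fd[OF in_O[OF that]]]] by simp
  qed
  have p2: "((\<lambda>r. ?h (x + s *\<^sub>R u + r *\<^sub>R v)) has_derivative (\<lambda>d. d * ?E (x + s *\<^sub>R u + r *\<^sub>R v) v)) (at r)"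
    if "0 \<le> s" "s \<le> t" "0 \<le> r" "r \<le> t" for s r
  proof -
    have "((\<lambda>r. x + s *\<^sub>R u + r *\<^sub>R v) has_derivative (\<lambda>d. d *\<^sub>R v)) (at r)"
      by (auto intro!: derivative_eq_intros)
    from has_derivative_compose[OF this hd[OF in_O[OF that]]]
    show ?thesis
      using linear_scale[OF has_derivative_linear[OF hd[OF in_O[OF that]]]] by simp
  qed
  let ?\<phi> = "\<lambda>s. F (x + s *\<^sub>R u + t *\<^sub>R v) - F (x + s *\<^sub>R u)"
  have d\<phi>: "(?\<phi> has_derivative (\<lambda>d. d * (?h (x + s *\<^sub>R u + t *\<^sub>R v) - ?h (x + s *\<^sub>R u)))) (at s)"
    if "0 \<le> s" "s \<le> t" for s
    using has_derivative_diff[OF p1[OF that, of t] p1[OF that, of 0]] t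
    by (simp add: right_diff_distrib)
  have c\<phi>: "continuous_on {0..t} ?\<phi>"
    using has_derivative_continuous[OF d\<phi>] by (simp add: continuous_at_imp_continuous_on)
  obtain s where s: "0 < s" "s < t" "?\<phi> t - ?\<phi> 0 = (t - 0) * (?h (x + s *\<^sub>R u + t *\<^sub>R v) - ?h (x + s *\<^sub>R u))"
    by (rule mvt[OF t c\<phi>, of "\<lambda>s d. d * (?h (x + s *\<^sub>R u + t *\<^sub>R v) - ?h (x + s *\<^sub>R u))"])
       (use d\<phi> in auto)
  have ch: "continuous_on {0..t} (\<lambda>r. ?h (x + s *\<^sub>R u + r *\<^sub>R v))"
    using has_derivative_continuous[OF p2, of s] s by (simp add: continuous_at_imp_continuous_on)
  obtain r where r: "0 < r" "r < t"
    "?h (x + s *\<^sub>R u + t *\<^sub>R v) - ?h (x + s *\<^sub>R u + 0 *\<^sub>R v) = (t - 0) * ?E (x + s *\<^sub>R u + r *\<^sub>R v) v"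
    by (rule mvt[OF t ch, of "\<lambda>r d. d * ?E (x + s *\<^sub>R u + r *\<^sub>R v) v"])
       (use p2 s in auto)
  show ?thesis
  proof (rule that[of s r])
    show "0 < s" "s < t" "0 < r" "r < t" using s r by auto
    show "F (x + t *\<^sub>R u + t *\<^sub>R v) - F (x + t *\<^sub>R u) - F (x + t *\<^sub>R v) + F x
      = t * t * ?E (x + s *\<^sub>R u + r *\<^sub>R v) v"
      using s(3) r(3) by simp
  qed
qed

text \<open>The same second difference is \<open>t * t\<close> times either mixed derivative, each
  at some nearby point; by continuity the two values at \<open>x\<close> cannot differ.\<close>

lemma second_derivative_symmetric:
  fixes F :: "'a::euclidean_space \<Rightarrow> real"
  assumes "open O'" and C: "Cinf_on O' F" and x: "x \<in> O'"
  shows "frechet_derivative (\<lambda>y. frechet_derivative F (at y) u) (at x) v =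
         frechet_derivative (\<lambda>y. frechet_derivative F (at y) v) (at x) u"
proof (rule ccontr)
  let ?q = "\<lambda>u v x. frechet_derivative (\<lambda>y. frechet_derivative F (at y) u) (at x) v"
  assume ne: "?q u v x \<noteq> ?q v u x"
  \<comment> \<open>Half the gap: numbers closer than \<open>e\<close> to the two different limits
    cannot coincide.\<close>
  define e where "e = \<bar>?q u v x - ?q v u x\<bar> / 2"
  have e: "e > 0" using ne by (simp add: e_def)
  have c: "continuous_on O' (?q u v)" for u v
    using Cinf_on_derivative[OF Cinf_on_derivative[OF C]] Ck_on_continuous by blast
  have ev: "\<forall>\<^sub>F y in at x. dist (?q u v y) (?q u v x) < e" for u v
  proof -
    have "((?q u v) \<longlongrightarrow> ?q u v x) (at x)"
      using c x unfolding continuous_on_eq_continuous_at[OF \<open>open O'\<close>] isCont_def by blast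
    then show ?thesis using e by (rule tendstoD)
  qed
  have "\<forall>\<^sub>F y in at x. y \<in> O'" using x \<open>open O'\<close> by (simp add: eventually_at_in_open')
  then have "\<forall>\<^sub>F y in at x. y \<in> O' \<and> dist (?q u v y) (?q u v x) < e \<and> dist (?q v u y) (?q v u x) < e"
    using ev[of u v] ev[of v u] by eventually_elim auto
  then obtain d where d: "d > 0" "\<And>y. y \<noteq> x \<Longrightarrow> dist y x < d \<Longrightarrow>
      y \<in> O' \<and> dist (?q u v y) (?q u v x) < e \<and> dist (?q v u y) (?q v u x) < e"
    unfolding eventually_at by auto
  have d': "y \<in> O' \<and> dist (?q u v y) (?q u v x) < e \<and> dist (?q v u y) (?q v u x) < e"
    if "dist y x < d" for y
    using d that x e by (cases "y = x") auto
  \<comment> \<open>The summand 1 keeps \<open>n\<close> positive when \<open>u = v = 0\<close>;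
    with \<open>t = d / (2 * n)\<close> the whole parallelogram spanned by
    \<open>t *\<^sub>R u\<close> and \<open>t *\<^sub>R v\<close> stays within distance
    \<open>d / 2\<close> of \<open>x\<close>.\<close>
  define n where "n = norm u + norm v + 1"
  have n: "n > 0" by (simp add: n_def add_nonneg_pos)
  define t where "t = d / (2 * n)"
  have t: "t > 0" unfolding t_def using d(1) n by simp
  have near: "dist (x + s *\<^sub>R u + r *\<^sub>R v) x < d \<and> dist (x + s *\<^sub>R v + r *\<^sub>R u) x < d"
    if "0 \<le> s" "s \<le> t" "0 \<le> r" "r \<le> t" for s r
  proof -
    have "norm (s *\<^sub>R u + r *\<^sub>R v) \<le> t * norm u + t * norm v"
      "norm (s *\<^sub>R v + r *\<^sub>R u) \<le> t * norm v + t * norm u"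
      using that by (auto intro!: norm_triangle_le add_mono mult_right_mono)
    moreover have "t * norm u + t * norm v < d"
    proof -
      have "t * (norm u + norm v) \<le> t * n" using t by (simp add: n_def)
      also have "\<dots> = d / 2"
        unfolding t_def using n by simp
      finally show ?thesis using d(1) by (simp add: distrib_left)
    qed
    ultimately show ?thesis by (simp add: dist_norm add.assoc)
  qed
  have inO: "x + s *\<^sub>R u + r *\<^sub>R v \<in> O'" "x + s *\<^sub>R v + r *\<^sub>R u \<in> O'"
    if "0 \<le> s" "s \<le> t" "0 \<le> r" "r \<le> t" for s r
    using d' near[OF that] by blast+
  obtain s r where 1: "0 < s" "s < t" "0 < r" "r < t"
    "F (x + t *\<^sub>R u + t *\<^sub>R v) - F (x + t *\<^sub>R u) - F (x + t *\<^sub>R v) + F x = t * t * ?q u v (x + s *\<^sub>R u + r *\<^sub>R v)"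
    by (rule second_difference_mvt[OF C t inO(1)])
  obtain s' r' where 2: "0 < s'" "s' < t" "0 < r'" "r' < t"
    "F (x + t *\<^sub>R v + t *\<^sub>R u) - F (x + t *\<^sub>R v) - F (x + t *\<^sub>R u) + F x = t * t * ?q v u (x + s' *\<^sub>R v + r' *\<^sub>R u)"
    by (rule second_difference_mvt[OF C t inO(2)])
  have "t * t * ?q u v (x + s *\<^sub>R u + r *\<^sub>R v) = t * t * ?q v u (x + s' *\<^sub>R v + r' *\<^sub>R u)"
    using 1(5) 2(5) by (simp add: algebra_simps)
  then have eq: "?q u v (x + s *\<^sub>R u + r *\<^sub>R v) = ?q v u (x + s' *\<^sub>R v + r' *\<^sub>R u)"
    using t by simp
  have 3: "dist (?q u v (x + s *\<^sub>R u + r *\<^sub>R v)) (?q u v x) < e"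
    "dist (?q v u (x + s' *\<^sub>R v + r' *\<^sub>R u)) (?q v u x) < e"
    using d' near[of s r] near[of s' r'] 1(1-4) 2(1-4) by (meson less_imp_le)+
  have 4: False if "dist a p < \<bar>p - q\<bar> / 2" "dist b q < \<bar>p - q\<bar> / 2" "a = b" for a b p q :: real
    using that unfolding dist_real_def by (simp add: abs_if field_simps split: if_splits)
  show False
    by (rule 4[OF 3[unfolded e_def] eq])
qed

section \<open>Germs of smooth functions in charts\<close>

lemma chart_facts:
  assumes "smooth_manifold M" "(U, \<phi>) \<in> atlas M"
  shows chart_openin: "openin (mtop M) U"
    and chart_image_openin: "openin (top_of_set (model M)) (\<phi> ` U)"
    and chart_homeomorphic: "homeomorphic_map (subtopology (mtop M) U) (top_of_set (\<phi> ` U)) \<phi>"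
    and chart_inj: "inj_on \<phi> U"
    and chart_subset: "U \<subseteq> points M"
    and chart_model: "p \<in> U \<Longrightarrow> \<phi> p \<in> model M"
proof -
  show 1: "openin (mtop M) U" and 2: "openin (top_of_set (model M)) (\<phi> ` U)"
    and 3: "homeomorphic_map (subtopology (mtop M) U) (top_of_set (\<phi> ` U)) \<phi>"
    using assms unfolding smooth_manifold_def by fastforce+
  show 4: "U \<subseteq> points M" using openin_subset[OF 1] by (simp add: points_def)
  show "inj_on \<phi> U"
    using homeomorphic_imp_injective_map[OF 3] 4
    by (simp add: points_def topspace_subtopology inf.absorb2)
  show "p \<in> U \<Longrightarrow> \<phi> p \<in> model M"
    using openin_subset[OF 2] by auto
qed

lemma manifold_subspace: "smooth_manifold M \<Longrightarrow> subspace (model M)"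
  by (simp add: smooth_manifold_def)

lemma manifold_chart_exists:
  assumes "smooth_manifold M" "p \<in> points M"
  obtains U \<phi> where "(U, \<phi>) \<in> atlas M" "p \<in> U"
  using assms unfolding smooth_manifold_def by force

text \<open>A chart image is only relatively open in \<open>model M\<close>, so an open set of the
  manifold is matched by an ambient open \<open>B\<close> that is controlled at chart points
  alone.\<close>

lemma chart_open_image:
  assumes M: "smooth_manifold M" "(U, \<phi>) \<in> atlas M" and S: "openin (mtop M) S"
  obtains B where "open B" "\<And>q. q \<in> U \<Longrightarrow> \<phi> q \<in> B \<longleftrightarrow> q \<in> S"
proof -
  have U: "topspace (subtopology (mtop M) U) = U"
    using chart_subset[OF M] by (simp add: topspace_subtopology points_def inf.absorb2)
  have "openin (subtopology (mtop M) U) (U \<inter> S)"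
    using S by (metis inf_commute openin_subtopology_Int)
  then have "openin (top_of_set (\<phi> ` U)) (\<phi> ` (U \<inter> S))"
    using homeomorphic_imp_open_map[OF chart_homeomorphic[OF M]] unfolding open_map_def by blast
  then obtain B where B: "open B" "\<phi> ` (U \<inter> S) = \<phi> ` U \<inter> B"
    unfolding openin_open by blast
  show ?thesis
  proof (rule that[OF B(1)])
    fix q assume q: "q \<in> U"
    show "\<phi> q \<in> B \<longleftrightarrow> q \<in> S"
    proof
      assume "\<phi> q \<in> B"
      then have "\<phi> q \<in> \<phi> ` (U \<inter> S)" using B(2) q by blast
      then show "q \<in> S" using chart_inj[OF M] q by (auto dest: inj_onD)
    next
      assume "q \<in> S" then show "\<phi> q \<in> B" using B(2) q by blast
    qed
  qed
qed

lemma chart_open_preimage: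
  assumes M: "smooth_manifold M" "(U, \<phi>) \<in> atlas M" and B: "open B"
  shows "openin (mtop M) {q\<in>U. \<phi> q \<in> B}"
proof -
  have U: "topspace (subtopology (mtop M) U) = U"
    using chart_subset[OF M] by (simp add: topspace_subtopology points_def inf.absorb2)
  have c: "continuous_map (subtopology (mtop M) U) (top_of_set (\<phi> ` U)) \<phi>"
    using chart_homeomorphic[OF M] homeomorphic_imp_continuous_map by blast
  have "openin (top_of_set (\<phi> ` U)) (\<phi> ` U \<inter> B)"
    using B by (simp add: openin_open_Int)
  from openin_continuous_map_preimage[OF c this]
  have "openin (subtopology (mtop M) U) {q\<in>U. \<phi> q \<in> \<phi> ` U \<inter> B}" unfolding U .
  moreover have "{q\<in>U. \<phi> q \<in> \<phi> ` U \<inter> B} = {q\<in>U. \<phi> q \<in> B}" by auto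
  ultimately show ?thesis
    using openin_trans_full[OF _ chart_openin[OF M]] by auto
qed

text \<open>The representative \<open>h\<close> lives on an open subset of the whole Euclidean
  space, although the values of \<open>\<phi>\<close> may fill only a piece of a proper subspace.
  This makes the ordinary Frechet derivative available; off the chart image \<open>h\<close> is
  arbitrary.\<close>

definition local_rep ::
  "'a set \<Rightarrow> ('a \<Rightarrow> 'e::euclidean_space) \<Rightarrow> 'a \<Rightarrow> ('a \<Rightarrow> 'b::euclidean_space) \<Rightarrow> 'e set \<Rightarrow> ('e \<Rightarrow> 'b) \<Rightarrow> bool"
where
  "local_rep U \<phi> p f B h \<longleftrightarrow>
     open B \<and> \<phi> p \<in> B \<and> Cinf_on B h \<and> (\<forall>q\<in>U. \<phi> q \<in> B \<longrightarrow> f q = h (\<phi> q))"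

definition smooth_germ :: "('a, 'e::euclidean_space) manifold \<Rightarrow> 'a \<Rightarrow> ('a \<Rightarrow> 'b::euclidean_space) \<Rightarrow> bool"
where
  "smooth_germ M p f \<longleftrightarrow> (\<exists>(U, \<phi>)\<in>atlas M. p \<in> U \<and> (\<exists>B h. local_rep U \<phi> p f B h))"

lemma smooth_germI:
  "(U, \<phi>) \<in> atlas M \<Longrightarrow> p \<in> U \<Longrightarrow> local_rep U \<phi> p f B h \<Longrightarrow> smooth_germ M p f"
  unfolding smooth_germ_def by blast

lemma local_rep_subset:
  "local_rep U \<phi> p f B h \<Longrightarrow> open B' \<Longrightarrow> \<phi> p \<in> B' \<Longrightarrow> B' \<subseteq> B \<Longrightarrow> local_rep U \<phi> p f B' h"
  unfolding local_rep_def by (meson Ck_on_subset subsetD)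

lemma local_rep_shrink:
  assumes M: "smooth_manifold M" "(U, \<phi>) \<in> atlas M" and p: "p \<in> U" "p \<in> S" "openin (mtop M) S"
    and rep: "local_rep U \<phi> p f B h"
  obtains B' where "local_rep U \<phi> p f B' h" "\<And>q. q \<in> U \<Longrightarrow> \<phi> q \<in> B' \<Longrightarrow> q \<in> S"
proof -
  obtain C where C: "open C" "\<And>q. q \<in> U \<Longrightarrow> \<phi> q \<in> C \<longleftrightarrow> q \<in> S"
    using chart_open_image[OF M p(3)] by blast
  show ?thesis
  proof (rule that[of "B \<inter> C"])
    show "local_rep U \<phi> p f (B \<inter> C) h"
      using rep C p by (intro local_rep_subset[OF rep]) (auto simp: local_rep_def)
  qed (use C in auto)
qed

text \<open>Removes \<open>inv_into\<close> from coordinate expressions: smoothness becomes a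
  condition at points of the manifold.\<close>

lemma smooth_on_chart_iff:
  assumes "inj_on \<phi> U" "S \<subseteq> U"
  shows "smooth_on (\<phi> ` S) (\<lambda>x. f (inv_into U \<phi> x)) \<longleftrightarrow> (\<forall>p\<in>S. \<exists>B h. local_rep S \<phi> p f B h)"
    (is "?L = ?R")
proof -
  have inv: "inv_into U \<phi> (\<phi> q) = q" if "q \<in> S" for q
    using assms that by (simp add: inv_into_f_f subsetD)
  have "?L \<longleftrightarrow> (\<forall>p\<in>S. \<exists>B h. open B \<and> \<phi> p \<in> B \<and> Cinf_on B h \<and> (\<forall>y\<in>\<phi> ` S \<inter> B. f (inv_into U \<phi> y) = h y))"
    unfolding smooth_on_def by simp
  also have "\<dots> \<longleftrightarrow> ?R"
  proof -
    have "(\<forall>y\<in>\<phi> ` S \<inter> B. f (inv_into U \<phi> y) = h y) \<longleftrightarrow> (\<forall>q\<in>S. \<phi> q \<in> B \<longrightarrow> f q = h (\<phi> q))"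
      for B and h :: "'b \<Rightarrow> 'c"
    proof -
      have "(\<forall>y\<in>\<phi> ` S \<inter> B. f (inv_into U \<phi> y) = h y) \<longleftrightarrow>
          (\<forall>q\<in>S. \<phi> q \<in> B \<longrightarrow> f (inv_into U \<phi> (\<phi> q)) = h (\<phi> q))" by blast
      then show ?thesis using inv by simp
    qed
    then show ?thesis unfolding local_rep_def by simp
  qed
  finally show ?thesis .
qed

text \<open>Cutting the ambient open set so that it meets no chart point outside \<open>S\<close>
  turns a representative over \<open>S\<close> into one over the whole chart.\<close>

lemma local_rep_open_subset:
  assumes M: "smooth_manifold M" "(U, \<phi>) \<in> atlas M" and S: "openin (mtop M) S" "S \<subseteq> U" "p \<in> S"
    and rep: "local_rep S \<phi> p f B h"
  obtains B' where "local_rep U \<phi> p f B' h" "\<And>q. q \<in> U \<Longrightarrow> \<phi> q \<in> B' \<Longrightarrow> q \<in> S"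
proof -
  obtain C where C: "open C" "\<And>q. q \<in> U \<Longrightarrow> \<phi> q \<in> C \<longleftrightarrow> q \<in> S"
    using chart_open_image[OF M S(1)] by blast
  show ?thesis
  proof (rule that[of "B \<inter> C"])
    show "local_rep U \<phi> p f (B \<inter> C) h"
      using rep C S unfolding local_rep_def
      by (auto intro: Ck_on_subset)
  qed (use C in auto)
qed

text \<open>Compose with a smooth extension \<open>k\<close> of the transition map. Hence one chart
  decides whether a germ is smooth, and any other chart may be used to compute with it.\<close>

lemma local_rep_change:
  assumes M: "smooth_manifold M" and U: "(U, \<phi>) \<in> atlas M" "p \<in> U" and V: "(V, \<psi>) \<in> atlas M" "p \<in> V"
    and rep: "local_rep U \<phi> p f B h"
  obtains B' h' where "local_rep V \<psi> p f B' h'"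
proof -
  have "smooth_on (\<psi> ` (V \<inter> U)) (\<lambda>x. \<phi> (inv_into V \<psi> x))"
    using M U V unfolding smooth_manifold_def by fastforce
  then obtain C k where C: "local_rep (V \<inter> U) \<psi> p \<phi> C k"
    using smooth_on_chart_iff[OF chart_inj[OF M V(1)], of "V \<inter> U" \<phi>] U V by blast
  have o: "openin (mtop M) (V \<inter> U)"
    using chart_openin[OF M U(1)] chart_openin[OF M V(1)] by blast
  obtain C' where C': "local_rep V \<psi> p \<phi> C' k" "\<And>q. q \<in> V \<Longrightarrow> \<psi> q \<in> C' \<Longrightarrow> q \<in> V \<inter> U"
    by (rule local_rep_open_subset[OF M V(1) o _ _ C]) (use U V in auto)
  \<comment> \<open>The extension \<open>k\<close> need not map all of \<open>C'\<close> into the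
    domain of \<open>h\<close>, so the domain is restricted to where it does.\<close>
  define D where "D = {x\<in>C'. k x \<in> B}"
  have oD: "open D"
    unfolding D_def using C'(1) rep unfolding local_rep_def
    by (intro open_Collect_continuous Cinf_on_continuous) auto
  have "local_rep V \<psi> p f D (\<lambda>x. h (k x))"
    unfolding local_rep_def
  proof (intro conjI allI ballI impI oD)
    show "\<psi> p \<in> D" using C' rep V unfolding local_rep_def D_def by force
    show "Ck_on n D (\<lambda>x. h (k x))" for n
    proof (rule Ck_on_compose[where f = h and h = k, OF _ oD])
      show "open B" "Ck_on n B h" using rep unfolding local_rep_def by auto
      show "Ck_on n D k" using C'(1) unfolding local_rep_def D_def by (auto intro: Ck_on_subset)
      show "k ` D \<subseteq> B" unfolding D_def by auto
    qed
    fix q assume q: "q \<in> V" "\<psi> q \<in> D"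
    then have "q \<in> U" "\<phi> q = k (\<psi> q)" "k (\<psi> q) \<in> B" using C' unfolding D_def local_rep_def by auto
    then show "f q = h (k (\<psi> q))" using rep unfolding local_rep_def by auto
  qed
  then show ?thesis using that by blast
qed

lemma smooth_germ_rep:
  assumes M: "smooth_manifold M" and "smooth_germ M p f" and V: "(V, \<psi>) \<in> atlas M" "p \<in> V"
  obtains B h where "local_rep V \<psi> p f B h"
proof -
  obtain U \<phi> B h where U: "(U, \<phi>) \<in> atlas M" "p \<in> U" "local_rep U \<phi> p f B h"
    using assms(2) unfolding smooth_germ_def by blast
  show ?thesis by (rule local_rep_change[OF M U(1,2) V U(3)]) (rule that)
qed

lemma local_rep_nbhd:
  "local_rep U \<phi> p f B h \<Longrightarrow> \<phi> q \<in> B \<Longrightarrow> local_rep U \<phi> q f B h"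
  unfolding local_rep_def by blast

text \<open>Smoothness is local, so the remaining development can argue with germs at single
  points.\<close>

lemma smooth_fun_on_iff_germ:
  assumes M: "smooth_manifold M"
  shows "smooth_fun_on M W f \<longleftrightarrow> openin (mtop M) W \<and> (\<forall>p\<in>W. smooth_germ M p f)"
proof (cases "openin (mtop M) W")
  case W: True
  have 1: "smooth_on (\<phi> ` (U \<inter> W)) (\<lambda>x. f (inv_into U \<phi> x)) \<longleftrightarrow> (\<forall>p\<in>U \<inter> W. smooth_germ M p f)"
    if U: "(U, \<phi>) \<in> atlas M" for U \<phi>
  proof -
    have o: "openin (mtop M) (U \<inter> W)" using W chart_openin[OF M U] by blast
    have "(\<exists>B h. local_rep (U \<inter> W) \<phi> p f B h) \<longleftrightarrow> smooth_germ M p f" if p: "p \<in> U \<inter> W" for p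
    proof
      assume "\<exists>B h. local_rep (U \<inter> W) \<phi> p f B h"
      then obtain B h where B: "local_rep (U \<inter> W) \<phi> p f B h" by blast
      show "smooth_germ M p f"
        by (rule local_rep_open_subset[OF M U o _ p B]) (use p in \<open>auto intro: smooth_germI[OF U]\<close>)
    next
      assume "smooth_germ M p f"
      then obtain B h where "local_rep U \<phi> p f B h" using smooth_germ_rep[OF M _ U, of p f] p by auto
      then show "\<exists>B h. local_rep (U \<inter> W) \<phi> p f B h" unfolding local_rep_def by blast
    qed
    then show ?thesis
      using smooth_on_chart_iff[OF chart_inj[OF M U], of "U \<inter> W" f] by auto
  qed
  have "smooth_fun_on M W f \<longleftrightarrow> (\<forall>(U, \<phi>)\<in>atlas M. \<forall>p\<in>U \<inter> W. smooth_germ M p f)"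
    unfolding smooth_fun_on_def using W 1 by auto
  also have "\<dots> \<longleftrightarrow> (\<forall>p\<in>W. smooth_germ M p f)"
  proof -
    have "\<exists>U \<phi>. (U, \<phi>) \<in> atlas M \<and> p \<in> U" if "p \<in> W" for p
      using manifold_chart_exists[OF M, of p] openin_subset[OF W] that unfolding points_def by blast
    then show ?thesis by blast
  qed
  finally show ?thesis using W by simp
qed (auto simp: smooth_fun_on_def)

lemma smooth_germ_nbhd:
  assumes M: "smooth_manifold M" and "smooth_germ M p f"
  obtains W where "openin (mtop M) W" "p \<in> W" "\<And>q. q \<in> W \<Longrightarrow> smooth_germ M q f"
proof -
  obtain U \<phi> B h where U: "(U, \<phi>) \<in> atlas M" "p \<in> U" "local_rep U \<phi> p f B h"
    using assms(2) unfolding smooth_germ_def by blast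
  show ?thesis
  proof (rule that[of "{q\<in>U. \<phi> q \<in> B}"])
    show "openin (mtop M) {q\<in>U. \<phi> q \<in> B}"
      using chart_open_preimage[OF M U(1)] U(3) unfolding local_rep_def by blast
    show "p \<in> {q\<in>U. \<phi> q \<in> B}" using U unfolding local_rep_def by blast
    show "smooth_germ M q f" if "q \<in> {q\<in>U. \<phi> q \<in> B}" for q
      using that smooth_germI[OF U(1)] local_rep_nbhd[OF U(3)] by blast
  qed
qed

lemma smooth_fun_at_iff_germ:
  assumes M: "smooth_manifold M"
  shows "smooth_fun_at M p f \<longleftrightarrow> smooth_germ M p f"
proof
  show "smooth_fun_at M p f \<Longrightarrow> smooth_germ M p f"
    unfolding smooth_fun_at_def smooth_fun_on_iff_germ[OF M] by blast
  assume "smooth_germ M p f"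
  then obtain W where "openin (mtop M) W" "p \<in> W" "\<And>q. q \<in> W \<Longrightarrow> smooth_germ M q f"
    by (rule smooth_germ_nbhd[OF M]) auto
  then show "smooth_fun_at M p f"
    unfolding smooth_fun_at_def smooth_fun_on_iff_germ[OF M] by blast
qed

lemma smooth_germ_points:
  "smooth_manifold M \<Longrightarrow> smooth_germ M p f \<Longrightarrow> p \<in> points M"
  unfolding smooth_germ_def using chart_subset by blast

lemma smooth_germ_cong:
  assumes M: "smooth_manifold M" and S: "openin (mtop M) S" "p \<in> S" "\<And>q. q \<in> S \<Longrightarrow> f q = f' q"
    and g: "smooth_germ M p f"
  shows "smooth_germ M p f'"
proof -
  obtain U \<phi> B h where U: "(U, \<phi>) \<in> atlas M" "p \<in> U" "local_rep U \<phi> p f B h"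
    using g unfolding smooth_germ_def by blast
  obtain B' where B': "local_rep U \<phi> p f B' h" "\<And>q. q \<in> U \<Longrightarrow> \<phi> q \<in> B' \<Longrightarrow> q \<in> S"
    by (rule local_rep_shrink[OF M U(1,2) S(2,1) U(3)]) auto
  then have "local_rep U \<phi> p f' B' h" using S(3) unfolding local_rep_def by metis
  then show ?thesis by (rule smooth_germI[OF U(1,2)])
qed

lemma local_rep_chart: "p \<in> U \<Longrightarrow> local_rep U \<phi> p \<phi> UNIV (\<lambda>x. x)"
  unfolding local_rep_def using Ck_on_bounded_linear[OF bounded_linear_ident] by auto

lemma local_rep_const: "local_rep U \<phi> p (\<lambda>q. c) UNIV (\<lambda>x. c)"
  unfolding local_rep_def using Ck_on_const by auto

lemma local_rep_compose:
  assumes rep: "local_rep U \<phi> p f B h" and H: "open C" "f p \<in> C" "Cinf_on C H" and p: "p \<in> U"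
  shows "local_rep U \<phi> p (\<lambda>q. H (f q)) {x\<in>B. h x \<in> C} (\<lambda>x. H (h x))"
proof -
  have o: "open {x\<in>B. h x \<in> C}"
    using rep H unfolding local_rep_def by (intro open_Collect_continuous Cinf_on_continuous) auto
  have "Ck_on n {x\<in>B. h x \<in> C} (\<lambda>x. H (h x))" for n
    by (rule Ck_on_compose[where f = H and h = h, OF H(1) o]) (use rep H in \<open>auto simp: local_rep_def intro: Ck_on_subset\<close>)
  then show ?thesis using rep H p o unfolding local_rep_def by auto
qed

lemma local_rep_add:
  assumes "local_rep U \<phi> p f B h" "local_rep U \<phi> p f' B' h'"
  shows "local_rep U \<phi> p (\<lambda>q. f q + f' q) (B \<inter> B') (\<lambda>x. h x + h' x)"
  using assms unfolding local_rep_def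
  by (auto intro!: Ck_on_add intro: Ck_on_subset)

lemma local_rep_linear:
  assumes "local_rep U \<phi> p f B h" "bounded_linear L"
  shows "local_rep U \<phi> p (\<lambda>q. L (f q)) B (\<lambda>x. L (h x))"
  using assms Ck_on_linear_compose[of B L _ h] unfolding local_rep_def by auto

lemma smooth_germ_chart: "(U, \<phi>) \<in> atlas M \<Longrightarrow> p \<in> U \<Longrightarrow> smooth_germ M p \<phi>"
  by (rule smooth_germI[OF _ _ local_rep_chart])

lemma smooth_germ_const:
  "smooth_manifold M \<Longrightarrow> p \<in> points M \<Longrightarrow> smooth_germ M p (\<lambda>q. c)"
  by (rule manifold_chart_exists[of M p]) (auto intro: smooth_germI[OF _ _ local_rep_const])

lemma smooth_germ_compose_Cinf:
  assumes f: "smooth_germ M p f" and C: "open C" "f p \<in> C" "Cinf_on C H"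
  shows "smooth_germ M p (\<lambda>q. H (f q))"
proof -
  obtain U \<phi> B h where U: "(U, \<phi>) \<in> atlas M" "p \<in> U" "local_rep U \<phi> p f B h"
    using f unfolding smooth_germ_def by blast
  show ?thesis
    by (rule smooth_germI[OF U(1,2) local_rep_compose[where H = H, OF U(3) C U(2)]])
qed

lemma smooth_germ_linear:
  assumes "smooth_germ M p f" "bounded_linear L"
  shows "smooth_germ M p (\<lambda>q. L (f q))"
  by (rule smooth_germ_compose_Cinf[where H = L, OF assms(1) open_UNIV])
     (auto intro: Ck_on_bounded_linear assms)

lemma smooth_germ_add:
  assumes "smooth_manifold M" "smooth_germ M p f" "smooth_germ M p f'"
  shows "smooth_germ M p (\<lambda>q. f q + f' q)"
proof -
  obtain U \<phi> B h where U: "(U, \<phi>) \<in> atlas M" "p \<in> U" "local_rep U \<phi> p f B h"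
    using assms unfolding smooth_germ_def by blast
  obtain B' h' where "local_rep U \<phi> p f' B' h'"
    by (rule smooth_germ_rep[OF assms(1,3) U(1,2)])
  then show ?thesis by (rule smooth_germI[OF U(1,2) local_rep_add[OF U(3)]])
qed

lemma smooth_germ_sum:
  assumes "smooth_manifold M" "p \<in> points M" "\<And>i. i \<in> I \<Longrightarrow> smooth_germ M p (f i)"
  shows "smooth_germ M p (\<lambda>q. \<Sum>i\<in>I. f i q)"
  using assms(3)
  by (induction I rule: infinite_finite_induct)
     (auto simp: smooth_germ_const[OF assms(1,2)] intro!: smooth_germ_add[OF assms(1)])

lemma smooth_germ_scaleR:
  "smooth_germ M p f \<Longrightarrow> smooth_germ M p (\<lambda>q. c *\<^sub>R f q)"
  by (rule smooth_germ_linear[OF _ bounded_linear_scaleR_right[of c]])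

lemma smooth_germ_diff:
  assumes "smooth_manifold M" "smooth_germ M p f" "smooth_germ M p f'"
  shows "smooth_germ M p (\<lambda>q. f q - f' q)"
  using smooth_germ_add[OF assms(1,2) smooth_germ_scaleR[OF assms(3), of "-1"]] by simp

section \<open>Smooth maps in charts\<close>

lemma smooth_map_rep:
  assumes M: "smooth_manifold M" "smooth_manifold N" and F: "smooth_map M N F"
    and U: "(U, \<phi>) \<in> atlas M" "p \<in> U" and V: "(V, \<psi>) \<in> atlas N" "F p \<in> V"
  obtains B h where "local_rep U \<phi> p (\<lambda>q. \<psi> (F q)) B h" "\<And>q. q \<in> U \<Longrightarrow> \<phi> q \<in> B \<Longrightarrow> F q \<in> V"
proof -
  let ?S = "{q\<in>U. F q \<in> V}"
  have "openin (mtop M) {q \<in> topspace (mtop M). F q \<in> V}"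
    using F chart_openin[OF M(2) V(1)] unfolding smooth_map_def continuous_map by blast
  then have "openin (mtop M) (U \<inter> {q \<in> topspace (mtop M). F q \<in> V})"
    using chart_openin[OF M(1) U(1)] by blast
  moreover have "U \<inter> {q \<in> topspace (mtop M). F q \<in> V} = ?S"
    using chart_subset[OF M(1) U(1)] by (auto simp: points_def)
  ultimately have o: "openin (mtop M) ?S" by simp
  have "smooth_on (\<phi> ` ?S) (\<lambda>x. \<psi> (F (inv_into U \<phi> x)))"
    using F U V unfolding smooth_map_def by fastforce
  then obtain B h where "local_rep ?S \<phi> p (\<lambda>q. \<psi> (F q)) B h"
    using smooth_on_chart_iff[OF chart_inj[OF M(1) U(1)], of ?S "\<lambda>q. \<psi> (F q)"] U V by auto
  then show ?thesis
    by (rule local_rep_open_subset[OF M(1) U(1) o, rotated 2]) (use U V that in auto)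
qed

lemma smooth_germ_compose:
  assumes M: "smooth_manifold M" "smooth_manifold N" and F: "smooth_map M N F"
    and p: "p \<in> points M" and f: "smooth_germ N (F p) f"
  shows "smooth_germ M p (\<lambda>q. f (F q))"
proof -
  obtain U \<phi> where U: "(U, \<phi>) \<in> atlas M" "p \<in> U" by (rule manifold_chart_exists[OF M(1) p])
  obtain V \<psi> C k where V: "(V, \<psi>) \<in> atlas N" "F p \<in> V" "local_rep V \<psi> (F p) f C k"
    using f unfolding smooth_germ_def by blast
  obtain B h where B: "local_rep U \<phi> p (\<lambda>q. \<psi> (F q)) B h" "\<And>q. q \<in> U \<Longrightarrow> \<phi> q \<in> B \<Longrightarrow> F q \<in> V"
    by (rule smooth_map_rep[OF M F U V(1,2)]) auto
  have C: "open C" "\<psi> (F p) \<in> C" "Cinf_on C k" using V(3) unfolding local_rep_def by auto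
  have "local_rep U \<phi> p (\<lambda>q. k (\<psi> (F q))) {x\<in>B. h x \<in> C} (\<lambda>x. k (h x))"
    by (rule local_rep_compose[where H = k, OF B(1) C U(2)])
  moreover have "f (F q) = k (\<psi> (F q))" if "q \<in> U" "\<phi> q \<in> {x\<in>B. h x \<in> C}" for q
    using that B V(3) unfolding local_rep_def by auto
  ultimately have "local_rep U \<phi> p (\<lambda>q. f (F q)) {x\<in>B. h x \<in> C} (\<lambda>x. k (h x))"
    unfolding local_rep_def by simp
  then show ?thesis by (rule smooth_germI[OF U])
qed

text \<open>A single target chart around each image point suffices: continuity keeps nearby values
  inside it, and a transition map leads to any other chart.\<close>

lemma smooth_mapI:
  assumes M: "smooth_manifold M" "smooth_manifold N" and c: "continuous_map (mtop M) (mtop N) F"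
    and g: "\<And>p. p \<in> points M \<Longrightarrow> \<exists>V \<psi>. (V, \<psi>) \<in> atlas N \<and> F p \<in> V \<and> smooth_germ M p (\<lambda>q. \<psi> (F q))"
  shows "smooth_map M N F"
proof -
  have "smooth_on (\<phi> ` {p\<in>U. F p \<in> V}) (\<lambda>x. \<psi> (F (inv_into U \<phi> x)))"
    if U: "(U, \<phi>) \<in> atlas M" and V: "(V, \<psi>) \<in> atlas N" for U \<phi> V \<psi>
  proof -
    have "\<exists>B h. local_rep {p\<in>U. F p \<in> V} \<phi> p (\<lambda>q. \<psi> (F q)) B h" if p: "p \<in> U" "F p \<in> V" for p
    proof -
      have pM: "p \<in> points M" using chart_subset[OF M(1) U] p(1) by blast
      obtain V' \<psi>' where V': "(V', \<psi>') \<in> atlas N" "F p \<in> V'" "smooth_germ M p (\<lambda>q. \<psi>' (F q))"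
        using g[OF pM] by (elim exE conjE)
      obtain C k where C: "local_rep V' \<psi>' (F p) \<psi> C k"
        by (rule smooth_germ_rep[OF M(2) smooth_germ_chart[OF V p(2)] V'(1,2)])
      obtain B h where B: "local_rep U \<phi> p (\<lambda>q. \<psi>' (F q)) B h"
        by (rule smooth_germ_rep[OF M(1) V'(3) U p(1)])
      have "openin (mtop M) {q \<in> topspace (mtop M). F q \<in> V'}"
        using c chart_openin[OF M(2) V'(1)] unfolding continuous_map by blast
      then obtain B' where B': "local_rep U \<phi> p (\<lambda>q. \<psi>' (F q)) B' h"
        "\<And>q. q \<in> U \<Longrightarrow> \<phi> q \<in> B' \<Longrightarrow> q \<in> {q \<in> topspace (mtop M). F q \<in> V'}"
        by (rule local_rep_shrink[OF M(1) U p(1) _ _ B, rotated])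
           (use p V' chart_subset[OF M(1) U] in \<open>auto simp: points_def\<close>)
      have "local_rep U \<phi> p (\<lambda>q. k (\<psi>' (F q))) {x\<in>B'. h x \<in> C} (\<lambda>x. k (h x))"
        by (rule local_rep_compose[where H = k, OF B'(1)]) (use C p in \<open>auto simp: local_rep_def\<close>)
      moreover have "\<psi> (F q) = k (\<psi>' (F q))" if "q \<in> U" "\<phi> q \<in> {x\<in>B'. h x \<in> C}" for q
        using that B' C unfolding local_rep_def by auto
      ultimately have "local_rep U \<phi> p (\<lambda>q. \<psi> (F q)) {x\<in>B'. h x \<in> C} (\<lambda>x. k (h x))"
        unfolding local_rep_def by simp
      then show ?thesis unfolding local_rep_def by blast
    qed
    then show ?thesis
      using smooth_on_chart_iff[OF chart_inj[OF M(1) U], of "{p\<in>U. F p \<in> V}" "\<lambda>q. \<psi> (F q)"] by auto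
  qed
  then show ?thesis using c unfolding smooth_map_def by auto
qed

section \<open>Tangent vectors in charts\<close>

text \<open>A subspace of a Euclidean space is its own double orthogonal complement. Membership
  thereby becomes a family of scalar equations, which can be differentiated.\<close>

lemma subspace_memI_orthogonal:
  fixes F :: "'b::euclidean_space set"
  assumes "subspace F" and "\<And>z. (\<And>y. y \<in> F \<Longrightarrow> y \<bullet> z = 0) \<Longrightarrow> w \<bullet> z = 0"
  shows "w \<in> F"
proof -
  obtain y z where yz: "y \<in> span F" "\<And>u. u \<in> span F \<Longrightarrow> orthogonal z u" "w = y + z"
    using orthogonal_subspace_decomp_exists[of F w] by blast
  have F: "span F = F" using assms(1) by (simp add: span_eq_iff)
  have z: "u \<bullet> z = 0" if "u \<in> F" for u
    using yz(2)[of u] that F by (simp add: orthogonal_def inner_commute)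
  have "w \<bullet> z = 0" using assms(2) z by blast
  moreover have "y \<bullet> z = 0" using z yz(1) F by simp
  ultimately have "z = 0" using yz(3) by (simp add: inner_add_left)
  then show ?thesis using yz F by simp
qed

text \<open>Along the line through \<open>x\<close> in direction \<open>e\<close>, which stays in
  \<open>E\<close>, the product of \<open>h\<close> with any vector orthogonal to \<open>F\<close>
  is zero near \<open>x\<close>, hence so is its derivative. Repeatedly used to show that coordinate
  vectors stay in the model.\<close>

lemma has_derivative_subspace:
  fixes h :: "'a::euclidean_space \<Rightarrow> 'b::euclidean_space"
  assumes d: "(h has_derivative h') (at x)" and E: "subspace E" "x \<in> E" "e \<in> E"
    and F: "subspace F" and B: "open B" "x \<in> B" and hF: "\<And>y. y \<in> B \<Longrightarrow> y \<in> E \<Longrightarrow> h y \<in> F"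
  shows "h' e \<in> F"
proof (rule subspace_memI_orthogonal[OF F])
  fix z assume z: "\<And>y. y \<in> F \<Longrightarrow> y \<bullet> z = 0"
  let ?l = "\<lambda>t::real. x + t *\<^sub>R e"
  have l: "(?l has_derivative (\<lambda>s. s *\<^sub>R e)) (at 0)" by (auto intro!: derivative_eq_intros)
  have "((\<lambda>t. h (?l t)) has_derivative (\<lambda>s. h' (s *\<^sub>R e))) (at 0)"
    using has_derivative_compose[OF l, of h h'] d by simp
  then have 1: "((\<lambda>t. h (?l t) \<bullet> z) has_derivative (\<lambda>s. h' (s *\<^sub>R e) \<bullet> z)) (at 0)"
    by (rule has_derivative_inner_left)
  have o: "open {t. ?l t \<in> B}"
    using open_vimage[OF B(1), of ?l] by (simp add: vimage_def continuous_intros)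
  have "((\<lambda>t. 0) has_derivative (\<lambda>s. h' (s *\<^sub>R e) \<bullet> z)) (at 0)"
  proof (rule has_derivative_transform_within_open[OF 1 o])
    show "0 \<in> {t. ?l t \<in> B}" using B by simp
    fix t assume "t \<in> {t. ?l t \<in> B}"
    moreover have "?l t \<in> E" using E by (simp add: subspace_add subspace_scale)
    ultimately show "h (?l t) \<bullet> z = 0" using hF z by blast
  qed
  then have "(\<lambda>s. h' (s *\<^sub>R e) \<bullet> z) = (\<lambda>s. 0)"
    using has_derivative_unique has_derivative_const by blast
  then show "h' e \<bullet> z = 0" by (metis scaleR_one)
qed

text \<open>The coordinate vector of \<open>v\<close> in a chart. Quantifying over all
  representatives is consistent because \<open>e\<close> lies in the model: different extensions of
  \<open>f\<close> agree on the chart image, which is relatively open in the model, and so have the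
  same derivative along \<open>e\<close>.\<close>

definition vec_coord ::
  "('a, 'e::euclidean_space) manifold \<Rightarrow> 'a set \<Rightarrow> ('a \<Rightarrow> 'e) \<Rightarrow> 'a \<Rightarrow> 'a tvec \<Rightarrow> 'e \<Rightarrow> bool" where
  "vec_coord M U \<phi> p v e \<longleftrightarrow>
     e \<in> model M \<and> (\<forall>f. \<not> smooth_germ M p f \<longrightarrow> v f = 0) \<and>
     (\<forall>f B h. local_rep U \<phi> p f B h \<longrightarrow> v f = frechet_derivative h (at (\<phi> p)) e)"

lemma vec_coordD:
  "vec_coord M U \<phi> p v e \<Longrightarrow> local_rep U \<phi> p f B h \<Longrightarrow> v f = frechet_derivative h (at (\<phi> p)) e"
  unfolding vec_coord_def by blast

lemma vec_coord_unique:
  assumes M: "smooth_manifold M" "(U, \<phi>) \<in> atlas M" "p \<in> U"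
    and "vec_coord M U \<phi> p v e" "vec_coord M U \<phi> p w e"
  shows "v = w"
proof
  fix f
  show "v f = w f"
  proof (cases "smooth_germ M p f")
    case True
    obtain B h where "local_rep U \<phi> p f B h" by (rule smooth_germ_rep[OF M(1) True M(2,3)])
    then show ?thesis using vec_coordD[OF assms(4)] vec_coordD[OF assms(5)] by simp
  next
    case False
    then show ?thesis using assms(4,5) unfolding vec_coord_def by simp
  qed
qed

lemma local_rep_has_derivative:
  "local_rep U \<phi> p f B h \<Longrightarrow> (h has_derivative frechet_derivative h (at (\<phi> p))) (at (\<phi> p))"
  unfolding local_rep_def by (intro Cinf_on_has_derivative) auto

text \<open>The chain rule, with the velocity of the coordinate curve as coordinate vector. That
  vector lies in the model because the curve does.\<close>

lemma velocity_vec_coord: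
  assumes M: "smooth_manifold M" "(U, \<phi>) \<in> atlas M" and \<epsilon>: "0 < \<epsilon>"
    and c: "local_rep {- \<epsilon><..<\<epsilon>} (\<lambda>t. t) 0 (\<lambda>t. \<phi> (\<gamma> t)) B c"
    and U: "\<And>t. t \<in> {- \<epsilon><..<\<epsilon>} \<Longrightarrow> t \<in> B \<Longrightarrow> \<gamma> t \<in> U"
  shows "vec_coord M U \<phi> (\<gamma> 0) (velocity M \<gamma>) (frechet_derivative c (at 0) 1)"
proof -
  let ?I = "{- \<epsilon><..<\<epsilon>}"
  have B: "open B" "0 \<in> B" "Cinf_on B c" "\<And>t. t \<in> ?I \<Longrightarrow> t \<in> B \<Longrightarrow> \<phi> (\<gamma> t) = c t"
    using c unfolding local_rep_def by auto
  have dc: "(c has_derivative frechet_derivative c (at 0)) (at 0)"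
    using local_rep_has_derivative[OF c] by simp
  have c0: "c 0 = \<phi> (\<gamma> 0)" using B(4)[of 0] B(2) \<epsilon> by simp
  have p: "\<gamma> 0 \<in> U" using U[of 0] B(2) \<epsilon> by simp
  have mem: "frechet_derivative c (at 0) 1 \<in> model M"
  proof (rule has_derivative_subspace[OF dc subspace_UNIV _ _ manifold_subspace[OF M(1)], of _ "B \<inter> ?I"])
    show "c t \<in> model M" if "t \<in> B \<inter> ?I" for t
      using chart_model[OF M U, of t] B(4)[of t] that by simp
  qed (use B \<epsilon> in auto)
  have "velocity M \<gamma> f = frechet_derivative h (at (\<phi> (\<gamma> 0))) (frechet_derivative c (at 0) 1)"
    if h: "local_rep U \<phi> (\<gamma> 0) f C h" for f C h
  proof -
    have C: "open C" "\<And>q. q \<in> U \<Longrightarrow> \<phi> q \<in> C \<Longrightarrow> f q = h (\<phi> q)" "\<phi> (\<gamma> 0) \<in> C"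
      using h unfolding local_rep_def by auto
    have sm: "smooth_fun_at M (\<gamma> 0) f"
      unfolding smooth_fun_at_iff_germ[OF M(1)] by (rule smooth_germI[OF M(2) p h])
    let ?A = "{t \<in> B \<inter> ?I. c t \<in> C}"
    have A: "open ?A"
      using B C by (intro open_Collect_continuous continuous_on_subset[OF Cinf_on_continuous[OF B(3)]]) auto
    have "((\<lambda>t. h (c t)) has_derivative
        (\<lambda>s. frechet_derivative h (at (\<phi> (\<gamma> 0))) (frechet_derivative c (at 0) s))) (at 0)"
      by (rule has_derivative_compose[OF dc]) (use local_rep_has_derivative[OF h] c0 in simp)
    then have d: "((\<lambda>t. f (\<gamma> t)) has_derivative
        (\<lambda>s. frechet_derivative h (at (\<phi> (\<gamma> 0))) (frechet_derivative c (at 0) s))) (at 0)"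
    proof (rule has_derivative_transform_within_open[OF _ A])
      show "0 \<in> ?A" using B(2) C(3) c0 \<epsilon> by simp
      show "h (c t) = f (\<gamma> t)" if "t \<in> ?A" for t
        using that B(4)[of t] U[of t] C(2)[of "\<gamma> t"] by simp
    qed
    have "deriv (\<lambda>t. f (\<gamma> t)) 0 = frechet_derivative h (at (\<phi> (\<gamma> 0))) (frechet_derivative c (at 0) 1)"
    proof (rule DERIV_imp_deriv)
      have lin: "linear (\<lambda>s. frechet_derivative h (at (\<phi> (\<gamma> 0))) (frechet_derivative c (at 0) s))"
        using d has_derivative_linear by blast
      have e: "s * frechet_derivative h (at (\<phi> (\<gamma> 0))) (frechet_derivative c (at 0) 1) =
          frechet_derivative h (at (\<phi> (\<gamma> 0))) (frechet_derivative c (at 0) s)" for s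
        using linear_scale[OF lin, of s 1] by (simp only: real_scaleR_def mult_1_right)
      show "((\<lambda>t. f (\<gamma> t)) has_field_derivative
          frechet_derivative h (at (\<phi> (\<gamma> 0))) (frechet_derivative c (at 0) 1)) (at 0)"
        by (rule has_derivative_imp_has_field_derivative[OF d e])
    qed
    then show ?thesis using sm unfolding velocity_def by simp
  qed
  moreover have "velocity M \<gamma> f = 0" if "\<not> smooth_germ M (\<gamma> 0) f" for f
    using that smooth_fun_at_iff_germ[OF M(1)] unfolding velocity_def by simp
  ultimately show ?thesis unfolding vec_coord_def using mem by blast
qed

section \<open>Tangent spaces correspond to the model\<close>

lemma smooth_manifold_interval: "smooth_manifold (interval_manifold \<epsilon>)"
proof -
  have "smooth_on S (\<lambda>x. inv_into {- \<epsilon><..<\<epsilon>} (\<lambda>t. t) x)" if "S \<subseteq> {- \<epsilon><..<\<epsilon>}" for S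
  proof -
    have "inv_into {- \<epsilon><..<\<epsilon>} (\<lambda>t. t) x = x" if "x \<in> S" for x
      using \<open>S \<subseteq> _\<close> that by (intro inv_into_f_eq) auto
    then show ?thesis
      unfolding smooth_on_def
      by (intro ballI exI[of _ UNIV] exI[of _ "\<lambda>x. x"]) (auto intro: Ck_on_bounded_linear)
  qed
  moreover have "second_countable (top_of_set {- \<epsilon><..<\<epsilon>})"
  proof (rule second_countable_subtopology)
    obtain \<B> :: "real set set" where B: "countable \<B>" "topological_basis \<B>"
      using ex_countable_basis by blast
    have "\<exists>V\<in>\<B>. x \<in> V \<and> V \<subseteq> U" if "open U" "x \<in> U" for U x
      by (rule topological_basisE[OF B(2) that]) blast
    moreover have "open V" if "V \<in> \<B>" for V by (rule topological_basis_open[OF B(2) that])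
    ultimately show "second_countable (euclidean :: real topology)"
      unfolding second_countable_def open_openin[symmetric] using B(1) by blast
  qed
  moreover have "homeomorphic_map (subtopology (top_of_set {- \<epsilon><..<\<epsilon>}) {- \<epsilon><..<\<epsilon>}) (top_of_set {- \<epsilon><..<\<epsilon>}) (\<lambda>t. t)"
    by (simp add: subtopology_subtopology homeomorphic_map_id[unfolded id_def])
  ultimately show ?thesis
    unfolding smooth_manifold_def interval_manifold_def points_def
    by (auto simp: Hausdorff_space_subtopology)
qed

lemma interval_chart: "({- \<epsilon><..<\<epsilon>}, \<lambda>t. t) \<in> atlas (interval_manifold \<epsilon>)"
  by (simp add: interval_manifold_def)

lemma points_interval: "points (interval_manifold \<epsilon>) = {- \<epsilon><..<\<epsilon>}"
  by (simp add: interval_manifold_def points_def)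

lemma tangent_space_vec_coord:
  assumes M: "smooth_manifold M" "(U, \<phi>) \<in> atlas M" "p \<in> U" and v: "v \<in> tangent_space M p"
  obtains e where "vec_coord M U \<phi> p v e"
proof -
  obtain \<gamma> \<epsilon> where \<gamma>: "v = velocity M \<gamma>" "0 < \<epsilon>" "smooth_map (interval_manifold \<epsilon>) M \<gamma>" "\<gamma> 0 = p"
    using v unfolding tangent_space_def by blast
  have 0: "(0::real) \<in> {- \<epsilon><..<\<epsilon>}" "\<gamma> 0 \<in> U" using \<gamma> M by auto
  obtain B c where "local_rep {- \<epsilon><..<\<epsilon>} (\<lambda>t. t) 0 (\<lambda>t. \<phi> (\<gamma> t)) B c"
    "\<And>t. t \<in> {- \<epsilon><..<\<epsilon>} \<Longrightarrow> t \<in> B \<Longrightarrow> \<gamma> t \<in> U"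
    by (rule smooth_map_rep[OF smooth_manifold_interval M(1) \<gamma>(3) interval_chart 0(1) M(2) 0(2)]) auto
  from velocity_vec_coord[OF M(1,2) \<gamma>(2) this]
  show ?thesis using that \<gamma> by blast
qed

text \<open>The curve is the straight line \<open>\<phi> p + t *\<^sub>R e\<close> pulled back by
  the chart: it stays in the model, which is a subspace, and for small \<open>t\<close> in the chart
  image, which is relatively open there.\<close>

lemma vec_coord_exists:
  assumes M: "smooth_manifold M" "(U, \<phi>) \<in> atlas M" "p \<in> U" and e: "e \<in> model M"
  obtains v where "v \<in> tangent_space M p" "vec_coord M U \<phi> p v e"
proof -
  let ?l = "\<lambda>t::real. \<phi> p + t *\<^sub>R e"
  define \<gamma> where "\<gamma> t = inv_into U \<phi> (?l t)" for t
  note inj = chart_inj[OF M(1,2)]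
  have lm: "?l t \<in> model M" for t
    using chart_model[OF M] e manifold_subspace[OF M(1)] by (simp add: subspace_add subspace_scale)
  obtain O' where O': "open O'" "\<phi> ` U = model M \<inter> O'"
    using chart_image_openin[OF M(1,2)] unfolding openin_open by blast
  have "open {t. ?l t \<in> O'}"
    using open_vimage[OF O'(1), of ?l] by (simp add: vimage_def continuous_intros)
  moreover have "0 \<in> {t. ?l t \<in> O'}" using O' M(3) by auto
  ultimately obtain \<epsilon> where \<epsilon>: "0 < \<epsilon>" "ball 0 \<epsilon> \<subseteq> {t. ?l t \<in> O'}"
    using open_contains_ball by blast
  let ?I = "{- \<epsilon><..<\<epsilon>}"
  have lU: "?l t \<in> \<phi> ` U" if "t \<in> ?I" for t
    using that \<epsilon>(2) lm O' by (auto simp: ball_def dist_real_def subset_iff)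
  have \<gamma>U: "\<gamma> t \<in> U" "\<phi> (\<gamma> t) = ?l t" if "t \<in> ?I" for t
    unfolding \<gamma>_def using lU[OF that] by (auto intro: inv_into_into f_inv_into_f)
  have \<gamma>0: "\<gamma> 0 = p" unfolding \<gamma>_def using inj M(3) by simp
  have cl: "Cinf_on UNIV ?l"
  proof
    fix k
    show "Ck_on k UNIV ?l"
      by (intro Ck_on_add Ck_on_const Ck_on_bounded_linear bounded_linear_scaleR_left) simp
  qed
  have rep: "local_rep ?I (\<lambda>t. t) t (\<lambda>t. \<phi> (\<gamma> t)) UNIV ?l" for t
    unfolding local_rep_def using cl \<gamma>U by auto
  \<comment> \<open>The set-theoretic inverse \<open>inv_into U \<phi>\<close> agrees on the chart
    image with the continuous inverse \<open>k\<close> of the homeomorphism, so continuity can be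
    taken from \<open>k\<close>.\<close>
  have cont: "continuous_map (top_of_set ?I) (mtop M) \<gamma>"
  proof -
    obtain k where k: "homeomorphic_maps (subtopology (mtop M) U) (top_of_set (\<phi> ` U)) \<phi> k"
      using chart_homeomorphic[OF M(1,2)] homeomorphic_map_maps by blast
    have tU: "topspace (subtopology (mtop M) U) = U"
      using chart_subset[OF M(1,2)] by (simp add: topspace_subtopology points_def inf.absorb2)
    have kinv: "k y = inv_into U \<phi> y" if "y \<in> \<phi> ` U" for y
    proof -
      obtain q where q: "q \<in> U" "y = \<phi> q" using \<open>y \<in> \<phi> ` U\<close> by blast
      have "k (\<phi> q) = q" using k q(1) tU unfolding homeomorphic_maps_def by auto
      then show ?thesis using q inj by simp
    qed
    have "continuous_map (top_of_set (\<phi> ` U)) (subtopology (mtop M) U) k"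
      using k unfolding homeomorphic_maps_def by blast
    then have ck: "continuous_map (top_of_set (\<phi> ` U)) (mtop M) k"
      by (rule continuous_map_into_fulltopology)
    have "continuous_map (top_of_set ?I) (top_of_set (\<phi> ` U)) ?l"
      using lU by (auto simp: continuous_map_in_subtopology intro!: continuous_intros)
    from continuous_map_compose[OF this ck] have "continuous_map (top_of_set ?I) (mtop M) (k \<circ> ?l)" .
    moreover have "(k \<circ> ?l) t = \<gamma> t" if "t \<in> topspace (top_of_set ?I)" for t
      using kinv[OF lU[of t]] that unfolding \<gamma>_def by simp
    ultimately show ?thesis by (rule continuous_map_eq)
  qed
  have sm: "smooth_map (interval_manifold \<epsilon>) M \<gamma>"
  proof (rule smooth_mapI[OF smooth_manifold_interval M(1)])
    show "continuous_map (mtop (interval_manifold \<epsilon>)) (mtop M) \<gamma>"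
      using cont by (simp add: interval_manifold_def)
    fix t assume "t \<in> points (interval_manifold \<epsilon>)"
    then have t: "t \<in> ?I" by (simp add: points_interval)
    have "smooth_germ (interval_manifold \<epsilon>) t (\<lambda>t. \<phi> (\<gamma> t))"
      by (rule smooth_germI[OF interval_chart t rep])
    then show "\<exists>V \<psi>. (V, \<psi>) \<in> atlas M \<and> \<gamma> t \<in> V \<and> smooth_germ (interval_manifold \<epsilon>) t (\<lambda>q. \<psi> (\<gamma> q))"
      using M(2) \<gamma>U[OF t] by blast
  qed
  have "(?l has_derivative (\<lambda>s. s *\<^sub>R e)) (at 0)" by (auto intro!: derivative_eq_intros)
  then have "frechet_derivative ?l (at 0) 1 = e" by (simp add: frechet_derivative_eqI)
  moreover have "vec_coord M U \<phi> (\<gamma> 0) (velocity M \<gamma>) (frechet_derivative ?l (at 0) 1)"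
    by (rule velocity_vec_coord[OF M(1,2) \<epsilon>(1) rep]) (use \<gamma>U in auto)
  ultimately have "vec_coord M U \<phi> p (velocity M \<gamma>) e" using \<gamma>0 by simp
  moreover have "velocity M \<gamma> \<in> tangent_space M p"
    unfolding tangent_space_def using \<epsilon>(1) sm \<gamma>0 by blast
  ultimately show ?thesis using that by blast
qed

text \<open>By uniqueness, \<open>v\<close> is the velocity constructed for \<open>e\<close>. From
  here on a vector is shown to be tangent by exhibiting a coordinate, without any curve.\<close>

lemma vec_coord_tangent:
  assumes M: "smooth_manifold M" "(U, \<phi>) \<in> atlas M" "p \<in> U" and v: "vec_coord M U \<phi> p v e"
  shows "v \<in> tangent_space M p"
proof -
  have "e \<in> model M" using v unfolding vec_coord_def by simp
  then obtain w where w: "w \<in> tangent_space M p" "vec_coord M U \<phi> p w e"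
    by (rule vec_coord_exists[OF M])
  then show ?thesis using vec_coord_unique[OF M v w(2)] by simp
qed

lemma vec_coord_add:
  assumes M: "smooth_manifold M" "(U, \<phi>) \<in> atlas M" "p \<in> U"
    and v: "vec_coord M U \<phi> p v e" and w: "vec_coord M U \<phi> p w e'"
  shows "vec_coord M U \<phi> p (v + w) (e + e')"
proof -
  have "linear (frechet_derivative h (at (\<phi> p)))" if "local_rep U \<phi> p f B h" for f :: "'a \<Rightarrow> real" and B h
    using local_rep_has_derivative[OF that] has_derivative_linear by blast
  then show ?thesis
    using v w manifold_subspace[OF M(1)] unfolding vec_coord_def
    by (auto simp: subspace_add) (metis linear_add)
qed

lemma vec_coord_scaleR:
  assumes M: "smooth_manifold M" "(U, \<phi>) \<in> atlas M" "p \<in> U"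
    and v: "vec_coord M U \<phi> p v e"
  shows "vec_coord M U \<phi> p (c *\<^sub>R v) (c *\<^sub>R e)"
proof -
  have "linear (frechet_derivative h (at (\<phi> p)))" if "local_rep U \<phi> p f B h" for f :: "'a \<Rightarrow> real" and B h
    using local_rep_has_derivative[OF that] has_derivative_linear by blast
  then show ?thesis
    using v manifold_subspace[OF M(1)] unfolding vec_coord_def
    by (auto simp: subspace_scale scaleR_fun_def) (metis linear_scale real_scaleR_def)
qed

lemma vec_coord_zero:
  assumes M: "smooth_manifold M" "(U, \<phi>) \<in> atlas M" "p \<in> U"
  shows "vec_coord M U \<phi> p 0 0"
proof -
  have "linear (frechet_derivative h (at (\<phi> p)))" if "local_rep U \<phi> p f B h" for f :: "'a \<Rightarrow> real" and B h
    using local_rep_has_derivative[OF that] has_derivative_linear by blast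
  then show ?thesis
    using manifold_subspace[OF M(1)] unfolding vec_coord_def
    by (auto simp: subspace_0) (metis linear_0)
qed

text \<open>It is not evident that a sum of velocities is the velocity of a curve; coordinates can
  be added in the model.\<close>

lemma subspace_tangent_space:
  assumes M: "smooth_manifold M" "p \<in> points M"
  shows "subspace (tangent_space M p)"
proof -
  obtain U \<phi> where U: "(U, \<phi>) \<in> atlas M" "p \<in> U" by (rule manifold_chart_exists[OF M])
  note MU = M(1) U
  show ?thesis
    unfolding subspace_def
  proof (intro conjI ballI allI)
    show "0 \<in> tangent_space M p" by (rule vec_coord_tangent[OF MU vec_coord_zero[OF MU]])
    fix v assume v: "v \<in> tangent_space M p"
    obtain e where e: "vec_coord M U \<phi> p v e" by (rule tangent_space_vec_coord[OF MU v])
    show "c *\<^sub>R v \<in> tangent_space M p" for c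
      by (rule vec_coord_tangent[OF MU vec_coord_scaleR[OF MU e]])
    fix w assume w: "w \<in> tangent_space M p"
    obtain e' where e': "vec_coord M U \<phi> p w e'" by (rule tangent_space_vec_coord[OF MU w])
    show "v + w \<in> tangent_space M p"
      by (rule vec_coord_tangent[OF MU vec_coord_add[OF MU e e']])
  qed
qed

section \<open>Locality and linearity of tangent vectors\<close>

lemma tangent_nonsmooth:
  assumes M: "smooth_manifold M" "p \<in> points M" and v: "v \<in> tangent_space M p" "\<not> smooth_germ M p f"
  shows "v f = 0"
proof -
  obtain U \<phi> where U: "(U, \<phi>) \<in> atlas M" "p \<in> U" by (rule manifold_chart_exists[OF M])
  obtain e where "vec_coord M U \<phi> p v e" by (rule tangent_space_vec_coord[OF M(1) U v(1)])
  then show ?thesis using v(2) unfolding vec_coord_def by blast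
qed

text \<open>Functions that agree near \<open>p\<close> share a representative after shrinking it; if
  one of the germs is not smooth, neither is the other, and both values are the default 0.\<close>

lemma tangent_local:
  assumes M: "smooth_manifold M" and v: "v \<in> tangent_space M p"
    and S: "openin (mtop M) S" "p \<in> S" "\<And>q. q \<in> S \<Longrightarrow> f q = f' q"
  shows "v f = v f'"
proof -
  have p: "p \<in> points M" using openin_subset[OF S(1)] S(2) by (auto simp: points_def)
  obtain U \<phi> where U: "(U, \<phi>) \<in> atlas M" "p \<in> U" by (rule manifold_chart_exists[OF M p])
  obtain e where e: "vec_coord M U \<phi> p v e" by (rule tangent_space_vec_coord[OF M U v])
  show ?thesis
  proof (cases "smooth_germ M p f")
    case True
    obtain B h where B: "local_rep U \<phi> p f B h" by (rule smooth_germ_rep[OF M True U])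
    obtain B' where B': "local_rep U \<phi> p f B' h" "\<And>q. q \<in> U \<Longrightarrow> \<phi> q \<in> B' \<Longrightarrow> q \<in> S"
      by (rule local_rep_shrink[OF M U(1,2) S(2,1) B]) auto
    then have "local_rep U \<phi> p f' B' h" using S(3) unfolding local_rep_def by metis
    from vec_coordD[OF e this] vec_coordD[OF e B] show ?thesis by simp
  next
    case False
    then have "\<not> smooth_germ M p f'" using smooth_germ_cong[OF M S(1,2), of f' f] S(3) by auto
    then show ?thesis using tangent_nonsmooth[OF M p v] False by simp
  qed
qed

lemma tangent_add:
  assumes M: "smooth_manifold M" and v: "v \<in> tangent_space M p"
    and f: "smooth_germ M p f" "smooth_germ M p f'"
  shows "v (\<lambda>q. f q + f' q) = v f + v f'"
proof -
  obtain U \<phi> where U: "(U, \<phi>) \<in> atlas M" "p \<in> U"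
    by (rule manifold_chart_exists[OF M smooth_germ_points[OF M f(1)]])
  obtain e where e: "vec_coord M U \<phi> p v e" by (rule tangent_space_vec_coord[OF M U v])
  obtain B h where B: "local_rep U \<phi> p f B h" by (rule smooth_germ_rep[OF M f(1) U])
  obtain B' h' where B': "local_rep U \<phi> p f' B' h'" by (rule smooth_germ_rep[OF M f(2) U])
  have "frechet_derivative (\<lambda>x. h x + h' x) (at (\<phi> p)) =
      (\<lambda>e. frechet_derivative h (at (\<phi> p)) e + frechet_derivative h' (at (\<phi> p)) e)"
    by (intro frechet_derivative_eqI has_derivative_add local_rep_has_derivative[OF B]
        local_rep_has_derivative[OF B'])
  then show ?thesis
    using vec_coordD[OF e local_rep_add[OF B B']] vec_coordD[OF e B] vec_coordD[OF e B'] by simp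
qed

lemma tangent_scaleR:
  assumes M: "smooth_manifold M" and v: "v \<in> tangent_space M p" and f: "smooth_germ M p f"
  shows "v (\<lambda>q. c * f q) = c * v f"
proof -
  obtain U \<phi> where U: "(U, \<phi>) \<in> atlas M" "p \<in> U"
    by (rule manifold_chart_exists[OF M smooth_germ_points[OF M f]])
  obtain e where e: "vec_coord M U \<phi> p v e" by (rule tangent_space_vec_coord[OF M U v])
  obtain B h where B: "local_rep U \<phi> p f B h" by (rule smooth_germ_rep[OF M f U])
  have "frechet_derivative (\<lambda>x. c * h x) (at (\<phi> p)) =
      (\<lambda>e. c * frechet_derivative h (at (\<phi> p)) e)"
    by (intro frechet_derivative_eqI has_derivative_mult_right local_rep_has_derivative[OF B])
  then show ?thesis
    using vec_coordD[OF e local_rep_linear[OF B bounded_linear_mult_right[of c]]] vec_coordD[OF e B] by simp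
qed

lemma tangent_diff:
  assumes M: "smooth_manifold M" and v: "v \<in> tangent_space M p"
    and f: "smooth_germ M p f" "smooth_germ M p f'"
  shows "v (\<lambda>q. f q - f' q) = v f - v f'"
proof -
  have g: "smooth_germ M p (\<lambda>q. - 1 * f' q)" using smooth_germ_scaleR[OF f(2), of "-1"] by simp
  show ?thesis
    using tangent_add[OF M v f(1) g] tangent_scaleR[OF M v f(2), of "-1"] by simp
qed

lemma tangent_const:
  assumes M: "smooth_manifold M" and v: "v \<in> tangent_space M p" and p: "p \<in> points M"
  shows "v (\<lambda>q. c) = 0"
proof -
  obtain U \<phi> where U: "(U, \<phi>) \<in> atlas M" "p \<in> U" by (rule manifold_chart_exists[OF M p])
  obtain e where e: "vec_coord M U \<phi> p v e" by (rule tangent_space_vec_coord[OF M U v])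
  have "v (\<lambda>q. c) = frechet_derivative (\<lambda>x. c) (at (\<phi> p)) e"
    by (rule vec_coordD[OF e local_rep_const])
  then show ?thesis by simp
qed

text \<open>In coordinates the differential is the derivative of the coordinate expression
  \<open>h\<close> of \<open>F\<close>. It respects the models because \<open>h\<close> sends points
  of the chart image near \<open>\<phi> p\<close> into \<open>model N\<close>.\<close>

lemma differential_tangent:
  assumes M: "smooth_manifold M" "smooth_manifold N" and F: "smooth_map M N F"
    and p: "p \<in> points M" and v: "v \<in> tangent_space M p"
  shows "differential N F p v \<in> tangent_space N (F p)"
proof -
  have Fp: "F p \<in> points N"
    using F p unfolding smooth_map_def points_def continuous_map by blast
  obtain U \<phi> where U: "(U, \<phi>) \<in> atlas M" "p \<in> U" by (rule manifold_chart_exists[OF M(1) p])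
  obtain V \<psi> where V: "(V, \<psi>) \<in> atlas N" "F p \<in> V" by (rule manifold_chart_exists[OF M(2) Fp])
  obtain e where e: "vec_coord M U \<phi> p v e" by (rule tangent_space_vec_coord[OF M(1) U v])
  obtain B h where B: "local_rep U \<phi> p (\<lambda>q. \<psi> (F q)) B h" "\<And>q. q \<in> U \<Longrightarrow> \<phi> q \<in> B \<Longrightarrow> F q \<in> V"
    by (rule smooth_map_rep[OF M F U V]) auto
  let ?D = "frechet_derivative h (at (\<phi> p))"
  note dh = local_rep_has_derivative[OF B(1)]
  have hp: "h (\<phi> p) = \<psi> (F p)" using B(1) U(2) unfolding local_rep_def by auto
  obtain O' where O': "open O'" "\<phi> ` U = model M \<inter> O'"
    using chart_image_openin[OF M(1) U(1)] unfolding openin_open by blast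
  have mem: "?D e \<in> model N"
  proof (rule has_derivative_subspace[OF dh manifold_subspace[OF M(1)] chart_model[OF M(1) U] _ manifold_subspace[OF M(2)]])
    show "e \<in> model M" using e unfolding vec_coord_def by blast
    show "open (B \<inter> O')" "\<phi> p \<in> B \<inter> O'" using B(1) O' U(2) unfolding local_rep_def by auto
    fix y assume y: "y \<in> B \<inter> O'" "y \<in> model M"
    then obtain q where q: "q \<in> U" "y = \<phi> q" using O' by blast
    then have "h y = \<psi> (F q)" "F q \<in> V" using B y unfolding local_rep_def by auto
    then show "h y \<in> model N" using chart_model[OF M(2) V(1)] by simp
  qed
  have "v (\<lambda>q. f (F q)) = frechet_derivative k (at (\<psi> (F p))) (?D e)"
    if k: "local_rep V \<psi> (F p) f C k" for f C k
  proof -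
    have C: "open C" "\<psi> (F p) \<in> C" "Cinf_on C k" using k unfolding local_rep_def by auto
    have "local_rep U \<phi> p (\<lambda>q. k (\<psi> (F q))) {x\<in>B. h x \<in> C} (\<lambda>x. k (h x))"
      by (rule local_rep_compose[where H = k, OF B(1) C U(2)])
    moreover have "f (F q) = k (\<psi> (F q))" if "q \<in> U" "\<phi> q \<in> {x\<in>B. h x \<in> C}" for q
      using that B k unfolding local_rep_def by auto
    ultimately have "local_rep U \<phi> p (\<lambda>q. f (F q)) {x\<in>B. h x \<in> C} (\<lambda>x. k (h x))"
      unfolding local_rep_def by simp
    then have "v (\<lambda>q. f (F q)) = frechet_derivative (\<lambda>x. k (h x)) (at (\<phi> p)) e"
      by (rule vec_coordD[OF e])
    also have "frechet_derivative (\<lambda>x. k (h x)) (at (\<phi> p)) =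
        (\<lambda>e. frechet_derivative k (at (\<psi> (F p))) (?D e))"
      by (rule frechet_derivative_eqI, rule has_derivative_compose[OF dh])
         (use local_rep_has_derivative[OF k] hp in simp)
    finally show ?thesis .
  qed
  moreover have "smooth_fun_at N (F p) f" if "local_rep V \<psi> (F p) f C k" for f C k
    unfolding smooth_fun_at_iff_germ[OF M(2)] by (rule smooth_germI[OF V that])
  ultimately have "vec_coord N V \<psi> (F p) (differential N F p v) (?D e)"
    unfolding vec_coord_def differential_def using mem smooth_fun_at_iff_germ[OF M(2)] by simp
  then show ?thesis by (rule vec_coord_tangent[OF M(2) V])
qed

section \<open>Vector fields and their brackets\<close>

lemma vector_field_tangent: "vector_field M X \<Longrightarrow> p \<in> points M \<Longrightarrow> X p \<in> tangent_space M p"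
  unfolding vector_field_def by blast

lemma vector_field_outside: "vector_field M X \<Longrightarrow> p \<notin> points M \<Longrightarrow> X p = 0"
  unfolding vector_field_def by blast

lemma vector_field_germ:
  assumes M: "smooth_manifold M" and X: "vector_field M X" and f: "smooth_germ M p f"
  shows "smooth_germ M p (\<lambda>q. X q f)"
proof -
  obtain W where W: "openin (mtop M) W" "p \<in> W" "\<And>q. q \<in> W \<Longrightarrow> smooth_germ M q f"
    by (rule smooth_germ_nbhd[OF M f]) auto
  then have "smooth_fun_on M W f" unfolding smooth_fun_on_iff_germ[OF M] by blast
  then have "smooth_fun_on M W (\<lambda>q. X q f)" using X unfolding vector_field_def by blast
  then show ?thesis using W(2) unfolding smooth_fun_on_iff_germ[OF M] by blast
qed

lemma vector_fieldI:
  assumes M: "smooth_manifold M" and "\<And>p. p \<in> points M \<Longrightarrow> X p \<in> tangent_space M p"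
    "\<And>p. p \<notin> points M \<Longrightarrow> X p = 0"
    "\<And>p f. smooth_germ M p f \<Longrightarrow> smooth_germ M p (\<lambda>q. X q f)"
  shows "vector_field M X"
  unfolding vector_field_def smooth_fun_on_iff_germ[OF M] using assms by blast

lemma vector_field_add:
  assumes M: "smooth_manifold M" and X: "vector_field M X" "vector_field M Y"
  shows "vector_field M (X + Y)"
proof (rule vector_fieldI[OF M])
  fix p
  show "p \<in> points M \<Longrightarrow> (X + Y) p \<in> tangent_space M p"
    using vector_field_tangent[OF X(1)] vector_field_tangent[OF X(2)] subspace_add[OF subspace_tangent_space[OF M]]
    by simp
  show "p \<notin> points M \<Longrightarrow> (X + Y) p = 0"
    using vector_field_outside[OF X(1)] vector_field_outside[OF X(2)] by simp
  fix f :: "_ \<Rightarrow> real" assume "smooth_germ M p f"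
  then show "smooth_germ M p (\<lambda>q. (X + Y) q f)"
    using smooth_germ_add[OF M vector_field_germ[OF M X(1)] vector_field_germ[OF M X(2)], of p f f] by simp
qed

lemma vector_field_scaleR:
  assumes M: "smooth_manifold M" and X: "vector_field M X"
  shows "vector_field M (c *\<^sub>R X)"
proof (rule vector_fieldI[OF M])
  fix p
  show "p \<in> points M \<Longrightarrow> (c *\<^sub>R X) p \<in> tangent_space M p"
    using vector_field_tangent[OF X] subspace_scale[OF subspace_tangent_space[OF M]]
    by (simp add: scaleR_fun_def[of c X])
  show "p \<notin> points M \<Longrightarrow> (c *\<^sub>R X) p = 0"
    using vector_field_outside[OF X] by (simp add: scaleR_fun_def[of c X])
  fix f :: "_ \<Rightarrow> real" assume f: "smooth_germ M p f"
  show "smooth_germ M p (\<lambda>q. (c *\<^sub>R X) q f)"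
    using smooth_germ_scaleR[OF vector_field_germ[OF M X f], of c] by (simp add: scaleR_fun_def)
qed

lemma vector_field_zero: "smooth_manifold M \<Longrightarrow> vector_field M 0"
  by (rule vector_fieldI)
     (auto simp: subspace_0[OF subspace_tangent_space] intro!: smooth_germ_const dest: smooth_germ_points)

lemma local_rep_inner_chart: "p \<in> U \<Longrightarrow> local_rep U \<phi> p (\<lambda>q. \<phi> q \<bullet> b) UNIV (\<lambda>x. x \<bullet> b)"
  by (rule local_rep_linear[OF local_rep_chart bounded_linear_inner_left])

lemma vec_coord_expansion:
  assumes p: "p \<in> U" and v: "vec_coord M U \<phi> p v e"
  shows "e = (\<Sum>b\<in>Basis. v (\<lambda>q. \<phi> q \<bullet> b) *\<^sub>R b)"
proof -
  have "v (\<lambda>q. \<phi> q \<bullet> b) = e \<bullet> b" for b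
  proof -
    have "frechet_derivative (\<lambda>x. x \<bullet> b) (at (\<phi> p)) = (\<lambda>x. x \<bullet> b)"
      by (rule frechet_derivative_eqI) (rule bounded_linear_imp_has_derivative[OF bounded_linear_inner_left])
    then show ?thesis using vec_coordD[OF v local_rep_inner_chart[OF p]] by simp
  qed
  then show ?thesis by (simp add: euclidean_representation)
qed

text \<open>The components are the values of the field on the coordinate functions, so they are
  smooth because the field preserves smooth germs.\<close>

lemma vector_field_coord:
  assumes M: "smooth_manifold M" and U: "(U, \<phi>) \<in> atlas M" and X: "vector_field M X"
  obtains \<xi> where "\<And>q. q \<in> U \<Longrightarrow> vec_coord M U \<phi> q (X q) (\<xi> q)" "\<And>q. q \<in> U \<Longrightarrow> smooth_germ M q \<xi>"
proof -
  define \<xi> where "\<xi> q = (\<Sum>b\<in>Basis. X q (\<lambda>q. \<phi> q \<bullet> b) *\<^sub>R b)" for q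
  show ?thesis
  proof (rule that[of \<xi>])
    fix q assume q: "q \<in> U"
    have qM: "q \<in> points M" using q chart_subset[OF M U] by blast
    obtain e where e: "vec_coord M U \<phi> q (X q) e"
      by (rule tangent_space_vec_coord[OF M U q vector_field_tangent[OF X qM]])
    then have "e = \<xi> q" unfolding \<xi>_def by (rule vec_coord_expansion[OF q])
    then show "vec_coord M U \<phi> q (X q) (\<xi> q)" using e by simp
    show "smooth_germ M q \<xi>"
      unfolding \<xi>_def[abs_def]
    proof (rule smooth_germ_sum[OF M qM])
      fix b :: 'b
      show "smooth_germ M q (\<lambda>q. X q (\<lambda>q. \<phi> q \<bullet> b) *\<^sub>R b)"
        by (rule smooth_germ_linear[OF vector_field_germ[OF M X smooth_germ_linear[OF smooth_germ_chart[OF U q]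
                bounded_linear_inner_left]] bounded_linear_scaleR_left])
    qed
  qed
qed

text \<open>Differentiating along two fields in succession: a first-order term, and a Hessian term
  written as a double sum over basis indices so that exchanging the two fields amounts to exchanging
  the indices.\<close>

lemma derivative_along_field:
  fixes F :: "'a::euclidean_space \<Rightarrow> real" and \<eta> :: "'a \<Rightarrow> 'a"
  assumes B: "open B" "x \<in> B" and F: "Cinf_on B F" and \<eta>: "Cinf_on B \<eta>"
  shows "Cinf_on B (\<lambda>y. frechet_derivative F (at y) (\<eta> y))" (is ?A)
    and "frechet_derivative (\<lambda>y. frechet_derivative F (at y) (\<eta> y)) (at x) e =
      frechet_derivative F (at x) (frechet_derivative \<eta> (at x) e) +
      (\<Sum>b\<in>Basis. \<Sum>c\<in>Basis. (\<eta> x \<bullet> b) * (e \<bullet> c) *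
         frechet_derivative (\<lambda>y. frechet_derivative F (at y) b) (at x) c)" (is ?B)
proof -
  let ?D = "\<lambda>y. frechet_derivative F (at y)"
  let ?H = "\<lambda>y. \<Sum>b\<in>Basis. (\<eta> y \<bullet> b) *\<^sub>R ?D y b"
  have lin: "linear (?D y)" if "y \<in> B" for y
    using Cinf_on_has_derivative[OF F that] has_derivative_linear by blast
  have eq: "?H y = ?D y (\<eta> y)" if "y \<in> B" for y
    using linear_Basis_expansion[OF lin[OF that], of "\<eta> y"] by simp
  have H: "Cinf_on B ?H"
  proof
    fix k
    show "Ck_on k B ?H"
    proof (rule Ck_on_sum[OF B(1)])
      fix b :: 'a
      show "Ck_on k B (\<lambda>y. (\<eta> y \<bullet> b) *\<^sub>R ?D y b)"
        using Ck_on_linear_compose[OF B(1) bounded_linear_inner_left, of k \<eta> b] \<eta> Cinf_on_derivative[OF F, of b]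
        by (intro Ck_on_scaleR[OF B(1)]) auto
    qed
  qed
  show ?A
  proof
    fix k
    show "Ck_on k B (\<lambda>y. ?D y (\<eta> y))"
      by (rule Ck_on_cong[OF B(1), of ?H]) (use eq H in auto)
  qed
  let ?Q = "\<lambda>b e. frechet_derivative (\<lambda>y. ?D y b) (at x) e"
  have d\<eta>: "(\<eta> has_derivative frechet_derivative \<eta> (at x)) (at x)"
    by (rule Cinf_on_has_derivative[OF \<eta> B(2)])
  have dD: "((\<lambda>y. ?D y b) has_derivative ?Q b) (at x)" for b
    by (rule Cinf_on_has_derivative[OF Cinf_on_derivative[OF F] B(2)])
  have dH: "(?H has_derivative (\<lambda>e. \<Sum>b\<in>Basis.
      (\<eta> x \<bullet> b) *\<^sub>R ?Q b e + (frechet_derivative \<eta> (at x) e \<bullet> b) *\<^sub>R ?D x b)) (at x)"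
    by (intro has_derivative_sum has_derivative_scaleR has_derivative_inner_left[OF d\<eta>] dD)
  have d: "((\<lambda>y. ?D y (\<eta> y)) has_derivative (\<lambda>e. \<Sum>b\<in>Basis.
      (\<eta> x \<bullet> b) *\<^sub>R ?Q b e + (frechet_derivative \<eta> (at x) e \<bullet> b) *\<^sub>R ?D x b)) (at x)"
    by (rule has_derivative_transform_within_open[OF dH B eq])
  have Qc: "?Q b e = (\<Sum>c\<in>Basis. (e \<bullet> c) * ?Q b c)" for b
    using linear_Basis_expansion[OF has_derivative_linear[OF dD], of b e] by simp
  have "frechet_derivative (\<lambda>y. ?D y (\<eta> y)) (at x) e =
      (\<Sum>b\<in>Basis. (\<eta> x \<bullet> b) * ?Q b e) + (\<Sum>b\<in>Basis. (frechet_derivative \<eta> (at x) e \<bullet> b) *\<^sub>R ?D x b)"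
    unfolding frechet_derivative_eqI[OF d] by (simp add: sum.distrib)
  also have "(\<Sum>b\<in>Basis. (frechet_derivative \<eta> (at x) e \<bullet> b) *\<^sub>R ?D x b) = ?D x (frechet_derivative \<eta> (at x) e)"
    by (rule linear_Basis_expansion[OF lin[OF B(2)], symmetric])
  also have "(\<Sum>b\<in>Basis. (\<eta> x \<bullet> b) * ?Q b e) = (\<Sum>b\<in>Basis. \<Sum>c\<in>Basis. (\<eta> x \<bullet> b) * (e \<bullet> c) * ?Q b c)"
  proof (rule sum.cong[OF refl])
    fix b :: 'a
    show "(\<eta> x \<bullet> b) * ?Q b e = (\<Sum>c\<in>Basis. (\<eta> x \<bullet> b) * (e \<bullet> c) * ?Q b c)"
      by (subst Qc) (simp add: sum_distrib_left mult.assoc)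
  qed
  finally show ?B by simp
qed

section \<open>The Lie bracket of vector fields\<close>

lemma lie_bracket_apply:
  "smooth_manifold M \<Longrightarrow> smooth_germ M p f \<Longrightarrow>
     lie_bracket M X Y p f = X p (\<lambda>q. Y q f) - Y p (\<lambda>q. X q f)"
  unfolding lie_bracket_def by (simp add: smooth_fun_at_iff_germ)

lemma lie_bracket_nonsmooth:
  "smooth_manifold M \<Longrightarrow> \<not> smooth_germ M p f \<Longrightarrow> lie_bracket M X Y p f = 0"
  unfolding lie_bracket_def by (simp add: smooth_fun_at_iff_germ)

text \<open>In a chart, the second derivatives in the commutator cancel by symmetry.\<close>

lemma lie_bracket_tangent:
  assumes M: "smooth_manifold M" and X: "vector_field M X" and Y: "vector_field M Y"
    and p: "p \<in> points M"
  shows "lie_bracket M X Y p \<in> tangent_space M p"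
proof -
  obtain U \<phi> where U: "(U, \<phi>) \<in> atlas M" "p \<in> U" by (rule manifold_chart_exists[OF M p])
  obtain \<xi> where \<xi>: "\<And>q. q \<in> U \<Longrightarrow> vec_coord M U \<phi> q (X q) (\<xi> q)" "\<And>q. q \<in> U \<Longrightarrow> smooth_germ M q \<xi>"
    by (rule vector_field_coord[OF M U(1) X]) auto
  obtain \<eta> where \<eta>: "\<And>q. q \<in> U \<Longrightarrow> vec_coord M U \<phi> q (Y q) (\<eta> q)" "\<And>q. q \<in> U \<Longrightarrow> smooth_germ M q \<eta>"
    by (rule vector_field_coord[OF M U(1) Y]) auto
  obtain A x where A: "local_rep U \<phi> p \<xi> A x" by (rule smooth_germ_rep[OF M \<xi>(2)[OF U(2)] U])
  obtain A' y where A': "local_rep U \<phi> p \<eta> A' y" by (rule smooth_germ_rep[OF M \<eta>(2)[OF U(2)] U])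
  let ?p = "\<phi> p"
  have xp: "x ?p = \<xi> p" using A U(2) unfolding local_rep_def by auto
  have yp: "y ?p = \<eta> p" using A' U(2) unfolding local_rep_def by auto
  obtain O' where O': "open O'" "\<phi> ` U = model M \<inter> O'"
    using chart_image_openin[OF M U(1)] unfolding openin_open by blast
  \<comment> \<open>The components of a vector field take values in the model on the chart image, so
    their derivatives along model vectors do too; this puts \<open>?z\<close>, the coordinate vector
    of the bracket, into the model.\<close>
  have field_derivative: "frechet_derivative z (at ?p) e \<in> model M"
    if z: "local_rep U \<phi> p \<zeta> C z" and \<zeta>: "\<And>q. q \<in> U \<Longrightarrow> vec_coord M U \<phi> q (Z q) (\<zeta> q)" and e: "e \<in> model M"
    for z \<zeta> C Z e
  proof (rule has_derivative_subspace[OF local_rep_has_derivative[OF z] manifold_subspace[OF M]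
        chart_model[OF M U] e manifold_subspace[OF M]])
    show "open (C \<inter> O')" "\<phi> p \<in> C \<inter> O'" using z O' U(2) unfolding local_rep_def by auto
    fix u assume u: "u \<in> C \<inter> O'" "u \<in> model M"
    then obtain q where q: "q \<in> U" "u = \<phi> q" using O' by blast
    then have "z u = \<zeta> q" using z u unfolding local_rep_def by auto
    then show "z u \<in> model M" using \<zeta>[OF q(1)] unfolding vec_coord_def by simp
  qed
  have model: "\<xi> p \<in> model M" "\<eta> p \<in> model M" using \<xi>(1)[OF U(2)] \<eta>(1)[OF U(2)] unfolding vec_coord_def by auto
  let ?Dx = "frechet_derivative x (at ?p)" and ?Dy = "frechet_derivative y (at ?p)"
  let ?z = "?Dy (\<xi> p) - ?Dx (\<eta> p)"
  have zm: "?z \<in> model M"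
    by (intro subspace_diff[OF manifold_subspace[OF M]] field_derivative[OF A' \<eta>(1) model(1)]
        field_derivative[OF A \<xi>(1) model(2)])
  have iterated: "Z p (\<lambda>q. W q f) = frechet_derivative (\<lambda>u. frechet_derivative h (at u) (w u)) (at ?p) (\<zeta> p)"
    if h: "local_rep U \<phi> p f C h" and w: "local_rep U \<phi> p \<omega> C' w"
      and W: "\<And>q. q \<in> U \<Longrightarrow> vec_coord M U \<phi> q (W q) (\<omega> q)"
      and Z: "\<And>q. q \<in> U \<Longrightarrow> vec_coord M U \<phi> q (Z q) (\<zeta> q)"
    for f C h W w \<omega> Z \<zeta> C'
  proof (rule vec_coordD[OF Z[OF U(2)]])
    have "open (C \<inter> C')" "?p \<in> C \<inter> C'" "Cinf_on (C \<inter> C') h" "Cinf_on (C \<inter> C') w"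
      using h w unfolding local_rep_def by (auto intro: Ck_on_subset)
    moreover have "W q f = frechet_derivative h (at (\<phi> q)) (w (\<phi> q))" if q: "q \<in> U" "\<phi> q \<in> C \<inter> C'" for q
    proof -
      have "local_rep U \<phi> q f C h" by (rule local_rep_nbhd[OF h]) (use q in simp)
      from vec_coordD[OF W[OF q(1)] this] show ?thesis
        using w q unfolding local_rep_def by auto
    qed
    ultimately show "local_rep U \<phi> p (\<lambda>q. W q f) (C \<inter> C') (\<lambda>u. frechet_derivative h (at u) (w u))"
      unfolding local_rep_def using derivative_along_field(1)[of "C \<inter> C'" _ h w] by blast
  qed
  have "lie_bracket M X Y p f = frechet_derivative h (at ?p) ?z" if h: "local_rep U \<phi> p f C h" for f C h
  proof -
    let ?Q = "\<lambda>b c. frechet_derivative (\<lambda>u. frechet_derivative h (at u) b) (at ?p) c"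
    have C: "open C" "?p \<in> C" "Cinf_on C h" using h unfolding local_rep_def by auto
    have e: "open (C \<inter> A)" "?p \<in> C \<inter> A" "Cinf_on (C \<inter> A) h" "Cinf_on (C \<inter> A) x"
      "open (C \<inter> A')" "?p \<in> C \<inter> A'" "Cinf_on (C \<inter> A') h" "Cinf_on (C \<inter> A') y"
      using C A A' unfolding local_rep_def by (auto intro: Ck_on_subset)
    have "X p (\<lambda>q. Y q f) = frechet_derivative h (at ?p) (?Dy (\<xi> p)) +
        (\<Sum>b\<in>Basis. \<Sum>c\<in>Basis. (\<eta> p \<bullet> b) * (\<xi> p \<bullet> c) * ?Q b c)"
      using iterated[OF h A' \<eta>(1) \<xi>(1)] derivative_along_field(2)[OF e(5-8), of "\<xi> p"] yp by simp
    moreover have "Y p (\<lambda>q. X q f) = frechet_derivative h (at ?p) (?Dx (\<eta> p)) +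
        (\<Sum>b\<in>Basis. \<Sum>c\<in>Basis. (\<xi> p \<bullet> b) * (\<eta> p \<bullet> c) * ?Q b c)"
      using iterated[OF h A \<xi>(1) \<eta>(1)] derivative_along_field(2)[OF e(1-4), of "\<eta> p"] xp by simp
    moreover have "(\<Sum>b\<in>Basis. \<Sum>c\<in>Basis. (\<xi> p \<bullet> b) * (\<eta> p \<bullet> c) * ?Q b c) =
        (\<Sum>b\<in>Basis. \<Sum>c\<in>Basis. (\<eta> p \<bullet> b) * (\<xi> p \<bullet> c) * ?Q b c)"
    \<comment> \<open>Renaming the summation indices leaves exactly the symmetry of the Hessian to
      be used.\<close>
    proof (subst sum.swap, intro sum.cong refl)
      fix b c :: 'b
      show "(\<xi> p \<bullet> c) * (\<eta> p \<bullet> b) * ?Q c b = (\<eta> p \<bullet> b) * (\<xi> p \<bullet> c) * ?Q b c"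
        using second_derivative_symmetric[OF C(1,3,2), of c b] by simp
    qed
    moreover have "linear (frechet_derivative h (at ?p))"
      using local_rep_has_derivative[OF h] has_derivative_linear by blast
    ultimately show ?thesis
      using lie_bracket_apply[OF M smooth_germI[OF U h], of X Y] linear_diff by fastforce
  qed
  then have "vec_coord M U \<phi> p (lie_bracket M X Y p) ?z"
    unfolding vec_coord_def using zm lie_bracket_nonsmooth[OF M] by blast
  then show ?thesis by (rule vec_coord_tangent[OF M U])
qed

lemma lie_bracket_vector_field:
  assumes M: "smooth_manifold M" and X: "vector_field M X" and Y: "vector_field M Y"
  shows "vector_field M (lie_bracket M X Y)"
proof (rule vector_fieldI[OF M])
  fix p
  show "p \<in> points M \<Longrightarrow> lie_bracket M X Y p \<in> tangent_space M p"
    by (rule lie_bracket_tangent[OF M X Y])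
  show "p \<notin> points M \<Longrightarrow> lie_bracket M X Y p = 0"
    using lie_bracket_nonsmooth[OF M] smooth_germ_points[OF M] by fastforce
  fix f :: "_ \<Rightarrow> real" assume f: "smooth_germ M p f"
  obtain W where W: "openin (mtop M) W" "p \<in> W" "\<And>q. q \<in> W \<Longrightarrow> smooth_germ M q f"
    by (rule smooth_germ_nbhd[OF M f]) auto
  have "smooth_germ M p (\<lambda>q. X q (\<lambda>r. Y r f) - Y q (\<lambda>r. X r f))"
    by (intro smooth_germ_diff[OF M] vector_field_germ[OF M X] vector_field_germ[OF M Y] f)
  then show "smooth_germ M p (\<lambda>q. lie_bracket M X Y q f)"
    by (rule smooth_germ_cong[OF M W(1,2), rotated]) (simp add: lie_bracket_apply[OF M W(3)])
qed

lemma lie_bracket_skew: "lie_bracket M X Y = - lie_bracket M Y X"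
  unfolding lie_bracket_def by (auto simp: fun_eq_iff)

lemma lie_bracket_add_left:
  assumes M: "smooth_manifold M" and X: "vector_field M X" "vector_field M X'" and Y: "vector_field M Y"
  shows "lie_bracket M (X + X') Y = lie_bracket M X Y + lie_bracket M X' Y"
proof (intro ext)
  fix p f
  show "lie_bracket M (X + X') Y p f = (lie_bracket M X Y + lie_bracket M X' Y) p f"
  proof (cases "smooth_germ M p f")
    case f: True
    have "Y p (\<lambda>q. X q f + X' q f) = Y p (\<lambda>q. X q f) + Y p (\<lambda>q. X' q f)"
      by (rule tangent_add[OF M vector_field_tangent[OF Y smooth_germ_points[OF M f]]
          vector_field_germ[OF M X(1) f] vector_field_germ[OF M X(2) f]])
    then show ?thesis by (simp add: lie_bracket_apply[OF M f])
  qed (simp add: lie_bracket_nonsmooth[OF M])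
qed

lemma lie_bracket_scaleR_left:
  assumes M: "smooth_manifold M" and X: "vector_field M X" and Y: "vector_field M Y"
  shows "lie_bracket M (c *\<^sub>R X) Y = c *\<^sub>R lie_bracket M X Y"
proof (intro ext)
  fix p f
  show "lie_bracket M (c *\<^sub>R X) Y p f = (c *\<^sub>R lie_bracket M X Y) p f"
  proof (cases "smooth_germ M p f")
    case f: True
    have "Y p (\<lambda>q. c * X q f) = c * Y p (\<lambda>q. X q f)"
      by (rule tangent_scaleR[OF M vector_field_tangent[OF Y smooth_germ_points[OF M f]]
          vector_field_germ[OF M X f]])
    then show ?thesis by (simp add: lie_bracket_apply[OF M f] scaleR_fun_def right_diff_distrib)
  qed (simp add: lie_bracket_nonsmooth[OF M] scaleR_fun_def)
qed

text \<open>The commutator formula for the inner bracket holds only where \<open>f\<close> is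
  smooth; since that is a whole neighbourhood of \<open>p\<close>, locality allows it under the
  outer field.\<close>

lemma vector_field_lie_bracket_apply:
  assumes M: "smooth_manifold M" and X: "vector_field M X" and Y: "vector_field M Y"
    and Z: "vector_field M Z" and f: "smooth_germ M p f"
  shows "X p (\<lambda>q. lie_bracket M Y Z q f) = X p (\<lambda>q. Y q (\<lambda>r. Z r f)) - X p (\<lambda>q. Z q (\<lambda>r. Y r f))"
proof -
  have p: "p \<in> points M" by (rule smooth_germ_points[OF M f])
  obtain W where W: "openin (mtop M) W" "p \<in> W" "\<And>q. q \<in> W \<Longrightarrow> smooth_germ M q f"
    by (rule smooth_germ_nbhd[OF M f]) auto
  have "X p (\<lambda>q. lie_bracket M Y Z q f) = X p (\<lambda>q. Y q (\<lambda>r. Z r f) - Z q (\<lambda>r. Y r f))"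
    by (rule tangent_local[OF M vector_field_tangent[OF X p] W(1,2)]) (simp add: lie_bracket_apply[OF M W(3)])
  also have "\<dots> = X p (\<lambda>q. Y q (\<lambda>r. Z r f)) - X p (\<lambda>q. Z q (\<lambda>r. Y r f))"
    by (rule tangent_diff[OF M vector_field_tangent[OF X p] vector_field_germ[OF M Y vector_field_germ[OF M Z f]]
        vector_field_germ[OF M Z vector_field_germ[OF M Y f]]])
  finally show ?thesis .
qed

text \<open>The derivation form of the Jacobi identity, valid for commutators of operators: after
  unfolding, the threefold compositions cancel. This form says that the adjoint map of a bracket is
  a commutator.\<close>

lemma lie_bracket_jacobi:
  assumes M: "smooth_manifold M" and X: "vector_field M X" and Y: "vector_field M Y" and Z: "vector_field M Z"
  shows "lie_bracket M (lie_bracket M X Y) Z =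
    lie_bracket M X (lie_bracket M Y Z) - lie_bracket M Y (lie_bracket M X Z)"
proof (intro ext)
  fix p f
  show "lie_bracket M (lie_bracket M X Y) Z p f =
    (lie_bracket M X (lie_bracket M Y Z) - lie_bracket M Y (lie_bracket M X Z)) p f"
  proof (cases "smooth_germ M p f")
    case f: True
    note ap = lie_bracket_apply[OF M f] lie_bracket_apply[OF M vector_field_germ[OF M X f]]
      lie_bracket_apply[OF M vector_field_germ[OF M Y f]] lie_bracket_apply[OF M vector_field_germ[OF M Z f]]
    show ?thesis
      using vector_field_lie_bracket_apply[OF M X Y Z f] vector_field_lie_bracket_apply[OF M Y X Z f]
        vector_field_lie_bracket_apply[OF M Z X Y f]
      by (simp add: ap)
  qed (simp add: lie_bracket_nonsmooth[OF M])
qed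

section \<open>Left-invariant vector fields\<close>

lemma lie_group_facts:
  assumes "lie_group G M"
  shows lie_group_group: "group G"
    and lie_group_manifold: "smooth_manifold M"
    and lie_group_points: "points M = carrier G"
    and lie_group_mult: "smooth_map (prod_manifold M M) M (\<lambda>(x, y). x \<otimes>\<^bsub>G\<^esub> y)"
  using assms unfolding lie_group_def by auto

lemma lie_group_mult_continuous:
  "lie_group G M \<Longrightarrow> continuous_map (prod_topology (mtop M) (mtop M)) (mtop M) (\<lambda>(x, y). x \<otimes>\<^bsub>G\<^esub> y)"
  using lie_group_mult unfolding smooth_map_def prod_manifold_def by fastforce

text \<open>Smoothness gives a representative only over the pairs whose product lies in
  \<open>Y\<close>. By continuity these contain a box \<open>A1 \<times> A2\<close> around
  \<open>(p, q)\<close>, and restricting to its coordinates removes the side condition.\<close>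

lemma lie_group_mult_rep:
  assumes G: "lie_group G M"
    and U: "(U, \<phi>) \<in> atlas M" "p \<in> U" and V: "(V, \<theta>) \<in> atlas M" "q \<in> V"
    and Y: "(Y, \<psi>) \<in> atlas M" "p \<otimes>\<^bsub>G\<^esub> q \<in> Y"
  obtains B h where "open B" "(\<phi> p, \<theta> q) \<in> B" "Cinf_on B h"
    "\<And>p' q'. p' \<in> U \<Longrightarrow> q' \<in> V \<Longrightarrow> (\<phi> p', \<theta> q') \<in> B \<Longrightarrow>
       p' \<otimes>\<^bsub>G\<^esub> q' \<in> Y \<and> \<psi> (p' \<otimes>\<^bsub>G\<^esub> q') = h (\<phi> p', \<theta> q')"
proof -
  note M = lie_group_manifold[OF G]
  let ?m = "\<lambda>(x, y). x \<otimes>\<^bsub>G\<^esub> y"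
  let ?S = "{x \<in> U \<times> V. ?m x \<in> Y}"
  let ?f = "map_prod \<phi> \<theta>"
  have ch: "(U \<times> V, ?f) \<in> atlas (prod_manifold M M)"
    using U V unfolding prod_manifold_def by auto
  have sm: "smooth_on (?f ` ?S) (\<lambda>x. \<psi> (?m (inv_into (U \<times> V) ?f x)))"
    using lie_group_mult[OF G] ch Y(1) unfolding smooth_map_def by fast
  have inj: "inj_on ?f (U \<times> V)"
    by (rule map_prod_inj_on[OF chart_inj[OF M U(1)] chart_inj[OF M V(1)]])
  have S: "?S \<subseteq> U \<times> V" by blast
  have "\<forall>x\<in>?S. \<exists>B h. local_rep ?S ?f x (\<lambda>x. \<psi> (?m x)) B h"
    using sm unfolding smooth_on_chart_iff[OF inj S, of "\<lambda>x. \<psi> (?m x)"] .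
  moreover have pq: "(p, q) \<in> ?S" using U V Y by simp
  ultimately obtain B h where B: "local_rep ?S ?f (p, q) (\<lambda>x. \<psi> (?m x)) B h" by blast
  have o: "openin (prod_topology (mtop M) (mtop M)) {x \<in> topspace (prod_topology (mtop M) (mtop M)). ?m x \<in> Y}"
    using lie_group_mult_continuous[OF G] chart_openin[OF M Y(1)] unfolding continuous_map by blast
  have pq': "(p, q) \<in> {x \<in> topspace (prod_topology (mtop M) (mtop M)). ?m x \<in> Y}"
    using pq chart_subset[OF M U(1)] chart_subset[OF M V(1)] by (auto simp: points_def)
  obtain A1 A2 where A: "openin (mtop M) A1" "openin (mtop M) A2" "p \<in> A1" "q \<in> A2"
    "A1 \<times> A2 \<subseteq> {x \<in> topspace (prod_topology (mtop M) (mtop M)). ?m x \<in> Y}"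
    using o[unfolded openin_prod_topology_alt, rule_format, OF pq'] by (elim exE conjE)
  obtain C1 where C1: "open C1" "\<And>x. x \<in> U \<Longrightarrow> \<phi> x \<in> C1 \<longleftrightarrow> x \<in> A1"
    by (rule chart_open_image[OF M U(1) A(1)]) auto
  obtain C2 where C2: "open C2" "\<And>x. x \<in> V \<Longrightarrow> \<theta> x \<in> C2 \<longleftrightarrow> x \<in> A2"
    by (rule chart_open_image[OF M V(1) A(2)]) auto
  show ?thesis
  proof (rule that[of "B \<inter> C1 \<times> C2" h])
    show "open (B \<inter> C1 \<times> C2)" using B C1 C2 unfolding local_rep_def by (auto intro: open_Times)
    show "(\<phi> p, \<theta> q) \<in> B \<inter> C1 \<times> C2" using B C1 C2 A U V unfolding local_rep_def by auto
    show "Cinf_on (B \<inter> C1 \<times> C2) h" using B unfolding local_rep_def by (auto intro: Ck_on_subset)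
    fix p' q' assume *: "p' \<in> U" "q' \<in> V" "(\<phi> p', \<theta> q') \<in> B \<inter> C1 \<times> C2"
    then have "(p', q') \<in> A1 \<times> A2" using C1(2)[of p'] C2(2)[of q'] by auto
    then have "(p', q') \<in> ?S" using A(5) * by auto
    then show "p' \<otimes>\<^bsub>G\<^esub> q' \<in> Y \<and> \<psi> (p' \<otimes>\<^bsub>G\<^esub> q') = h (\<phi> p', \<theta> q')"
      using B * unfolding local_rep_def by auto
  qed
qed

text \<open>Fixing the first factor gives left translations in coordinates; fixing the second one at
  the identity gives the dependence of a left-invariant field on its base point.\<close>

lemma Cinf_on_slice:
  fixes h :: "'a::euclidean_space \<times> 'b::euclidean_space \<Rightarrow> 'c::euclidean_space"
  assumes B: "open B" and h: "Cinf_on B h"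
  shows Cinf_on_slice_right: "open {y. (a, y) \<in> B}" "Cinf_on {y. (a, y) \<in> B} (\<lambda>y. h (a, y))"
    and Cinf_on_slice_left: "open {x. (x, b) \<in> B}" "Cinf_on {x. (x, b) \<in> B} (\<lambda>x. h (x, b))"
proof -
  show o: "open {y. (a, y) \<in> B}" "open {x. (x, b) \<in> B}"
    using open_vimage[OF B, of "Pair a"] open_vimage[OF B, of "\<lambda>x. (x, b)"]
    by (simp_all add: vimage_def continuous_intros)
  show "Cinf_on {y. (a, y) \<in> B} (\<lambda>y. h (a, y))"
  proof
    fix k
    show "Ck_on k {y. (a, y) \<in> B} (\<lambda>y. h (a, y))"
      by (rule Ck_on_compose[where f = h and h = "\<lambda>y. (a, y)", OF B o(1)])
         (use h in \<open>auto intro: Ck_on_Pair[OF o(1)] Ck_on_const Ck_on_bounded_linear[OF bounded_linear_ident]\<close>)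
  qed
  show "Cinf_on {x. (x, b) \<in> B} (\<lambda>x. h (x, b))"
  proof
    fix k
    show "Ck_on k {x. (x, b) \<in> B} (\<lambda>x. h (x, b))"
      by (rule Ck_on_compose[where f = h and h = "\<lambda>x. (x, b)", OF B o(2)])
         (use h in \<open>auto intro: Ck_on_Pair[OF o(2)] Ck_on_const Ck_on_bounded_linear[OF bounded_linear_ident]\<close>)
  qed
qed

lemma smooth_map_left_translation:
  assumes G: "lie_group G M" and a: "a \<in> carrier G"
  shows "smooth_map M M (\<lambda>x. a \<otimes>\<^bsub>G\<^esub> x)"
proof -
  note M = lie_group_manifold[OF G] and pts = lie_group_points[OF G]
  interpret group G by (rule lie_group_group[OF G])
  show ?thesis
  proof (rule smooth_mapI[OF M M])
    have "continuous_map (mtop M) (prod_topology (mtop M) (mtop M)) (\<lambda>x. (a, x))"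
      using a pts by (intro continuous_map_pairedI) (auto simp: points_def)
    from continuous_map_compose[OF this lie_group_mult_continuous[OF G]]
    show "continuous_map (mtop M) (mtop M) (\<lambda>x. a \<otimes>\<^bsub>G\<^esub> x)" by (simp add: o_def)
    fix p assume p: "p \<in> points M"
    have ap: "a \<otimes>\<^bsub>G\<^esub> p \<in> points M" using a p pts by simp
    have aM: "a \<in> points M" using a pts by simp
    obtain U \<phi> where U: "(U, \<phi>) \<in> atlas M" "a \<in> U" by (rule manifold_chart_exists[OF M aM])
    obtain V \<theta> where V: "(V, \<theta>) \<in> atlas M" "p \<in> V" by (rule manifold_chart_exists[OF M p])
    obtain Y \<psi> where Y: "(Y, \<psi>) \<in> atlas M" "a \<otimes>\<^bsub>G\<^esub> p \<in> Y" by (rule manifold_chart_exists[OF M ap])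
    obtain B h where B: "open B" "(\<phi> a, \<theta> p) \<in> B" "Cinf_on B h"
      "\<And>p' q'. p' \<in> U \<Longrightarrow> q' \<in> V \<Longrightarrow> (\<phi> p', \<theta> q') \<in> B \<Longrightarrow>
         p' \<otimes>\<^bsub>G\<^esub> q' \<in> Y \<and> \<psi> (p' \<otimes>\<^bsub>G\<^esub> q') = h (\<phi> p', \<theta> q')"
      by (rule lie_group_mult_rep[OF G U V Y]) auto
    have "local_rep V \<theta> p (\<lambda>q. \<psi> (a \<otimes>\<^bsub>G\<^esub> q)) {y. (\<phi> a, y) \<in> B} (\<lambda>y. h (\<phi> a, y))"
      unfolding local_rep_def using B U Cinf_on_slice_right[OF B(1,3)] by blast
    then show "\<exists>Y \<psi>. (Y, \<psi>) \<in> atlas M \<and> a \<otimes>\<^bsub>G\<^esub> p \<in> Y \<and> smooth_germ M p (\<lambda>q. \<psi> (a \<otimes>\<^bsub>G\<^esub> q))"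
      using smooth_germI[OF V] Y by blast
  qed
qed

lemma smooth_germ_left_translation:
  assumes G: "lie_group G M" and a: "a \<in> carrier G" "p \<in> carrier G"
    and f: "smooth_germ M (a \<otimes>\<^bsub>G\<^esub> p) f"
  shows "smooth_germ M p (\<lambda>x. f (a \<otimes>\<^bsub>G\<^esub> x))"
  by (rule smooth_germ_compose[OF lie_group_manifold[OF G] lie_group_manifold[OF G]
        smooth_map_left_translation[OF G a(1)] _ f])
     (use a lie_group_points[OF G] in simp)

lemma lie_algebra_vector_field: "X \<in> lie_algebra G M \<Longrightarrow> vector_field M X"
  unfolding lie_algebra_def by blast

lemma lie_algebra_apply:
  assumes M: "smooth_manifold M" and X: "X \<in> lie_algebra G M" and a: "a \<in> carrier G" "p \<in> carrier G"
    and f: "smooth_germ M (a \<otimes>\<^bsub>G\<^esub> p) f"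
  shows "X (a \<otimes>\<^bsub>G\<^esub> p) f = X p (\<lambda>x. f (a \<otimes>\<^bsub>G\<^esub> x))"
  using X a f unfolding lie_algebra_def differential_def by (simp add: smooth_fun_at_iff_germ[OF M])

text \<open>On non-smooth germs both sides have the default value 0, so invariance needs checking on
  smooth germs only.\<close>

lemma lie_algebraI:
  assumes M: "smooth_manifold M" and P: "points M = carrier G" "group G" and X: "vector_field M X"
    and inv: "\<And>a p f. a \<in> carrier G \<Longrightarrow> p \<in> carrier G \<Longrightarrow> smooth_germ M (a \<otimes>\<^bsub>G\<^esub> p) f \<Longrightarrow>
      X (a \<otimes>\<^bsub>G\<^esub> p) f = X p (\<lambda>x. f (a \<otimes>\<^bsub>G\<^esub> x))"
  shows "X \<in> lie_algebra G M"
proof -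
  interpret group G by (rule P(2))
  have "X (a \<otimes>\<^bsub>G\<^esub> p) f = differential M (\<lambda>x. a \<otimes>\<^bsub>G\<^esub> x) p (X p) f"
    if a: "a \<in> carrier G" "p \<in> carrier G" for a p f
  proof (cases "smooth_germ M (a \<otimes>\<^bsub>G\<^esub> p) f")
    case True
    then show ?thesis using inv[OF a True] unfolding differential_def by (simp add: smooth_fun_at_iff_germ[OF M])
  next
    case False
    have ap: "a \<otimes>\<^bsub>G\<^esub> p \<in> points M" using a P by simp
    have "X (a \<otimes>\<^bsub>G\<^esub> p) f = 0"
      by (rule tangent_nonsmooth[OF M ap vector_field_tangent[OF X ap] False])
    then show ?thesis using False unfolding differential_def by (simp add: smooth_fun_at_iff_germ[OF M])
  qed
  then show ?thesis unfolding lie_algebra_def using X by blast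
qed

lemma subspace_lie_algebra:
  assumes G: "lie_group G M"
  shows "subspace (lie_algebra G M)"
proof -
  note M = lie_group_manifold[OF G]
  note I = lie_algebraI[OF M lie_group_points[OF G] lie_group_group[OF G]]
  show ?thesis
    unfolding subspace_def
  proof (intro conjI ballI allI)
    show "0 \<in> lie_algebra G M" by (rule I[OF vector_field_zero[OF M]]) simp
    fix X assume X: "X \<in> lie_algebra G M"
    note vX = lie_algebra_vector_field[OF X]
    show "c *\<^sub>R X \<in> lie_algebra G M" for c
      by (rule I[OF vector_field_scaleR[OF M vX]]) (simp add: scaleR_fun_def lie_algebra_apply[OF M X])
    fix Y assume Y: "Y \<in> lie_algebra G M"
    show "X + Y \<in> lie_algebra G M"
      by (rule I[OF vector_field_add[OF M vX lie_algebra_vector_field[OF Y]]])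
         (simp add: lie_algebra_apply[OF M X] lie_algebra_apply[OF M Y])
  qed
qed

lemma lie_algebra_apply_nested:
  assumes G: "lie_group G M" and X: "X \<in> lie_algebra G M" and Y: "Y \<in> lie_algebra G M"
    and a: "a \<in> carrier G" "p \<in> carrier G" and f: "smooth_germ M (a \<otimes>\<^bsub>G\<^esub> p) f"
  shows "X (a \<otimes>\<^bsub>G\<^esub> p) (\<lambda>q. Y q f) = X p (\<lambda>q. Y q (\<lambda>x. f (a \<otimes>\<^bsub>G\<^esub> x)))"
proof -
  note M = lie_group_manifold[OF G] and pts = lie_group_points[OF G]
  have p: "p \<in> points M" using a pts by simp
  obtain W where W: "openin (mtop M) W" "a \<otimes>\<^bsub>G\<^esub> p \<in> W" "\<And>q. q \<in> W \<Longrightarrow> smooth_germ M q f"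
    by (rule smooth_germ_nbhd[OF M f]) auto
  have "continuous_map (mtop M) (mtop M) (\<lambda>x. a \<otimes>\<^bsub>G\<^esub> x)"
    using smooth_map_left_translation[OF G a(1)] unfolding smooth_map_def by blast
  then have o: "openin (mtop M) {x \<in> topspace (mtop M). a \<otimes>\<^bsub>G\<^esub> x \<in> W}"
    using W(1) unfolding continuous_map by blast
  have "X (a \<otimes>\<^bsub>G\<^esub> p) (\<lambda>q. Y q f) = X p (\<lambda>x. Y (a \<otimes>\<^bsub>G\<^esub> x) f)"
    by (rule lie_algebra_apply[OF M X a vector_field_germ[OF M lie_algebra_vector_field[OF Y] f]])
  also have "\<dots> = X p (\<lambda>q. Y q (\<lambda>x. f (a \<otimes>\<^bsub>G\<^esub> x)))"
  proof (rule tangent_local[OF M vector_field_tangent[OF lie_algebra_vector_field[OF X] p] o])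
    show "p \<in> {x \<in> topspace (mtop M). a \<otimes>\<^bsub>G\<^esub> x \<in> W}" using W(2) p by (simp add: points_def)
    fix q assume "q \<in> {x \<in> topspace (mtop M). a \<otimes>\<^bsub>G\<^esub> x \<in> W}"
    then have "q \<in> carrier G" "a \<otimes>\<^bsub>G\<^esub> q \<in> W" using pts by (auto simp: points_def)
    then show "Y (a \<otimes>\<^bsub>G\<^esub> q) f = Y q (\<lambda>x. f (a \<otimes>\<^bsub>G\<^esub> x))"
      by (intro lie_algebra_apply[OF M Y a(1)] W(3))
  qed
  finally show ?thesis .
qed

lemma lie_algebra_lie_bracket:
  assumes G: "lie_group G M" and X: "X \<in> lie_algebra G M" and Y: "Y \<in> lie_algebra G M"
  shows "lie_bracket M X Y \<in> lie_algebra G M"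
proof -
  note M = lie_group_manifold[OF G]
  show ?thesis
  proof (rule lie_algebraI[OF M lie_group_points[OF G] lie_group_group[OF G]])
    show "vector_field M (lie_bracket M X Y)"
      by (rule lie_bracket_vector_field[OF M lie_algebra_vector_field[OF X] lie_algebra_vector_field[OF Y]])
    fix a p and f :: "_ \<Rightarrow> real" assume a: "a \<in> carrier G" "p \<in> carrier G" and f: "smooth_germ M (a \<otimes>\<^bsub>G\<^esub> p) f"
    show "lie_bracket M X Y (a \<otimes>\<^bsub>G\<^esub> p) f = lie_bracket M X Y p (\<lambda>x. f (a \<otimes>\<^bsub>G\<^esub> x))"
      unfolding lie_bracket_apply[OF M f] lie_bracket_apply[OF M smooth_germ_left_translation[OF G a f]]
      using lie_algebra_apply_nested[OF G X Y a f] lie_algebra_apply_nested[OF G Y X a f] by simp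
  qed
qed

text \<open>The field is obtained by pushing \<open>v\<close> forward under left translations. Its
  smoothness is the point: in charts \<open>X q f\<close> is one partial derivative of the smooth
  function \<open>f\<close> of a product, taken in the second factor at the identity, and this
  depends smoothly on the first factor.\<close>

lemma left_invariant_extension:
  assumes G: "lie_group G M" and v: "v \<in> tangent_space M \<one>\<^bsub>G\<^esub>"
  obtains X where "X \<in> lie_algebra G M" "X \<one>\<^bsub>G\<^esub> = v"
proof -
  note M = lie_group_manifold[OF G] and pts = lie_group_points[OF G]
  interpret group G by (rule lie_group_group[OF G])
  have oM: "\<one>\<^bsub>G\<^esub> \<in> points M" using pts by simp
  define X where "X q = (if q \<in> carrier G then differential M (\<lambda>x. q \<otimes>\<^bsub>G\<^esub> x) \<one>\<^bsub>G\<^esub> v else 0)" for q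
  have X_apply: "X q f = v (\<lambda>x. f (q \<otimes>\<^bsub>G\<^esub> x))" if "smooth_germ M q f" for q f
    using smooth_germ_points[OF M that] that pts
    unfolding X_def differential_def by (simp add: smooth_fun_at_iff_germ[OF M])
  have openM: "openin (mtop M) (points M)" by (simp add: points_def)
  have vf: "vector_field M X"
  proof (rule vector_fieldI[OF M])
    fix p
    show "X p \<in> tangent_space M p" if "p \<in> points M"
      using differential_tangent[OF M M smooth_map_left_translation[OF G, of p] oM v] that pts
      unfolding X_def by simp
    show "X p = 0" if "p \<notin> points M" using that pts unfolding X_def by simp
    fix f :: "_ \<Rightarrow> real" assume f: "smooth_germ M p f"
    have p: "p \<in> points M" by (rule smooth_germ_points[OF M f])
    obtain U \<phi> where U: "(U, \<phi>) \<in> atlas M" "p \<in> U" by (rule manifold_chart_exists[OF M p])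
    obtain V \<theta> where V: "(V, \<theta>) \<in> atlas M" "\<one>\<^bsub>G\<^esub> \<in> V" by (rule manifold_chart_exists[OF M oM])
    have UG: "q \<in> carrier G" if "q \<in> U" for q using that chart_subset[OF M U(1)] pts by blast
    have pU: "p \<otimes>\<^bsub>G\<^esub> \<one>\<^bsub>G\<^esub> \<in> U" using U UG by simp
    obtain B h where B: "open B" "(\<phi> p, \<theta> \<one>\<^bsub>G\<^esub>) \<in> B" "Cinf_on B h"
      "\<And>p' q'. p' \<in> U \<Longrightarrow> q' \<in> V \<Longrightarrow> (\<phi> p', \<theta> q') \<in> B \<Longrightarrow>
         p' \<otimes>\<^bsub>G\<^esub> q' \<in> U \<and> \<phi> (p' \<otimes>\<^bsub>G\<^esub> q') = h (\<phi> p', \<theta> q')"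
      by (rule lie_group_mult_rep[OF G U V U(1) pU]) auto
    obtain C k where C: "local_rep U \<phi> p f C k" by (rule smooth_germ_rep[OF M f U])
    then have C': "open C" "\<phi> p \<in> C" "Cinf_on C k" "\<And>q. q \<in> U \<Longrightarrow> \<phi> q \<in> C \<Longrightarrow> f q = k (\<phi> q)"
      unfolding local_rep_def by auto
    obtain w where w: "vec_coord M V \<theta> \<one>\<^bsub>G\<^esub> v w" by (rule tangent_space_vec_coord[OF M V v])
    define A where "A = {z\<in>B. h z \<in> C}"
    have A: "open A"
      unfolding A_def by (rule open_Collect_continuous[OF B(1) Cinf_on_continuous[OF B(3)] C'(1)])
    have kh: "Cinf_on A (\<lambda>z. k (h z))"
    proof
      fix n
      show "Ck_on n A (\<lambda>z. k (h z))"
        by (rule Ck_on_compose[where f = k and h = h, OF C'(1) A])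
           (use B C' in \<open>auto simp: A_def intro: Ck_on_subset\<close>)
    qed
    \<comment> \<open>The direction \<open>(0, w)\<close> keeps the base point fixed and moves the
      second factor along the coordinate \<open>w\<close> of \<open>v\<close>.\<close>
    let ?D = "\<lambda>z. frechet_derivative (\<lambda>z. k (h z)) (at z) (0, w)"
    have h1: "h (\<phi> q, \<theta> \<one>\<^bsub>G\<^esub>) = \<phi> q" if "q \<in> U" "(\<phi> q, \<theta> \<one>\<^bsub>G\<^esub>) \<in> B" for q
      using B(4)[OF that(1) V(2) that(2)] UG[OF that(1)] by simp
    have Xval: "X q f = ?D (\<phi> q, \<theta> \<one>\<^bsub>G\<^esub>)" if q: "q \<in> U" "(\<phi> q, \<theta> \<one>\<^bsub>G\<^esub>) \<in> A" for q
    proof -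
      have "\<phi> q \<in> C" using q h1 unfolding A_def by auto
      then have gq: "smooth_germ M q f"
        by (intro smooth_germI[OF U(1) q(1), of f C k] local_rep_nbhd[OF C])
      have rep: "local_rep V \<theta> \<one>\<^bsub>G\<^esub> (\<lambda>x. f (q \<otimes>\<^bsub>G\<^esub> x)) {y. (\<phi> q, y) \<in> A} (\<lambda>y. k (h (\<phi> q, y)))"
        unfolding local_rep_def
        using Cinf_on_slice_right[OF A kh, of "\<phi> q"] q B(4)[OF q(1)] C'(4) unfolding A_def by auto
      have "((\<lambda>y. (\<phi> q, y)) has_derivative (\<lambda>y. (0, y))) (at (\<theta> \<one>\<^bsub>G\<^esub>))"
        by (intro has_derivative_Pair has_derivative_const has_derivative_ident)
      from has_derivative_compose[OF this Cinf_on_has_derivative[OF kh q(2)]]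
      have "frechet_derivative (\<lambda>y. k (h (\<phi> q, y))) (at (\<theta> \<one>\<^bsub>G\<^esub>)) =
          (\<lambda>y. frechet_derivative (\<lambda>z. k (h z)) (at (\<phi> q, \<theta> \<one>\<^bsub>G\<^esub>)) (0, y))"
        by (rule frechet_derivative_eqI)
      then show ?thesis using X_apply[OF gq] vec_coordD[OF w rep] by simp
    qed
    have pA: "(\<phi> p, \<theta> \<one>\<^bsub>G\<^esub>) \<in> A" unfolding A_def using B(2) h1[OF U(2) B(2)] C'(2) by simp
    have "local_rep U \<phi> p (\<lambda>q. X q f) {x. (x, \<theta> \<one>\<^bsub>G\<^esub>) \<in> A} (\<lambda>x. ?D (x, \<theta> \<one>\<^bsub>G\<^esub>))"
      unfolding local_rep_def
      using Cinf_on_slice_left(1)[OF A kh, of "\<theta> \<one>\<^bsub>G\<^esub>"]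
        Cinf_on_slice_left(2)[OF A Cinf_on_derivative[OF kh, of "(0, w)"], of "\<theta> \<one>\<^bsub>G\<^esub>"] pA Xval by auto
    then show "smooth_germ M p (\<lambda>q. X q f)" by (rule smooth_germI[OF U])
  qed
  have "X \<in> lie_algebra G M"
  proof (rule lie_algebraI[OF M pts lie_group_group[OF G] vf])
    fix a p and f :: "_ \<Rightarrow> real" assume a: "a \<in> carrier G" "p \<in> carrier G" and f: "smooth_germ M (a \<otimes>\<^bsub>G\<^esub> p) f"
    \<comment> \<open>Associativity is available only on the carrier, so the two functions are equal
      on \<open>points M\<close> and not as HOL functions; \<open>tangent_local\<close> bridges the
      difference.\<close>
    have "v (\<lambda>x. f (a \<otimes>\<^bsub>G\<^esub> p \<otimes>\<^bsub>G\<^esub> x)) = v (\<lambda>x. f (a \<otimes>\<^bsub>G\<^esub> (p \<otimes>\<^bsub>G\<^esub> x)))"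
      by (rule tangent_local[OF M v openM oM]) (use a pts in \<open>simp add: m_assoc\<close>)
    then show "X (a \<otimes>\<^bsub>G\<^esub> p) f = X p (\<lambda>x. f (a \<otimes>\<^bsub>G\<^esub> x))"
      by (simp add: X_apply[OF f] X_apply[OF smooth_germ_left_translation[OF G a f]])
  qed
  moreover have "X \<one>\<^bsub>G\<^esub> = v"
  proof
    fix f
    show "X \<one>\<^bsub>G\<^esub> f = v f"
    proof (cases "smooth_germ M \<one>\<^bsub>G\<^esub> f")
      case True
      have "v (\<lambda>x. f (\<one>\<^bsub>G\<^esub> \<otimes>\<^bsub>G\<^esub> x)) = v f"
        by (rule tangent_local[OF M v openM oM]) (use pts in simp)
      then show ?thesis by (simp add: X_apply[OF True])
    next
      case False
      then show ?thesis
        using tangent_nonsmooth[OF M oM v] tangent_nonsmooth[OF M oM vector_field_tangent[OF vf oM]] by simp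
    qed
  qed
  ultimately show ?thesis using that by blast
qed

section \<open>The Lie algebra of a Lie subgroup\<close>

lemma differential_inclusion_apply:
  assumes M: "smooth_manifold M" and f: "smooth_germ M p f"
  shows "differential M (\<lambda>x. x) p v f = v f"
  using f unfolding differential_def by (simp add: smooth_fun_at_iff_germ[OF M])

lemma subspace_lie_subalgebra:
  assumes G: "lie_group G M" and N: "smooth_manifold N" "\<one>\<^bsub>G\<^esub> \<in> points N"
  shows "subspace (lie_subalgebra G M N)"
proof -
  note S = subspace_lie_algebra[OF G] and T = subspace_tangent_space[OF N]
  let ?d = "differential M (\<lambda>x. x) \<one>\<^bsub>G\<^esub>"
  have d: "?d 0 = 0" "?d u + ?d w = ?d (u + w)" "c *\<^sub>R ?d u = ?d (c *\<^sub>R u)" for u w c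
    unfolding differential_def by (auto simp: fun_eq_iff scaleR_fun_def)
  show ?thesis
    unfolding subspace_def
  proof (intro conjI ballI allI)
    have "(0 :: 'a tvec) \<in> ?d ` tangent_space N \<one>\<^bsub>G\<^esub>"
      by (rule image_eqI[of _ ?d, OF d(1)[symmetric] subspace_0[OF T]])
    then show "0 \<in> lie_subalgebra G M N"
      unfolding lie_subalgebra_def using subspace_0[OF S] by simp
    fix X assume X: "X \<in> lie_subalgebra G M N"
    then obtain u where u: "u \<in> tangent_space N \<one>\<^bsub>G\<^esub>" "X \<one>\<^bsub>G\<^esub> = ?d u" "X \<in> lie_algebra G M"
      unfolding lie_subalgebra_def by blast
    show "c *\<^sub>R X \<in> lie_subalgebra G M N" for c
    proof -
      have "(c *\<^sub>R X) \<one>\<^bsub>G\<^esub> = ?d (c *\<^sub>R u)"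
        using u(2) d(3) by (simp add: scaleR_fun_def[of c X])
      then show ?thesis
        unfolding lie_subalgebra_def using subspace_scale[OF S u(3)] subspace_scale[OF T u(1)] by blast
    qed
    fix Y assume Y: "Y \<in> lie_subalgebra G M N"
    then obtain w where w: "w \<in> tangent_space N \<one>\<^bsub>G\<^esub>" "Y \<one>\<^bsub>G\<^esub> = ?d w" "Y \<in> lie_algebra G M"
      unfolding lie_subalgebra_def by blast
    have "(X + Y) \<one>\<^bsub>G\<^esub> = ?d (u + w)" using u(2) w(2) d(2) by simp
    then show "X + Y \<in> lie_subalgebra G M N"
      unfolding lie_subalgebra_def using subspace_add[OF S u(3) w(3)] subspace_add[OF T u(1) w(1)] by blast
  qed
qed

text \<open>Both fields are determined by their value at the identity, where they correspond, and
  translation by an element of \<open>K\<close> is the same in \<open>K\<close> and in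
  \<open>G\<close>. So \<open>X\<close> restricts to \<open>X'\<close> along all of
  \<open>K\<close>.\<close>

lemma left_invariant_related:
  assumes G: "lie_group G M" and K: "lie_subgroup G M K N"
    and X: "X \<in> lie_algebra G M" "X \<one>\<^bsub>G\<^esub> = differential M (\<lambda>x. x) \<one>\<^bsub>G\<^esub> (X' \<one>\<^bsub>G\<^esub>)"
    and X': "X' \<in> lie_algebra (G\<lparr>carrier := K\<rparr>) N"
    and q: "q \<in> K" and f: "smooth_germ M q f"
  shows "X q f = X' q f"
proof -
  note M = lie_group_manifold[OF G]
  interpret group G by (rule lie_group_group[OF G])
  have sub: "subgroup K G" and KN: "lie_group (G\<lparr>carrier := K\<rparr>) N" and inc: "smooth_map N M (\<lambda>x. x)"
    using K unfolding lie_subgroup_def by auto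
  note N = lie_group_manifold[OF KN]
  have qG: "q \<in> carrier G" using q sub by (rule subgroup.mem_carrier[rotated])
  have one: "\<one>\<^bsub>G\<^esub> \<in> K" by (rule subgroup.one_closed[OF sub])
  have qN: "q \<in> points N" using lie_group_points[OF KN] q by simp
  have fN: "smooth_germ N q f" by (rule smooth_germ_compose[OF N M inc qN f])
  have f1: "smooth_germ M (q \<otimes>\<^bsub>G\<^esub> \<one>\<^bsub>G\<^esub>) f" using f qG by simp
  have "X q f = X \<one>\<^bsub>G\<^esub> (\<lambda>x. f (q \<otimes>\<^bsub>G\<^esub> x))"
    using lie_algebra_apply[OF M X(1) qG one_closed f1] qG by simp
  also have "\<dots> = X' \<one>\<^bsub>G\<^esub> (\<lambda>x. f (q \<otimes>\<^bsub>G\<^esub> x))"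
    unfolding X(2) by (rule differential_inclusion_apply[OF M smooth_germ_left_translation[OF G qG one_closed f1]])
  also have "\<dots> = X' q f"
    using lie_algebra_apply[OF N X', of q "\<one>\<^bsub>G\<^esub>" f] q qG one fN by simp
  finally show ?thesis .
qed

text \<open>Membership speaks only of the value at the identity, whereas a bracket involves
  derivatives. Extending both vectors to left-invariant fields on \<open>K\<close> gives fields
  related by the inclusion, and brackets of related fields are related.\<close>

lemma lie_subalgebra_lie_bracket:
  assumes G: "lie_group G M" and K: "lie_subgroup G M K N"
    and X: "X \<in> lie_subalgebra G M N" and Y: "Y \<in> lie_subalgebra G M N"
  shows "lie_bracket M X Y \<in> lie_subalgebra G M N"
proof -
  note M = lie_group_manifold[OF G]
  interpret group G by (rule lie_group_group[OF G])
  have sub: "subgroup K G" and KN: "lie_group (G\<lparr>carrier := K\<rparr>) N" and inc: "smooth_map N M (\<lambda>x. x)"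
    using K unfolding lie_subgroup_def by auto
  note N = lie_group_manifold[OF KN]
  have ptsN: "points N = K" using lie_group_points[OF KN] by simp
  have one: "\<one>\<^bsub>G\<^esub> \<in> points N" using subgroup.one_closed[OF sub] ptsN by simp
  let ?d = "differential M (\<lambda>x. x) \<one>\<^bsub>G\<^esub>"
  have ex: "\<exists>Z'\<in>lie_algebra (G\<lparr>carrier := K\<rparr>) N. Z \<one>\<^bsub>G\<^esub> = ?d (Z' \<one>\<^bsub>G\<^esub>)"
    if Z: "Z \<in> lie_subalgebra G M N" for Z
  proof -
    obtain u where u: "u \<in> tangent_space N \<one>\<^bsub>G\<^esub>" "Z \<one>\<^bsub>G\<^esub> = ?d u"
      using Z unfolding lie_subalgebra_def by blast
    have u': "u \<in> tangent_space N \<one>\<^bsub>G\<lparr>carrier := K\<rparr>\<^esub>" using u(1) by simp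
    obtain Z' where "Z' \<in> lie_algebra (G\<lparr>carrier := K\<rparr>) N" "Z' \<one>\<^bsub>G\<lparr>carrier := K\<rparr>\<^esub> = u"
      by (rule left_invariant_extension[OF KN u'])
    then show ?thesis using u(2) by auto
  qed
  obtain X' where X': "X' \<in> lie_algebra (G\<lparr>carrier := K\<rparr>) N" "X \<one>\<^bsub>G\<^esub> = ?d (X' \<one>\<^bsub>G\<^esub>)" using ex[OF X] by blast
  obtain Y' where Y': "Y' \<in> lie_algebra (G\<lparr>carrier := K\<rparr>) N" "Y \<one>\<^bsub>G\<^esub> = ?d (Y' \<one>\<^bsub>G\<^esub>)" using ex[OF Y] by blast
  have XY: "X \<in> lie_algebra G M" "Y \<in> lie_algebra G M" using X Y unfolding lie_subalgebra_def by auto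
  have nested: "Z \<one>\<^bsub>G\<^esub> (\<lambda>q. W q f) = Z' \<one>\<^bsub>G\<^esub> (\<lambda>q. W' q f)"
    if f: "smooth_germ M \<one>\<^bsub>G\<^esub> f"
      and Z: "Z \<in> lie_algebra G M" "Z' \<in> lie_algebra (G\<lparr>carrier := K\<rparr>) N" "Z \<one>\<^bsub>G\<^esub> = ?d (Z' \<one>\<^bsub>G\<^esub>)"
      and W: "W \<in> lie_algebra G M" "W' \<in> lie_algebra (G\<lparr>carrier := K\<rparr>) N" "W \<one>\<^bsub>G\<^esub> = ?d (W' \<one>\<^bsub>G\<^esub>)"
    for f Z Z' W W'
  proof -
    obtain S where S: "openin (mtop M) S" "\<one>\<^bsub>G\<^esub> \<in> S" "\<And>q. q \<in> S \<Longrightarrow> smooth_germ M q f"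
      by (rule smooth_germ_nbhd[OF M f]) auto
    \<comment> \<open>The topology of \<open>N\<close> may be finer than the subspace topology; only
      continuity of the inclusion is used.\<close>
    have o: "openin (mtop N) {q \<in> topspace (mtop N). q \<in> S}"
      using inc S(1) unfolding smooth_map_def continuous_map by blast
    have "Z \<one>\<^bsub>G\<^esub> (\<lambda>q. W q f) = Z' \<one>\<^bsub>G\<^esub> (\<lambda>q. W q f)"
      unfolding Z(3)
      by (rule differential_inclusion_apply[OF M vector_field_germ[OF M lie_algebra_vector_field[OF W(1)] f]])
    also have "\<dots> = Z' \<one>\<^bsub>G\<^esub> (\<lambda>q. W' q f)"
    proof (rule tangent_local[OF N vector_field_tangent[OF lie_algebra_vector_field[OF Z(2)] one] o])
      show "\<one>\<^bsub>G\<^esub> \<in> {q \<in> topspace (mtop N). q \<in> S}" using one S(2) by (simp add: points_def)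
      show "W q f = W' q f" if "q \<in> {q \<in> topspace (mtop N). q \<in> S}" for q
        using that ptsN left_invariant_related[OF G K W(1,3,2) _ S(3)] by (auto simp: points_def)
    qed
    finally show ?thesis .
  qed
  have "lie_bracket M X Y \<one>\<^bsub>G\<^esub> = ?d (lie_bracket N X' Y' \<one>\<^bsub>G\<^esub>)"
  proof
    fix f
    show "lie_bracket M X Y \<one>\<^bsub>G\<^esub> f = ?d (lie_bracket N X' Y' \<one>\<^bsub>G\<^esub>) f"
    proof (cases "smooth_germ M \<one>\<^bsub>G\<^esub> f")
      case f: True
      have fN: "smooth_germ N \<one>\<^bsub>G\<^esub> f" by (rule smooth_germ_compose[OF N M inc one f])
      show ?thesis
        using nested[OF f XY(1) X' XY(2) Y'] nested[OF f XY(2) Y' XY(1) X']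
        by (simp add: differential_inclusion_apply[OF M f] lie_bracket_apply[OF M f] lie_bracket_apply[OF N fN])
    next
      case False
      then show ?thesis
        by (simp add: lie_bracket_nonsmooth[OF M] differential_def smooth_fun_at_iff_germ[OF M])
    qed
  qed
  moreover have "lie_bracket N X' Y' \<one>\<^bsub>G\<^esub> \<in> tangent_space N \<one>\<^bsub>G\<^esub>"
    by (rule lie_bracket_tangent[OF N lie_algebra_vector_field[OF X'(1)] lie_algebra_vector_field[OF Y'(1)] one])
  ultimately show ?thesis
    unfolding lie_subalgebra_def using lie_algebra_lie_bracket[OF G XY] by blast
qed

section \<open>Semisimple Lie algebras have no nonzero characters\<close>

text \<open>The laws are required on \<open>L\<close> alone, since \<open>lie_bracket M\<close>
  satisfies them for vector fields and not for arbitrary functions of that type. The locale is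
  applied to the whole Lie algebra and to \<open>\<k>\<close>; a finite basis comes from
  semisimplicity.\<close>

locale lie_algebra_on =
  fixes L :: "'v::real_vector set" and br :: "'v \<Rightarrow> 'v \<Rightarrow> 'v"
  assumes subspace_L: "subspace L"
    and br_closed: "x \<in> L \<Longrightarrow> y \<in> L \<Longrightarrow> br x y \<in> L"
    and br_skew: "x \<in> L \<Longrightarrow> y \<in> L \<Longrightarrow> br x y = - br y x"
    and br_add_left: "x \<in> L \<Longrightarrow> y \<in> L \<Longrightarrow> z \<in> L \<Longrightarrow> br (x + y) z = br x z + br y z"
    and br_scaleR_left: "x \<in> L \<Longrightarrow> y \<in> L \<Longrightarrow> br (c *\<^sub>R x) y = c *\<^sub>R br x y"
    and jacobi: "x \<in> L \<Longrightarrow> y \<in> L \<Longrightarrow> z \<in> L \<Longrightarrow> br (br x y) z = br x (br y z) - br y (br x z)"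
begin

lemma zero_L: "0 \<in> L" and add_L: "x \<in> L \<Longrightarrow> y \<in> L \<Longrightarrow> x + y \<in> L"
  and scaleR_L: "x \<in> L \<Longrightarrow> c *\<^sub>R x \<in> L" and diff_L: "x \<in> L \<Longrightarrow> y \<in> L \<Longrightarrow> x - y \<in> L"
  using subspace_0 subspace_add subspace_scale subspace_diff subspace_L by auto

lemma br_add_right: "x \<in> L \<Longrightarrow> y \<in> L \<Longrightarrow> z \<in> L \<Longrightarrow> br x (y + z) = br x y + br x z"
  using br_skew[of x "y + z"] br_skew[of x y] br_skew[of x z] br_add_left[of y z x] add_L by simp

lemma br_scaleR_right: "x \<in> L \<Longrightarrow> y \<in> L \<Longrightarrow> br x (c *\<^sub>R y) = c *\<^sub>R br x y"
  using br_skew[of x "c *\<^sub>R y"] br_skew[of x y] br_scaleR_left[of y x c] scaleR_L by simp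

text \<open>The very choice made inside \<open>trace_on\<close>, so that Killing forms unfold to
  traces in this basis.\<close>

definition basis where "basis = (SOME B. independent B \<and> span B = L)"

lemma basis: "independent basis" "span basis = L"
proof -
  obtain B where "B \<subseteq> L" "independent B" "L \<subseteq> span B"
    using maximal_independent_subset[of L] by blast
  then have "independent B \<and> span B = L"
    using subspace_L by (metis span_minimal subset_antisym)
  then have "independent basis \<and> span basis = L" unfolding basis_def by (rule someI)
  then show "independent basis" "span basis = L" by auto
qed

lemma basis_L: "b \<in> basis \<Longrightarrow> b \<in> L"
  using basis(2) span_base by blast

abbreviation "rep \<equiv> representation basis"

section \<open>Traces in the chosen basis\<close>

definition tr where "tr T = (\<Sum>b\<in>basis. rep (T b) b)"

lemma killing_form_tr: "killing_form L br x y = tr (\<lambda>z. br x (br y z))"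
  unfolding killing_form_def trace_on_def tr_def basis_def Let_def ..

lemma rep_add: "x \<in> L \<Longrightarrow> y \<in> L \<Longrightarrow> rep (x + y) b = rep x b + rep y b"
  using representation_add[OF basis(1)] basis(2) by simp

lemma rep_diff: "x \<in> L \<Longrightarrow> y \<in> L \<Longrightarrow> rep (x - y) b = rep x b - rep y b"
  using representation_diff[OF basis(1)] basis(2) by simp

lemma rep_scaleR: "x \<in> L \<Longrightarrow> rep (c *\<^sub>R x) b = c * rep x b"
  using representation_scale[OF basis(1)] basis(2) by simp

lemma rep_zero: "rep 0 b = 0"
  using rep_scaleR[of 0 0] zero_L by simp

lemma tr_diff:
  assumes "\<And>b. b \<in> basis \<Longrightarrow> S b \<in> L" "\<And>b. b \<in> basis \<Longrightarrow> T b \<in> L"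
  shows "tr (\<lambda>b. S b - T b) = tr S - tr T"
  unfolding tr_def using assms by (simp add: rep_diff sum_subtractf)

lemma tr_cong: "(\<And>b. b \<in> basis \<Longrightarrow> S b = T b) \<Longrightarrow> tr S = tr T"
  unfolding tr_def by simp

lemma rep_expand:
  assumes fin: "finite basis" and x: "x \<in> L"
  shows "x = (\<Sum>c\<in>basis. rep x c *\<^sub>R c)"
  using sum_representation_eq[OF basis(1) _ fin subset_refl] x basis(2) by metis

lemma linear_on_sum:
  assumes add: "\<And>x y. x \<in> L \<Longrightarrow> y \<in> L \<Longrightarrow> S (x + y) = S x + S y"
    and scale: "\<And>c x. x \<in> L \<Longrightarrow> S (c *\<^sub>R x) = c *\<^sub>R S x"
    and C: "C \<subseteq> L"
  shows "S (\<Sum>c\<in>C. k c *\<^sub>R c) = (\<Sum>c\<in>C. k c *\<^sub>R (S c :: 'w::real_vector))"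
proof -
  have z: "S 0 = 0" using scale[of 0 0] zero_L by simp
  have "(\<Sum>c\<in>C. k c *\<^sub>R c) \<in> L \<and> S (\<Sum>c\<in>C. k c *\<^sub>R c) = (\<Sum>c\<in>C. k c *\<^sub>R S c)"
    using C by (induction C rule: infinite_finite_induct) (auto simp: z zero_L add scale scaleR_L add_L)
  then show ?thesis by blast
qed

text \<open>The matrix formula for the trace of a product, whose double sum is symmetric in the two
  factors up to a swap of indices.\<close>

lemma tr_compose_expand:
  assumes fin: "finite basis"
    and S: "\<And>x y. x \<in> L \<Longrightarrow> y \<in> L \<Longrightarrow> S (x + y) = S x + S y"
      "\<And>c x. x \<in> L \<Longrightarrow> S (c *\<^sub>R x) = c *\<^sub>R S x" "\<And>x. x \<in> L \<Longrightarrow> S x \<in> L"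
    and T: "\<And>x. x \<in> L \<Longrightarrow> T x \<in> L"
  shows "tr (\<lambda>x. S (T x)) = (\<Sum>b\<in>basis. \<Sum>c\<in>basis. rep (T b) c * rep (S c) b)"
  unfolding tr_def
proof (rule sum.cong[OF refl])
  fix b assume b: "b \<in> basis"
  have sub: "basis \<subseteq> L" using basis_L by blast
  let ?R = "\<lambda>x. rep (S x) b"
  have "rep (S (T b)) b = ?R (\<Sum>c\<in>basis. rep (T b) c *\<^sub>R c)"
    using rep_expand[OF fin T[OF basis_L[OF b]]] by simp
  also have "\<dots> = (\<Sum>c\<in>basis. rep (T b) c *\<^sub>R ?R c)"
    by (rule linear_on_sum[OF _ _ sub]) (simp_all add: S rep_add rep_scaleR)
  finally show "rep (S (T b)) b = (\<Sum>c\<in>basis. rep (T b) c * rep (S c) b)" by simp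
qed

lemma tr_commute:
  assumes fin: "finite basis"
    and S: "\<And>x y. x \<in> L \<Longrightarrow> y \<in> L \<Longrightarrow> S (x + y) = S x + S y"
      "\<And>c x. x \<in> L \<Longrightarrow> S (c *\<^sub>R x) = c *\<^sub>R S x" "\<And>x. x \<in> L \<Longrightarrow> S x \<in> L"
    and T: "\<And>x y. x \<in> L \<Longrightarrow> y \<in> L \<Longrightarrow> T (x + y) = T x + T y"
      "\<And>c x. x \<in> L \<Longrightarrow> T (c *\<^sub>R x) = c *\<^sub>R T x" "\<And>x. x \<in> L \<Longrightarrow> T x \<in> L"
  shows "tr (\<lambda>x. S (T x)) = tr (\<lambda>x. T (S x))"
proof -
  have "tr (\<lambda>x. S (T x)) = (\<Sum>b\<in>basis. \<Sum>c\<in>basis. rep (T b) c * rep (S c) b)"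
    by (rule tr_compose_expand[OF fin S T(3)])
  also have "\<dots> = (\<Sum>b\<in>basis. \<Sum>c\<in>basis. rep (S b) c * rep (T c) b)"
    by (subst sum.swap) (simp add: mult.commute)
  also have "\<dots> = tr (\<lambda>x. T (S x))"
    by (rule tr_compose_expand[OF fin T S(3), symmetric])
  finally show ?thesis .
qed

abbreviation "\<kappa> \<equiv> killing_form L br"

text \<open>By the Jacobi identity the adjoint map of a bracket is a commutator, and for commutators
  tr([A,B]C) = tr(A[B,C]) follows from cyclicity of the trace.\<close>

lemma killing_invariant:
  assumes fin: "finite basis" and L: "x \<in> L" "y \<in> L" "z \<in> L"
  shows "\<kappa> (br x y) z = \<kappa> x (br y z)"
proof -
  note [simp] = L br_closed basis_L
  have "\<kappa> (br x y) z = tr (\<lambda>w. br x (br y (br z w)) - br y (br x (br z w)))"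
    unfolding killing_form_tr by (rule tr_cong) (simp add: jacobi)
  also have "\<dots> = tr (\<lambda>w. br x (br y (br z w))) - tr (\<lambda>w. br y (br x (br z w)))"
    by (rule tr_diff) simp_all
  \<comment> \<open>Cyclicity moves the leading \<open>br y\<close> to the innermost place.\<close>
  also have "tr (\<lambda>w. br y (br x (br z w))) = tr (\<lambda>w. br x (br z (br y w)))"
    by (rule tr_commute[of "br y" "\<lambda>w. br x (br z w)", OF fin])
       (simp_all add: br_add_right br_scaleR_right)
  also have "tr (\<lambda>w. br x (br y (br z w))) - \<dots> = tr (\<lambda>w. br x (br y (br z w)) - br x (br z (br y w)))"
    by (rule tr_diff[symmetric]) simp_all
  also have "\<dots> = \<kappa> x (br y z)"
    unfolding killing_form_tr
  proof (rule tr_cong)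
    fix b assume b: "b \<in> basis"
    have "br x (br y (br z b)) = br x (br (br y z) b) + br x (br z (br y b))"
      by (subst br_add_right[symmetric]) (use b in \<open>simp_all add: jacobi diff_L\<close>)
    then show "br x (br y (br z b)) - br x (br z (br y b)) = br x (br (br y z) b)" by simp
  qed
  finally show ?thesis .
qed

lemma killing_add_left: "x \<in> L \<Longrightarrow> y \<in> L \<Longrightarrow> z \<in> L \<Longrightarrow> \<kappa> (x + y) z = \<kappa> x z + \<kappa> y z"
  unfolding killing_form_tr tr_def by (simp add: br_add_left br_closed basis_L rep_add sum.distrib)

lemma killing_scaleR_left: "x \<in> L \<Longrightarrow> z \<in> L \<Longrightarrow> \<kappa> (c *\<^sub>R x) z = c * \<kappa> x z"
  unfolding killing_form_tr tr_def by (simp add: br_scaleR_left br_closed basis_L rep_scaleR sum_distrib_left)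

lemma killing_add_right: "x \<in> L \<Longrightarrow> y \<in> L \<Longrightarrow> z \<in> L \<Longrightarrow> \<kappa> x (y + z) = \<kappa> x y + \<kappa> x z"
  unfolding killing_form_tr tr_def
  by (simp add: br_add_left br_add_right br_closed basis_L rep_add sum.distrib)

lemma killing_scaleR_right: "x \<in> L \<Longrightarrow> z \<in> L \<Longrightarrow> \<kappa> x (c *\<^sub>R z) = c * \<kappa> x z"
  unfolding killing_form_tr tr_def
  by (simp add: br_scaleR_left br_scaleR_right br_closed basis_L rep_scaleR sum_distrib_left)

section \<open>Nondegeneracy of the Killing form\<close>

lemma eq_on_L:
  assumes "\<And>x y. x \<in> L \<Longrightarrow> y \<in> L \<Longrightarrow> S (x + y) = S x + S y" "\<And>c x. x \<in> L \<Longrightarrow> S (c *\<^sub>R x) = c *\<^sub>R S x"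
    and "\<And>x y. x \<in> L \<Longrightarrow> y \<in> L \<Longrightarrow> T (x + y) = T x + T y" "\<And>c x. x \<in> L \<Longrightarrow> T (c *\<^sub>R x) = c *\<^sub>R T x"
    and eq: "\<And>b. b \<in> basis \<Longrightarrow> S b = (T b :: 'w::real_vector)"
    and fin: "finite basis" and x: "x \<in> L"
  shows "S x = T x"
proof -
  have sub: "basis \<subseteq> L" using basis_L by blast
  have "S (\<Sum>c\<in>basis. rep x c *\<^sub>R c) = T (\<Sum>c\<in>basis. rep x c *\<^sub>R c)"
    using linear_on_sum[of S basis "rep x", OF assms(1,2) sub]
      linear_on_sum[of T basis "rep x", OF assms(3,4) sub] eq by simp
  then show ?thesis using rep_expand[OF fin x] by simp
qed

text \<open>\<open>?F\<close> is the Gram matrix of the Killing form acting on \<open>L\<close>.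
  Nondegeneracy makes it injective, hence surjective by dimension, and a preimage of the vector with
  coefficients \<open>l b\<close> represents \<open>l\<close>.\<close>

lemma killing_represents:
  assumes fin: "finite basis" and ss: "semisimple_lie_algebra L br"
    and add: "\<And>x y. x \<in> L \<Longrightarrow> y \<in> L \<Longrightarrow> l (x + y) = l x + l y"
    and scale: "\<And>c x. x \<in> L \<Longrightarrow> l (c *\<^sub>R x) = c * l x"
  obtains x where "x \<in> L" "\<And>y. y \<in> L \<Longrightarrow> \<kappa> x y = l y"
proof -
  let ?F = "\<lambda>x. \<Sum>c\<in>basis. \<kappa> x c *\<^sub>R c"
  \<comment> \<open>Linearity of \<open>?F\<close> is known on \<open>L\<close> only;
    \<open>h\<close> is a globally linear map with the same values on the basis, to which the facts
    on images of independent sets apply.\<close>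
  obtain h where h: "linear h" "\<And>b. b \<in> basis \<Longrightarrow> h b = ?F b"
    using linear_independent_extend[OF basis(1), of ?F] by blast
  have hF: "h x = ?F x" if "x \<in> L" for x
  proof (rule eq_on_L[where S = h and T = ?F, OF _ _ _ _ h(2) fin that])
    show "h (x + y) = h x + h y" "h (c *\<^sub>R x) = c *\<^sub>R h x" for x y c
      using h(1) by (simp_all add: linear_add linear_scale)
    show "?F (x + y) = ?F x + ?F y" if "x \<in> L" "y \<in> L" for x y
      using that by (simp add: killing_add_left basis_L scaleR_add_left sum.distrib)
    show "?F (c *\<^sub>R x) = c *\<^sub>R ?F x" if "x \<in> L" for x c
      using that by (simp add: killing_scaleR_left basis_L scaleR_sum_right)
  qed
  have coeff: "\<forall>b\<in>basis. k b = 0" if "(\<Sum>b\<in>basis. k b *\<^sub>R b) = 0" for k :: "'v \<Rightarrow> real"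
    using independentD[OF basis(1) fin subset_refl that] by blast
  have extend: "\<kappa> x y = l y" if x: "x \<in> L" and eq: "\<And>b. b \<in> basis \<Longrightarrow> \<kappa> x b = l b"
    and l: "\<And>x y. x \<in> L \<Longrightarrow> y \<in> L \<Longrightarrow> l (x + y) = l x + l y" "\<And>c x. x \<in> L \<Longrightarrow> l (c *\<^sub>R x) = c * l x"
    and y: "y \<in> L" for x y l
    by (rule eq_on_L[where S = "\<kappa> x" and T = l, OF _ _ _ _ eq fin y])
       (simp_all add: x l killing_add_right killing_scaleR_right)
  have "inj_on h (span basis)"
  proof (rule inj_onI)
    fix x y assume xy: "x \<in> span basis" "y \<in> span basis" "h x = h y"
    then have L: "x - y \<in> L" using basis(2) diff_L by simp
    have "h (x - y) = 0" using xy h(1) by (simp add: linear_diff)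
    then have "(\<Sum>c\<in>basis. \<kappa> (x - y) c *\<^sub>R c) = 0" using hF[OF L] by simp
    from coeff[OF this] have "\<kappa> (x - y) z = 0" if "z \<in> L" for z
      using extend[OF L, of "\<lambda>_. 0"] that by simp
    then have "x - y = 0" using ss L unfolding semisimple_lie_algebra_def by blast
    then show "x = y" by simp
  qed
  then have ind: "independent (h ` basis)" and inj: "inj_on h basis"
    using linear_independent_injective_image[OF h(1) basis(1)] inj_on_subset[OF _ span_superset] by auto
  have "?F x \<in> L" for x
    using subspace_sum[OF subspace_L, of basis "\<lambda>c. \<kappa> x c *\<^sub>R c"] basis_L scaleR_L by blast
  then have sub: "h ` basis \<subseteq> span basis" using hF basis_L basis(2) by auto
  have "L \<subseteq> span (h ` basis)"
  proof
    fix y assume y: "y \<in> L"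
    show "y \<in> span (h ` basis)"
    \<comment> \<open>Dimension count: \<open>h\<close> maps the basis to equally many independent
      vectors of \<open>L\<close>, and a vector outside their span would give one independent vector
      too many.\<close>
    proof (rule ccontr)
      assume ny: "y \<notin> span (h ` basis)"
      then have "independent (insert y (h ` basis))" by (rule independent_insertI[OF _ ind])
      moreover have "insert y (h ` basis) \<subseteq> span basis" using sub y basis(2) by simp
      ultimately have "card (insert y (h ` basis)) \<le> card basis"
        using independent_span_bound[OF fin] by blast
      moreover have "y \<notin> h ` basis" using ny span_base[of y "h ` basis"] by blast
      ultimately show False using fin card_image[OF inj] by simp
    qed
  qed
  then have surj: "L \<subseteq> h ` L" using basis(2) linear_span_image[OF h(1), of basis] by simp
  have "(\<Sum>b\<in>basis. l b *\<^sub>R b) \<in> L"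
    using subspace_sum[OF subspace_L, of basis "\<lambda>b. l b *\<^sub>R b"] basis_L scaleR_L by blast
  from subsetD[OF surj this] obtain x where x: "x \<in> L" "h x = (\<Sum>b\<in>basis. l b *\<^sub>R b)"
    by (metis imageE)
  have "(\<Sum>b\<in>basis. (\<kappa> x b - l b) *\<^sub>R b) = 0"
    using hF[OF x(1)] x(2) by (simp add: scaleR_diff_left sum_subtractf)
  from coeff[OF this] have "\<kappa> x b = l b" if "b \<in> basis" for b using that by simp
  then have "\<kappa> x y = l y" if "y \<in> L" for y
    by (rule extend[OF x(1) _ add scale that])
  then show ?thesis by (rule that[OF x(1)])
qed

text \<open>An infinite basis would make every trace in the Killing form an infinite sum, which is 0.\<close>

lemma semisimple_finite:
  assumes ss: "semisimple_lie_algebra L br"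
  shows "finite basis"
proof (rule ccontr)
  assume inf: "infinite basis"
  then have "\<kappa> x y = 0" for x y unfolding killing_form_tr tr_def by simp
  then have "L \<subseteq> {0}" using ss unfolding semisimple_lie_algebra_def by blast
  then have "basis \<subseteq> {0}" using basis_L by blast
  then show False using inf finite_subset by blast
qed

lemma semisimple_character_zero:
  assumes ss: "semisimple_lie_algebra L br"
    and add: "\<And>x y. x \<in> L \<Longrightarrow> y \<in> L \<Longrightarrow> l (x + y) = l x + l y"
    and scale: "\<And>c x. x \<in> L \<Longrightarrow> l (c *\<^sub>R x) = c * l x"
    and vanish: "\<And>x y. x \<in> L \<Longrightarrow> y \<in> L \<Longrightarrow> l (br x y) = 0"
    and w: "w \<in> L"
  shows "l w = 0"
proof -
  note fin = semisimple_finite[OF ss]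
  obtain x where x: "x \<in> L" "\<And>y. y \<in> L \<Longrightarrow> \<kappa> x y = l y"
    by (rule killing_represents[OF fin ss, of l]) (use add scale in auto)
  have "br x y = 0" if y: "y \<in> L" for y
  proof -
    have "\<kappa> (br x y) z = 0" if z: "z \<in> L" for z
      using killing_invariant[OF fin x(1) y z] x(2)[OF br_closed[OF y z]] vanish[OF y z] by simp
    then show ?thesis using ss br_closed[OF x(1) y] unfolding semisimple_lie_algebra_def by blast
  qed
  \<comment> \<open>The adjoint map of \<open>x\<close> vanishes, so the trace defining
    \<open>\<kappa> x w\<close> is a sum of zeros, and \<open>l w\<close> equals it.\<close>
  then have "\<kappa> x w = 0"
    unfolding killing_form_tr tr_def using w by (simp add: br_closed basis_L rep_zero)
  then show ?thesis using x(2)[OF w] by simp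
qed

end

section \<open>Orthogonal projections\<close>

locale inner_on =
  fixes T :: "'v::real_vector set" and ip :: "'v \<Rightarrow> 'v \<Rightarrow> real"
  assumes subspace_T: "subspace T"
    and sym: "x \<in> T \<Longrightarrow> y \<in> T \<Longrightarrow> ip x y = ip y x"
    and add_left: "x \<in> T \<Longrightarrow> y \<in> T \<Longrightarrow> z \<in> T \<Longrightarrow> ip (x + y) z = ip x z + ip y z"
    and scale_left: "x \<in> T \<Longrightarrow> y \<in> T \<Longrightarrow> ip (c *\<^sub>R x) y = c * ip x y"
    and pos: "x \<in> T \<Longrightarrow> x \<noteq> 0 \<Longrightarrow> ip x x > 0"
begin

lemma zero_T: "0 \<in> T" and add_T: "x \<in> T \<Longrightarrow> y \<in> T \<Longrightarrow> x + y \<in> T"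
  and scale_T: "x \<in> T \<Longrightarrow> c *\<^sub>R x \<in> T" and diff_T: "x \<in> T \<Longrightarrow> y \<in> T \<Longrightarrow> x - y \<in> T"
  using subspace_0 subspace_add subspace_scale subspace_diff subspace_T by auto

lemma diff_left: "x \<in> T \<Longrightarrow> y \<in> T \<Longrightarrow> z \<in> T \<Longrightarrow> ip (x - y) z = ip x z - ip y z"
  using add_left[of x "(-1) *\<^sub>R y" z] scale_left[of y z "-1"] scale_T[of y "-1"] by simp

lemma zero_left: "y \<in> T \<Longrightarrow> ip 0 y = 0"
  using scale_left[of 0 y 0] zero_T by simp

lemma add_right: "x \<in> T \<Longrightarrow> y \<in> T \<Longrightarrow> z \<in> T \<Longrightarrow> ip z (x + y) = ip z x + ip z y"
  using add_left[of x y z] sym add_T by metis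

lemma scale_right: "x \<in> T \<Longrightarrow> y \<in> T \<Longrightarrow> ip y (c *\<^sub>R x) = c * ip y x"
  using scale_left[of x y c] sym scale_T by metis

text \<open>Gram-Schmidt by induction on the spanning set. \<open>B\<close> need not be independent:
  values at a point of independent fields are used later, and the case \<open>b - c = 0\<close>
  covers a vector that adds nothing.\<close>

lemma projection_exists:
  assumes "finite B" "B \<subseteq> T" "u \<in> T"
  shows "\<exists>v\<in>span B. \<forall>w\<in>span B. ip (u - v) w = 0"
  using assms
proof (induction B arbitrary: u rule: finite_induct)
  case empty
  have "ip (u - 0) 0 = 0" using zero_left[OF empty(2)] sym[OF empty(2) zero_T] by simp
  then show ?case by simp
next
  case (insert b B)
  have bT: "b \<in> T" and BT: "B \<subseteq> T" using insert.prems by auto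
  have sT: "span B \<subseteq> T" using span_minimal[OF BT subspace_T] .
  obtain c where c: "c \<in> span B" "\<And>w. w \<in> span B \<Longrightarrow> ip (b - c) w = 0"
    using insert.IH[OF BT bT] by blast
  obtain v where v: "v \<in> span B" "\<And>w. w \<in> span B \<Longrightarrow> ip (u - v) w = 0"
    using insert.IH[OF BT insert.prems(2)] by blast
  have cT: "c \<in> T" and vT: "v \<in> T" using c v sT by auto
  show ?case
  proof (cases "b - c = 0")
    case True
    then have "span (insert b B) = span B" using c(1) by (simp add: span_redundant)
    then show ?thesis using v by auto
  next
    case False
    define d where "d = b - c"
    have d: "d \<in> T" "ip d d > 0" using pos[OF diff_T[OF bT cT] False] diff_T[OF bT cT] unfolding d_def by auto
    \<comment> \<open>The coefficient that makes the new remainder orthogonal to \<open>d\<close>,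
      the part of \<open>b\<close> orthogonal to \<open>span B\<close>.\<close>
    define s where "s = ip (u - v) d / ip d d"
    have uv: "u - v \<in> T" using diff_T insert.prems(2) vT by blast
    have "b \<in> span (insert b B)" "c \<in> span (insert b B)" "v \<in> span (insert b B)"
      using c(1) v(1) span_mono[of B "insert b B"] by (auto intro: span_base)
    then have mem: "v + s *\<^sub>R d \<in> span (insert b B)"
      unfolding d_def by (intro span_add span_scale span_diff)
    moreover have "ip (u - (v + s *\<^sub>R d)) w = 0" if w: "w \<in> span (insert b B)" for w
    proof -
      obtain t where t: "w - t *\<^sub>R b \<in> span B" using span_breakdown_eq w by blast
      define y where "y = w - t *\<^sub>R b + t *\<^sub>R c"
      have y: "y \<in> span B" unfolding y_def using t c(1) by (intro span_add span_scale)
      have yT: "y \<in> T" using y sT by auto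
      have w_eq: "w = y + t *\<^sub>R d" unfolding y_def d_def by (simp add: scaleR_diff_right)
      have dy: "ip d y = 0" unfolding d_def by (rule c(2)[OF y])
      have "ip (u - (v + s *\<^sub>R d)) w = ip ((u - v) - s *\<^sub>R d) (y + t *\<^sub>R d)" by (simp add: w_eq diff_diff_eq)
      also have "\<dots> = ip (u - v) (y + t *\<^sub>R d) - s * ip d (y + t *\<^sub>R d)"
        using uv d(1) yT by (simp add: diff_left scale_left add_T scale_T)
      also have "\<dots> = t * ip (u - v) d - s * (t * ip d d)"
        using uv d(1) yT v(2)[OF y] dy by (simp add: add_right scale_right scale_T)
      also have "\<dots> = 0" using d(2) by (simp add: s_def)
      finally show ?thesis .
    qed
    ultimately show ?thesis by blast
  qed
qed

end

section \<open>The conformal weight is a character\<close>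

text \<open>
  Conformality says that \<open>br W\<close>, projected to the orthogonal complement of \<open>k\<close>, is \<open>l W\<close> times
  the identity plus a skew map; the commutator of two such maps is skew.
\<close>

lemma conformal_weight_lie_bracket:
  assumes L: "lie_algebra_on L br" and k: "k \<subseteq> L" "\<And>x y. x \<in> k \<Longrightarrow> y \<in> k \<Longrightarrow> br x y \<in> k"
    and sym: "\<And>x y. x \<in> L \<Longrightarrow> y \<in> L \<Longrightarrow> ip x y = ip y x"
    and add: "\<And>x y z. x \<in> L \<Longrightarrow> y \<in> L \<Longrightarrow> z \<in> L \<Longrightarrow> ip (x + y) z = ip x z + ip y z"
    and decompose: "\<And>y. y \<in> L \<Longrightarrow> \<exists>c\<in>k. \<forall>w\<in>k. ip (y - c) w = 0"
    and conformal: "\<And>w x y. w \<in> k \<Longrightarrow> x \<in> L \<Longrightarrow> \<forall>z\<in>k. ip x z = 0 \<Longrightarrow> y \<in> L \<Longrightarrow> \<forall>z\<in>k. ip y z = 0 \<Longrightarrow>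
      ip (br w x) y + ip x (br w y) = 2 * l w * ip x y"
    and x: "x \<in> L" "\<forall>z\<in>k. ip x z = 0" "ip x x \<noteq> 0"
    and uw: "u \<in> k" "w \<in> k"
  shows "l (br u w) = (0::real)"
proof -
  interpret lie_algebra_on L br by (rule L)
  have kL: "z \<in> L" if "z \<in> k" for z using that k(1) by blast
  \<comment> \<open>Since \<open>x\<close> is horizontal, every component in \<open>k\<close>
    disappears when paired with \<open>x\<close>.\<close>
  have perp: "ip z x = 0" if "z \<in> k" for z using x that sym kL by metis
  \<comment> \<open>Conformality on the diagonal: the skew part contributes nothing, so a single
    horizontal vector \<open>x\<close> reads off the weight \<open>l v\<close>.\<close>
  have self: "ip (br v x) x = l v * ip x x" if v: "v \<in> k" for v
    using conformal[OF v x(1,2) x(1,2)] sym[OF x(1) br_closed[OF kL[OF v] x(1)]] by simp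
  have dec: "\<exists>a c. br v x = a + c \<and> c \<in> k \<and> a \<in> L \<and> (\<forall>z\<in>k. ip a z = 0)" if v: "v \<in> k" for v
  proof -
    obtain c where c: "c \<in> k" "\<forall>z\<in>k. ip (br v x - c) z = 0"
      using decompose[OF br_closed[OF kL[OF v] x(1)]] by blast
    then show ?thesis using diff_L[OF br_closed[OF kL[OF v] x(1)] kL[OF c(1)]]
      by (intro exI[of _ "br v x - c"] exI[of _ c]) simp
  qed
  obtain au cu where u: "br u x = au + cu" "cu \<in> k" "au \<in> L" "\<forall>z\<in>k. ip au z = 0" using dec[OF uw(1)] by blast
  obtain aw cw where w: "br w x = aw + cw" "cw \<in> k" "aw \<in> L" "\<forall>z\<in>k. ip aw z = 0" using dec[OF uw(2)] by blast
  \<comment> \<open>The vertical part of \<open>br v' x\<close> stays in \<open>k\<close> under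
    \<open>br v\<close> and is lost against \<open>x\<close>; for the horizontal part
    \<open>a'\<close>, conformality moves \<open>br v\<close> to the other side. The result is
    symmetric in the two elements of \<open>k\<close>, so it cancels in the commutator.\<close>
  have nested: "ip (br v (br v' x)) x = 2 * l v * l v' * ip x x - ip a' a"
    if v: "v \<in> k" "br v x = a + c" "c \<in> k" "a \<in> L" "\<forall>z\<in>k. ip a z = 0"
      and v': "v' \<in> k" "br v' x = a' + c'" "c' \<in> k" "a' \<in> L" "\<forall>z\<in>k. ip a' z = 0"
    for v a c v' a' c'
  proof -
    have "ip (br v (br v' x)) x = ip (br v a' + br v c') x"
      using v v' kL by (simp add: br_add_right)
    also have "\<dots> = ip (br v a') x"
      using add[OF br_closed[OF kL[OF v(1)] v'(4)] br_closed[OF kL[OF v(1)] kL[OF v'(3)]] x(1)]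
        perp[OF k(2)[OF v(1) v'(3)]] by simp
    also have "\<dots> = 2 * l v * ip a' x - ip a' (br v x)"
      using conformal[OF v(1) v'(4,5) x(1,2)] by simp
    also have "ip a' x = l v' * ip x x"
      using self[OF v'(1)] add[OF v'(4) kL[OF v'(3)] x(1)] perp[OF v'(3)] v'(2) by simp
    also have "ip a' (br v x) = ip a' a"
    proof -
      have "ip a' (a + c) = ip (a + c) a'" by (rule sym[OF v'(4) add_L[OF v(4) kL[OF v(3)]]])
      also have "\<dots> = ip a a' + ip c a'" by (rule add[OF v(4) kL[OF v(3)] v'(4)])
      also have "\<dots> = ip a' a + ip a' c" using sym v(3,4) v'(4) kL by metis
      finally show ?thesis using v(2,3) v'(5) by simp
    qed
    finally show ?thesis by simp
  qed
  note uL = kL[OF uw(1)] and wL = kL[OF uw(2)]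
  have "l (br u w) * ip x x = ip (br (br u w) x) x"
    by (rule self[OF k(2)[OF uw], symmetric])
  also have "br (br u w) x = br u (br w x) - br w (br u x)" by (rule jacobi[OF uL wL x(1)])
  also have "ip \<dots> x = ip (br u (br w x)) x - ip (br w (br u x)) x"
    using add[of "br u (br w x) - br w (br u x)" "br w (br u x)" x] uL wL x(1) by (simp add: br_closed diff_L)
  also have "\<dots> = 0"
    using nested[OF uw(1) u uw(2) w] nested[OF uw(2) w uw(1) u] sym[OF u(3) w(3)] by simp
  finally show ?thesis using x(3) by simp
qed

section \<open>Left-invariant metrics\<close>

lemma riemannian_metric_inner_on:
  assumes M: "smooth_manifold M" and g: "riemannian_metric M g" and p: "p \<in> points M"
  shows "inner_on (tangent_space M p) (g p)"
proof
  show "subspace (tangent_space M p)" by (rule subspace_tangent_space[OF M p])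
  have lin: "g p (a *\<^sub>R u + b *\<^sub>R v) w = a * g p u w + b * g p v w"
    if "u \<in> tangent_space M p" "v \<in> tangent_space M p" "w \<in> tangent_space M p" for u v w a b
    using g p that unfolding riemannian_metric_def by blast
  fix x y z c assume x: "x \<in> tangent_space M p"
  show "x \<noteq> 0 \<Longrightarrow> g p x x > 0" using g p x unfolding riemannian_metric_def by blast
  assume y: "y \<in> tangent_space M p"
  show "g p x y = g p y x" using g p x y unfolding riemannian_metric_def by blast
  show "g p (c *\<^sub>R x) y = c * g p x y" using lin[OF x x y, of c 0] by simp
  assume z: "z \<in> tangent_space M p"
  show "g p (x + y) z = g p x z + g p y z" using lin[OF x y z, of 1 1] by simp
qed

text \<open>Both fields and the metric are carried along by left translation. This kills the
  derivative terms in metric compatibility and lets orthogonality at one point spread to the whole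
  group.\<close>

lemma left_invariant_metric_const:
  assumes G: "lie_group G M" and g: "left_invariant_metric G M g"
    and X: "X \<in> lie_algebra G M" and Y: "Y \<in> lie_algebra G M" and p: "p \<in> carrier G"
  shows "g p (X p) (Y p) = g \<one>\<^bsub>G\<^esub> (X \<one>\<^bsub>G\<^esub>) (Y \<one>\<^bsub>G\<^esub>)"
proof -
  interpret group G by (rule lie_group_group[OF G])
  have one: "\<one>\<^bsub>G\<^esub> \<in> points M" using lie_group_points[OF G] by simp
  let ?d = "differential M (\<lambda>x. p \<otimes>\<^bsub>G\<^esub> x) \<one>\<^bsub>G\<^esub>"
  have "X (p \<otimes>\<^bsub>G\<^esub> \<one>\<^bsub>G\<^esub>) = ?d (X \<one>\<^bsub>G\<^esub>)" "Y (p \<otimes>\<^bsub>G\<^esub> \<one>\<^bsub>G\<^esub>) = ?d (Y \<one>\<^bsub>G\<^esub>)"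
    using X Y p one_closed unfolding lie_algebra_def by blast+
  moreover have "g (p \<otimes>\<^bsub>G\<^esub> \<one>\<^bsub>G\<^esub>) (?d (X \<one>\<^bsub>G\<^esub>)) (?d (Y \<one>\<^bsub>G\<^esub>)) = g \<one>\<^bsub>G\<^esub> (X \<one>\<^bsub>G\<^esub>) (Y \<one>\<^bsub>G\<^esub>)"
    using g p vector_field_tangent[OF lie_algebra_vector_field[OF X] one]
      vector_field_tangent[OF lie_algebra_vector_field[OF Y] one]
    unfolding left_invariant_metric_def by blast
  ultimately show ?thesis using p by simp
qed

text \<open>Translate \<open>v\<close> back to the identity by the inverse of \<open>p\<close> and
  extend from there. It supplies a left-invariant field with a prescribed value at an arbitrary
  point.\<close>

lemma lie_algebra_through:
  assumes G: "lie_group G M" and p: "p \<in> carrier G" and v: "v \<in> tangent_space M p"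
  obtains X where "X \<in> lie_algebra G M" "X p = v"
proof -
  note M = lie_group_manifold[OF G] and pts = lie_group_points[OF G]
  interpret group G by (rule lie_group_group[OF G])
  have pM: "p \<in> points M" using p pts by simp
  let ?i = "inv\<^bsub>G\<^esub> p"
  have i: "?i \<in> carrier G" using p by simp
  have ip: "?i \<otimes>\<^bsub>G\<^esub> p = \<one>\<^bsub>G\<^esub>" using p by simp
  have "differential M (\<lambda>x. ?i \<otimes>\<^bsub>G\<^esub> x) p v \<in> tangent_space M \<one>\<^bsub>G\<^esub>"
    using differential_tangent[OF M M smooth_map_left_translation[OF G i] pM v] ip by simp
  then obtain X where X: "X \<in> lie_algebra G M" "X \<one>\<^bsub>G\<^esub> = differential M (\<lambda>x. ?i \<otimes>\<^bsub>G\<^esub> x) p v"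
    by (rule left_invariant_extension[OF G])
  have "X p = v"
  proof
    fix f
    show "X p f = v f"
    proof (cases "smooth_germ M p f")
      case f: True
      have f1: "smooth_germ M (p \<otimes>\<^bsub>G\<^esub> \<one>\<^bsub>G\<^esub>) f" using f p by simp
      have "X p f = X \<one>\<^bsub>G\<^esub> (\<lambda>x. f (p \<otimes>\<^bsub>G\<^esub> x))"
        using lie_algebra_apply[OF M X(1) p one_closed f1] p by simp
      also have "\<dots> = v (\<lambda>x. f (p \<otimes>\<^bsub>G\<^esub> (?i \<otimes>\<^bsub>G\<^esub> x)))"
        using smooth_germ_left_translation[OF G p one_closed f1]
        unfolding X(2) differential_def ip by (simp add: smooth_fun_at_iff_germ[OF M])
      also have "\<dots> = v f"
      proof (rule tangent_local[OF M v _ pM])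
        show "openin (mtop M) (points M)" by (simp add: points_def)
        show "f (p \<otimes>\<^bsub>G\<^esub> (?i \<otimes>\<^bsub>G\<^esub> q)) = f q" if "q \<in> points M" for q
          using that p pts by (simp flip: m_assoc)
      qed
      finally show ?thesis .
    next
      case False
      then show ?thesis
        using tangent_nonsmooth[OF M pM v] tangent_nonsmooth[OF M pM vector_field_tangent[OF lie_algebra_vector_field[OF X(1)] pM]]
        by simp
    qed
  qed
  then show ?thesis using that X(1) by blast
qed

section \<open>The Levi-Civita connection on left-invariant fields\<close>

lemma levi_civita_facts:
  assumes D: "levi_civita_connection M g D" and X: "vector_field M X" and Y: "vector_field M Y"
  shows levi_civita_vector_field: "vector_field M (D X Y)"
    and levi_civita_torsion: "D X Y - D Y X = lie_bracket M X Y"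
    and levi_civita_metric: "vector_field M Z \<Longrightarrow> p \<in> points M \<Longrightarrow>
      X p (\<lambda>q. g q (Y q) (Z q)) = g p (D X Y p) (Z p) + g p (Y p) (D X Z p)"
proof -
  have "\<forall>X Y. vector_field M X \<longrightarrow> vector_field M Y \<longrightarrow> vector_field M (D X Y)"
    using D unfolding levi_civita_connection_def affine_connection_def by (elim conjE)
  then show "vector_field M (D X Y)" using X Y by simp
  have "\<forall>X Y. vector_field M X \<longrightarrow> vector_field M Y \<longrightarrow> D X Y - D Y X = lie_bracket M X Y"
    using D unfolding levi_civita_connection_def by (elim conjE)
  then show "D X Y - D Y X = lie_bracket M X Y" using X Y by simp
  have "\<forall>X Y Z. vector_field M X \<longrightarrow> vector_field M Y \<longrightarrow> vector_field M Z \<longrightarrow>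
      (\<forall>p\<in>points M. X p (\<lambda>q. g q (Y q) (Z q)) = g p (D X Y p) (Z p) + g p (Y p) (D X Z p))"
    using D unfolding levi_civita_connection_def by (elim conjE)
  then show "vector_field M Z \<Longrightarrow> p \<in> points M \<Longrightarrow>
      X p (\<lambda>q. g q (Y q) (Z q)) = g p (D X Y p) (Z p) + g p (Y p) (D X Z p)"
    using X Y by simp
qed

lemma koszul_left_invariant:
  assumes G: "lie_group G M" and g: "left_invariant_metric G M g" and D: "levi_civita_connection M g D"
    and X: "X \<in> lie_algebra G M" and Y: "Y \<in> lie_algebra G M" and W: "W \<in> lie_algebra G M"
    and p: "p \<in> carrier G"
  shows "g p (D X Y p + D Y X p) (W p) =
    g p (lie_bracket M W X p) (Y p) + g p (X p) (lie_bracket M W Y p)"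
proof -
  note M = lie_group_manifold[OF G] and pts = lie_group_points[OF G]
  have pM: "p \<in> points M" using p pts by simp
  have rm: "riemannian_metric M g" using g unfolding left_invariant_metric_def by blast
  interpret inner_on "tangent_space M p" "g p" by (rule riemannian_metric_inner_on[OF M rm pM])
  note vX = lie_algebra_vector_field[OF X] and vY = lie_algebra_vector_field[OF Y]
    and vW = lie_algebra_vector_field[OF W]
  note vD = levi_civita_vector_field[OF D]
  note T = vector_field_tangent[OF _ pM]
  \<comment> \<open>The inner product being differentiated is constant, so covariant differentiation
    is skew on left-invariant fields.\<close>
  have compat: "g p (D A B p) (C p) + g p (B p) (D A C p) = 0"
    if A: "A \<in> lie_algebra G M" and B: "B \<in> lie_algebra G M" and C: "C \<in> lie_algebra G M" for A B C
  proof -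
    note vf = lie_algebra_vector_field[OF A] lie_algebra_vector_field[OF B] lie_algebra_vector_field[OF C]
    have "A p (\<lambda>q. g q (B q) (C q)) = A p (\<lambda>q. g \<one>\<^bsub>G\<^esub> (B \<one>\<^bsub>G\<^esub>) (C \<one>\<^bsub>G\<^esub>))"
    proof (rule tangent_local[OF M T[OF vf(1)] _ pM])
      show "openin (mtop M) (points M)" by (simp add: points_def)
      show "g q (B q) (C q) = g \<one>\<^bsub>G\<^esub> (B \<one>\<^bsub>G\<^esub>) (C \<one>\<^bsub>G\<^esub>)" if "q \<in> points M" for q
        using left_invariant_metric_const[OF G g B C] that pts by simp
    qed
    also have "\<dots> = 0" by (rule tangent_const[OF M T[OF vf(1)] pM])
    finally show ?thesis using levi_civita_metric[OF D vf pM] by simp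
  qed
  have torsion: "D A W p = D W A p - lie_bracket M W A p" if "vector_field M A" for A
  proof -
    have "D W A p - D A W p = lie_bracket M W A p"
      unfolding levi_civita_torsion[OF D vW that, symmetric] by simp
    then show ?thesis by (simp add: algebra_simps)
  qed
  have bT: "lie_bracket M W X p \<in> tangent_space M p" "lie_bracket M W Y p \<in> tangent_space M p"
    by (intro T lie_bracket_vector_field[OF M] vX vY vW)+
  \<comment> \<open>Compatibility moves the derivative from \<open>Y\<close> to \<open>W\<close>,
    and vanishing torsion then exchanges \<open>W\<close> with \<open>X\<close>, at the price of a
    bracket.\<close>
  have 1: "g p (D X Y p) (W p) = - (g p (Y p) (D W X p) - g p (Y p) (lie_bracket M W X p))"
    using compat[OF X Y W] diff_left[OF T[OF vD[OF vW vX]] bT(1) T[OF vY]]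
      sym[OF T[OF vY] diff_T[OF T[OF vD[OF vW vX]] bT(1)]] sym[OF T[OF vY] T[OF vD[OF vW vX]]]
      sym[OF T[OF vY] bT(1)]
    unfolding torsion[OF vX] by simp
  have 2: "g p (D Y X p) (W p) = - (g p (X p) (D W Y p) - g p (X p) (lie_bracket M W Y p))"
    using compat[OF Y X W] diff_left[OF T[OF vD[OF vW vY]] bT(2) T[OF vX]]
      sym[OF T[OF vX] diff_T[OF T[OF vD[OF vW vY]] bT(2)]] sym[OF T[OF vX] T[OF vD[OF vW vY]]]
      sym[OF T[OF vX] bT(2)]
    unfolding torsion[OF vY] by simp
  \<comment> \<open>Skewness of \<open>D W\<close> cancels the remaining covariant derivatives in
    the sum of the two preceding identities, leaving only brackets.\<close>
  have 3: "g p (Y p) (D W X p) + g p (X p) (D W Y p) = 0"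
    using compat[OF W X Y] sym[OF T[OF vY] T[OF vD[OF vW vX]]] by simp
  show ?thesis
    using 1 2 3 add_left[OF T[OF vD[OF vX vY]] T[OF vD[OF vY vX]] T[OF vW]] sym[OF T[OF vY] bT(1)]
    by simp
qed

lemma generated_distribution_subspace:
  assumes "subspace \<k>"
  shows "generated_distribution \<k> p = (\<lambda>X. X p) ` \<k>"
proof -
  have "linear (\<lambda>X :: 'a vfield. X p)" by (rule linearI) (simp_all add: scaleR_fun_def)
  then have "subspace ((\<lambda>X. X p) ` \<k>)" by (rule linear_subspace_image[OF _ assms])
  then show ?thesis unfolding generated_distribution_def by (simp add: span_eq_iff)
qed

section \<open>The conformal field vanishes\<close>

theorem theorem1p2:
  fixes G :: "('a, 'm) monoid_scheme"
    and M :: "('a, 'e::euclidean_space) manifold"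
    and g :: "'a metric_tensor"
    and D :: "'a vfield \<Rightarrow> 'a vfield \<Rightarrow> 'a vfield"
    and K :: "'a set"
    and N :: "('a, 'f::euclidean_space) manifold"
  assumes "lie_group G M"
    and "left_invariant_metric G M g"
    and "levi_civita_connection M g D"
    and "lie_subgroup G M K N"
    and "semisimple_lie_algebra (lie_subalgebra G M N) (lie_bracket M)"
    and "mdim M = mdim N + 2"
    and "conformal_foliation M g D (generated_distribution (lie_subalgebra G M N))"
  shows "riemannian_foliation M g D (generated_distribution (lie_subalgebra G M N))"
proof -
  note G = assms(1) and g = assms(2) and D = assms(3) and K = assms(4) and ss = assms(5)
  define \<k> where "\<k> = lie_subalgebra G M N"
  define \<V> where "\<V> = generated_distribution \<k>"
  note M = lie_group_manifold[OF G] and pts = lie_group_points[OF G]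
  have rm: "riemannian_metric M g" using g unfolding left_invariant_metric_def by blast
  have N: "smooth_manifold N" "\<one>\<^bsub>G\<^esub> \<in> points N"
    using K lie_group_manifold lie_group_points subgroup.one_closed unfolding lie_subgroup_def by fastforce+
  have subk: "subspace \<k>" unfolding \<k>_def by (rule subspace_lie_subalgebra[OF G N])
  have kL: "\<k> \<subseteq> lie_algebra G M" unfolding \<k>_def lie_subalgebra_def by blast
  have kbr: "lie_bracket M X Y \<in> \<k>" if "X \<in> \<k>" "Y \<in> \<k>" for X Y
    using lie_subalgebra_lie_bracket[OF G K] that unfolding \<k>_def by blast
  have V: "\<V> p = (\<lambda>X. X p) ` \<k>" for p
    unfolding \<V>_def by (rule generated_distribution_subspace[OF subk])
  note vf = lie_algebra_vector_field
  interpret L: lie_algebra_on "lie_algebra G M" "lie_bracket M"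
    by standard (auto intro: lie_algebra_lie_bracket[OF G] subspace_lie_algebra[OF G] lie_bracket_skew
        lie_bracket_add_left[OF M vf vf vf] lie_bracket_scaleR_left[OF M vf vf] lie_bracket_jacobi[OF M vf vf vf])
  interpret k: lie_algebra_on \<k> "lie_bracket M"
    using kL by unfold_locales
      (auto intro: kbr subk lie_bracket_skew L.br_add_left L.br_scaleR_left L.jacobi)
  have ssk: "semisimple_lie_algebra \<k> (lie_bracket M)" using ss unfolding \<k>_def .
  obtain Z where Z: "section_of M \<V> Z" "conformal_with M g D \<V> Z"
    using assms(7) unfolding conformal_foliation_def \<V>_def \<k>_def by blast
  \<comment> \<open>A nonzero horizontal vector at \<open>p\<close> is needed: without one,
    conformality would put no constraint on \<open>Z p\<close>.\<close>
  have Z0: "Z p = 0"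
    if X0: "section_of M (orthogonal_distribution M g \<V>) X0" and p: "p \<in> points M" and nz: "X0 p \<noteq> 0" for X0 p
  proof -
    interpret inner_on "tangent_space M p" "g p" by (rule riemannian_metric_inner_on[OF M rm p])
    have pG: "p \<in> carrier G" using p pts by simp
    have LT: "Y p \<in> tangent_space M p" if "Y \<in> lie_algebra G M" for Y
      by (rule vector_field_tangent[OF vf[OF that] p])
    \<comment> \<open>The values at \<open>p\<close> of a basis of \<open>\<k>\<close> span
      \<open>\<V> p\<close>; this basis is finite by semisimplicity, so Gram-Schmidt
      applies.\<close>
    have proj: "\<exists>v\<in>\<V> p. \<forall>w\<in>\<V> p. g p (u - v) w = 0" if u: "u \<in> tangent_space M p" for u
    proof -
      have "span ((\<lambda>X. X p) ` k.basis) = (\<lambda>X. X p) ` span k.basis"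
        by (rule linear_span_image) (rule linearI, simp_all add: scaleR_fun_def)
      then have "span ((\<lambda>X. X p) ` k.basis) = \<V> p" unfolding V k.basis(2) .
      moreover have "\<exists>v\<in>span ((\<lambda>X. X p) ` k.basis). \<forall>w\<in>span ((\<lambda>X. X p) ` k.basis). g p (u - v) w = 0"
        using k.semisimple_finite[OF ssk] k.basis_L kL LT by (intro projection_exists u) auto
      ultimately show ?thesis by simp
    qed
    have VT: "v \<in> tangent_space M p" if "v \<in> \<V> p" for v using that kL LT unfolding V by blast
    have subV: "subspace (\<V> p)" unfolding \<V>_def generated_distribution_def by simp
    \<comment> \<open>The projection is a definite description, so uniqueness is required: the
      difference of two candidates lies in \<open>\<V> p\<close> and is orthogonal to
      itself.\<close>
    have projection: "orthogonal_projection g \<V> p u \<in> \<V> p \<and>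
        (\<forall>w\<in>\<V> p. g p (u - orthogonal_projection g \<V> p u) w = 0)" if u: "u \<in> tangent_space M p" for u
    proof -
      obtain v where v: "v \<in> \<V> p" "\<forall>w\<in>\<V> p. g p (u - v) w = 0" using proj[OF u] by blast
      have "\<exists>!v. v \<in> \<V> p \<and> (\<forall>w\<in>\<V> p. g p (u - v) w = 0)"
      proof (rule ex1I)
        show "v \<in> \<V> p \<and> (\<forall>w\<in>\<V> p. g p (u - v) w = 0)" using v by blast
        fix v' assume v': "v' \<in> \<V> p \<and> (\<forall>w\<in>\<V> p. g p (u - v') w = 0)"
        have d: "v' - v \<in> \<V> p" using subspace_diff[OF subV] v v' by blast
        have "g p ((u - v) - (u - v')) (v' - v) = 0"
          using diff_left[of "u - v" "u - v'" "v' - v"] d v v' u VT diff_T by simp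
        then have "g p (v' - v) (v' - v) = 0" by simp
        then show "v' = v" using pos[OF VT[OF d]] by force
      qed
      from theI'[OF this] show ?thesis unfolding orthogonal_projection_def .
    qed
    \<comment> \<open>Metric and weight are frozen at \<open>p\<close> and regarded as functions of
      fields; on left-invariant fields \<open>ip\<close> does not depend on \<open>p\<close>,
      whereas \<open>l\<close> may.\<close>
    define ip where "ip X Y = g p (X p) (Y p)" for X Y :: "'a vfield"
    define l where "l W = g p (Z p) (W p)" for W :: "'a vfield"
    have ZV: "Z p \<in> \<V> p" using Z(1) p unfolding section_of_def by blast
    \<comment> \<open>Conformality is stated for sections on all of \<open>M\<close>; constancy of
      the metric turns horizontality at \<open>p\<close> into horizontality everywhere.\<close>
    have horizontal: "section_of M (orthogonal_distribution M g \<V>) X"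
      if X: "X \<in> lie_algebra G M" "\<forall>W\<in>\<k>. ip X W = 0" for X
    proof -
      have "g q (X q) (W q) = 0" if "W \<in> \<k>" "q \<in> carrier G" for W q
        using left_invariant_metric_const[OF G g X(1), of W] that kL X(2) pG unfolding ip_def by force
      then show ?thesis
        unfolding section_of_def orthogonal_distribution_def V
        using vf[OF X(1)] vector_field_tangent[OF vf[OF X(1)]] pts by auto
    qed
    have conformal: "ip (lie_bracket M W X) Y + ip X (lie_bracket M W Y) = 2 * l W * ip X Y"
      if W: "W \<in> \<k>" and X: "X \<in> lie_algebra G M" "\<forall>W\<in>\<k>. ip X W = 0"
        and Y: "Y \<in> lie_algebra G M" "\<forall>W\<in>\<k>. ip Y W = 0" for W X Y
    proof -
      let ?u = "D X Y p + D Y X p"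
      have u: "?u \<in> tangent_space M p"
        by (intro add_T vector_field_tangent[OF _ p] levi_civita_vector_field[OF D] vf[OF X(1)] vf[OF Y(1)])
      let ?v = "orthogonal_projection g \<V> p ?u"
      have "(1 / 2) *\<^sub>R ?v = ip X Y *\<^sub>R Z p"
        using Z(2) horizontal[OF X] horizontal[OF Y] p
        unfolding conformal_with_def second_fundamental_form_def ip_def by blast
      \<comment> \<open>Clearing the 1/2 of the second fundamental form is the origin of the factor
        2 in \<open>2 * l W * ip X Y\<close>.\<close>
      then have "2 *\<^sub>R ((1 / 2) *\<^sub>R ?v) = 2 *\<^sub>R (ip X Y *\<^sub>R Z p)" by simp
      then have v: "?v = (2 * ip X Y) *\<^sub>R Z p" by simp
      have WV: "W p \<in> \<V> p" unfolding V using W by blast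
      have "g p (?u - ?v) (W p) = 0" using projection[OF u] WV by blast
      then have "g p ?u (W p) = g p ?v (W p)"
        using diff_left[OF u VT VT[OF WV]] projection[OF u] by simp
      also have "\<dots> = 2 * ip X Y * l W"
        unfolding v l_def by (rule scale_left[OF VT[OF ZV] VT[OF WV]])
      finally show ?thesis
        using koszul_left_invariant[OF G g D X(1) Y(1) subsetD[OF kL W] pG] unfolding ip_def by simp
    qed
    have decompose: "\<exists>C\<in>\<k>. \<forall>W\<in>\<k>. ip (Y - C) W = 0" if Y: "Y \<in> lie_algebra G M" for Y
    proof -
      obtain v where v: "v \<in> \<V> p" "\<forall>w\<in>\<V> p. g p (Y p - v) w = 0" using proj[OF LT[OF Y]] by blast
      then obtain C where "C \<in> \<k>" "v = C p" unfolding V by blast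
      then show ?thesis using v(2) unfolding V ip_def by (intro bexI[of _ C]) auto
    qed
    have X0p: "X0 p \<in> tangent_space M p" "\<forall>v\<in>\<V> p. g p (X0 p) v = 0"
      using X0 p unfolding section_of_def orthogonal_distribution_def by auto
    \<comment> \<open>The given section need not be left-invariant; only its value at
      \<open>p\<close> matters, and a left-invariant field with that value replaces it.\<close>
    obtain X where X: "X \<in> lie_algebra G M" "X p = X0 p" by (rule lie_algebra_through[OF G pG X0p(1)])
    have Xk: "\<forall>W\<in>\<k>. ip X W = 0" using X0p(2) X(2) unfolding ip_def V by auto
    have Xnz: "ip X X \<noteq> 0" using pos[OF X0p(1) nz] X(2) unfolding ip_def by simp
    have bracket: "l (lie_bracket M U W) = 0" if "U \<in> \<k>" "W \<in> \<k>" for U W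
    proof (rule conformal_weight_lie_bracket[where L = "lie_algebra G M" and k = \<k> and ip = ip and l = l
          and br = "lie_bracket M" and x = X, OF L.lie_algebra_on_axioms kL kbr _ _ decompose conformal X(1) Xk Xnz that])
      show "ip X Y = ip Y X" if "X \<in> lie_algebra G M" "Y \<in> lie_algebra G M" for X Y
        unfolding ip_def by (rule sym[OF LT[OF that(1)] LT[OF that(2)]])
      show "ip (X + Y) Z = ip X Z + ip Y Z"
        if "X \<in> lie_algebra G M" "Y \<in> lie_algebra G M" "Z \<in> lie_algebra G M" for X Y Z
        using add_left[OF LT[OF that(1)] LT[OF that(2)] LT[OF that(3)]] unfolding ip_def by simp
    qed
    have l0: "l W = 0" if "W \<in> \<k>" for W
    proof (rule k.semisimple_character_zero[where l = l, OF ssk _ _ bracket that])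
      show "l (X + Y) = l X + l Y" if "X \<in> \<k>" "Y \<in> \<k>" for X Y
        using add_right[OF LT[OF subsetD[OF kL that(1)]] LT[OF subsetD[OF kL that(2)]] VT[OF ZV]] unfolding l_def by simp
      show "l (c *\<^sub>R X) = c * l X" if "X \<in> \<k>" for c X
        using scale_right[OF LT[OF subsetD[OF kL that]] VT[OF ZV]] unfolding l_def by (simp add: scaleR_fun_def[of c X])
    qed
    \<comment> \<open>\<open>Z p\<close> is vertical, so it is the value of some \<open>W\<close> in
      \<open>\<k>\<close>, and for that \<open>W\<close> the number \<open>l W\<close> is the
      squared length of \<open>Z p\<close>.\<close>
    obtain W where "W \<in> \<k>" "Z p = W p" using ZV unfolding V by blast
    then have "g p (Z p) (Z p) = 0" using l0[of W] unfolding l_def by simp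
    then show ?thesis using pos[OF VT[OF ZV]] by force
  qed
  have "second_fundamental_form g D \<V> X Y p = g p (X p) (Y p) *\<^sub>R (0 :: 'a vfield) p"
    if X: "section_of M (orthogonal_distribution M g \<V>) X"
      and Y: "section_of M (orthogonal_distribution M g \<V>) Y" and p: "p \<in> points M" for X Y p
  proof -
    interpret inner_on "tangent_space M p" "g p" by (rule riemannian_metric_inner_on[OF M rm p])
    have "Y p \<in> tangent_space M p" using Y p unfolding section_of_def orthogonal_distribution_def by auto
    \<comment> \<open>If \<open>X p = 0\<close> the coefficient vanishes; otherwise \<open>X\<close>
      itself is the horizontal section that forces \<open>Z p = 0\<close>.\<close>
    then have "g p (X p) (Y p) *\<^sub>R Z p = 0"
      using Z0[OF X p] zero_left[of "Y p"] by (cases "X p = 0") auto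
    then show ?thesis using Z(2) X Y p unfolding conformal_with_def by simp
  qed
  then show ?thesis
    unfolding riemannian_foliation_def conformal_with_def \<V>_def \<k>_def by blast
qed

end
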